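(* Let $q>6^4$ be a prime power and let $\mathcal K$ be a maximal arc of degree $4$ in $\mathrm{PG}(2,q)$, i.e. a set of $3q+4$ points such that every line of $\mathrm{PG}(2,q)$ meets it in $0$ or $4$ points. Suppose $\Gamma$ is a plane algebraic curve defined over $\mathrm{GF}(q)$ containing all the points of $\mathcal K$. If $\deg\Gamma=7$, then $\Gamma$ consists of three pairwise disjoint (non-degenerate) conics, all with the same nucleus $N$, together with a line through $N$.
   Context: Such maximal arcs exist only for $q$ even. For $q$ even, all tangent lines of a non-degenerate conic of $\mathrm{PG}(2,q)$ pass through a common point, called its nucleus. *)

theory Defs
  imports
    "HOL-Analysis.Cartesian_Space"
    "HOL-Library.Poly_Mapping"
    "HOL-Algebra.Algebraic_Closure_Type"
begin

(* PG(2,q) is the projective plane of the vector space 'a^3, where the finite field 'a is GF(q):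
   points and lines are the subspaces of dimension 1 and 2, and incidence is inclusion. *)

definition pg_points :: "('a::field ^ 3) set set" where
  "pg_points = {P. vec.subspace P \<and> vec.dim P = 1}"

definition pg_lines :: "('a::field ^ 3) set set" where
  "pg_lines = {l. vec.subspace l \<and> vec.dim l = 2}"

definition maximal_arc4 :: "('a::{field,finite} ^ 3) set set \<Rightarrow> bool" where
  "maximal_arc4 K \<longleftrightarrow>
     K \<subseteq> pg_points \<and> card K = 3 * CARD('a) + 4 \<and>
     (\<forall>l\<in>pg_lines. card {P\<in>K. P \<subseteq> l} = 0 \<or> card {P\<in>K. P \<subseteq> l} = 4)"

(* Polynomials in three variables, as finitely supported maps from exponent vectors to
   coefficients; the ring structure is the convolution product of Poly_Mapping. *)

type_synonym 'a poly3 = "(3 \<Rightarrow>\<^sub>0 nat) \<Rightarrow>\<^sub>0 'a"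

definition eval3 :: "'a::field poly3 \<Rightarrow> 'a ^ 3 \<Rightarrow> 'a" where
  "eval3 F v = (\<Sum>m\<in>Poly_Mapping.keys F.
     Poly_Mapping.lookup F m * (\<Prod>i\<in>UNIV. (v $ i) ^ Poly_Mapping.lookup m i))"

(* A plane curve of degree d defined over 'a is given by a nonzero form of degree d
   (determined up to a nonzero scalar), so components carry multiplicities. *)

definition plane_curve :: "nat \<Rightarrow> 'a::field poly3 \<Rightarrow> bool" where
  "plane_curve d F \<longleftrightarrow>
     F \<noteq> 0 \<and> (\<forall>m\<in>Poly_Mapping.keys F. (\<Sum>i\<in>UNIV. Poly_Mapping.lookup m i) = d)"

(* The points of PG(2,q) on the curve; points over extension fields are not included. *)

definition curve_points :: "'a::field poly3 \<Rightarrow> ('a ^ 3) set set" where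
  "curve_points F = {P \<in> pg_points. \<forall>v\<in>P. eval3 F v = 0}"

(* The qualified name selects the type-class notion of irreducibility; HOL-Algebra has another. *)

definition absolutely_irreducible :: "'a::field poly3 \<Rightarrow> bool" where
  "absolutely_irreducible F \<longleftrightarrow>
     Factorial_Ring.irreducible (Poly_Mapping.map to_ac F :: 'a alg_closure poly3)"

(* Non-degenerate: the conic does not split into two lines over the algebraic closure. *)

definition nondegenerate_conic :: "'a::field poly3 \<Rightarrow> bool" where
  "nondegenerate_conic C \<longleftrightarrow> plane_curve 2 C \<and> absolutely_irreducible C"

(* A tangent of a non-degenerate conic in PG(2,q) is a line of PG(2,q) meeting it in exactly
   one point of PG(2,q). *)

definition tangent_line :: "'a::field poly3 \<Rightarrow> ('a ^ 3) set \<Rightarrow> bool" where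
  "tangent_line C t \<longleftrightarrow> t \<in> pg_lines \<and> card {P \<in> curve_points C. P \<subseteq> t} = 1"

definition is_nucleus :: "'a::field poly3 \<Rightarrow> ('a ^ 3) set \<Rightarrow> bool" where
  "is_nucleus C N \<longleftrightarrow> N \<in> pg_points \<and> (\<forall>t. tangent_line C t \<longrightarrow> N \<subseteq> t)"

end

theory Submission
  imports Defs
begin

text \<open>The arc forces \<open>q\<close> to be a power of 2. The curve is split into irreducible forms; a line carries
  at most 4 points of the arc, a conic at most \<open>q + 1\<close>, and Stepanov's method bounds the number of
  points on the components of higher degree well enough to leave only two possibilities: two conics
  and a cubic, or three conics and a line. In both the parity of the number of points of a conic or
  cubic on the lines of a pencil is compared with the 0 or 4 points of the arc. This excludes the
  first case at once. In the second it says that on almost every line of a pencil an even number of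
  the three conics is met in two points. Being met in two points is membership of a quotient in the
  subgroup \<open>{z^2 + z}\<close> of index 2, and the poles of these quotients at the lines through the nuclei
  cannot cancel unless the nuclei coincide.\<close>

text \<open>Over a finite field a space of forms of dimension \<open>k\<close> has
  \<open>CARD('a) ^ k\<close> elements, so the dimension arguments behind Bezout's theorem and
  Stepanov's method are run as comparisons of cardinalities. As q is a power of 2 above 6^4 = 1296,
  it is at least 2^11; with q = 32 q' this gives q' >= 64, and the arc has 96 q' + 4 points. To be
  excluded are one nonlinear component of degree at most 7, which needs a bound below 3 q, and two
  of degree at most 5, which needs bounds below 3 q / 2. The bounds 63 q' + 63 and 45 q' + 63 leave
  room for the points on lines. The covering of the arc by three curves is not exact: a point may
  lie on several curves or off the arc. Such exceptional points number fewer than q / 2 for two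
  conics and a cubic and at most 7 for three conics, so many lines of a pencil avoid them, and on
  those lines the numbers of points add up. The vertex of the pencil is put on a line joining two
  nuclei. The quotients belonging to nuclei on that line then have denominators that do not depend
  on the line of the pencil, and at most one pole remains.\<close>

no_notation fps_nth (infixl "$" 75)
alias lookup = Poly_Mapping.lookup
alias single = Poly_Mapping.single
alias keys = Poly_Mapping.keys

section \<open>Forms in three variables\<close>

definition mdeg :: "(3 \<Rightarrow>\<^sub>0 nat) \<Rightarrow> nat" where
  "mdeg m = (\<Sum>i\<in>UNIV. lookup m i)"

definition forms :: "nat \<Rightarrow> 'a::field poly3 set" where
  "forms n = {F. \<forall>m\<in>keys F. mdeg m = n}"

lemma plane_curve_iff: "plane_curve n F \<longleftrightarrow> F \<noteq> 0 \<and> F \<in> forms n"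
  by (simp add: plane_curve_def forms_def mdeg_def)

lemma mdeg_add: "mdeg (m + m') = mdeg m + mdeg m'"
  by (simp add: mdeg_def lookup_add sum.distrib)

lemma mdeg_0 [simp]: "mdeg 0 = 0"
  by (simp add: mdeg_def)

lemma mdeg_single [simp]: "mdeg (single i k) = k"
  by (simp add: mdeg_def lookup_single when_def)

lemma forms_0 [simp]: "0 \<in> forms n"
  by (simp add: forms_def)

lemma forms_add: "F \<in> forms n \<Longrightarrow> G \<in> forms n \<Longrightarrow> F + G \<in> forms n"
  using Poly_Mapping.keys_add[of F G] by (auto simp: forms_def)

lemma forms_uminus: "F \<in> forms n \<Longrightarrow> - F \<in> forms n"
  by (simp add: forms_def)

lemma forms_diff: "F \<in> forms n \<Longrightarrow> G \<in> forms n \<Longrightarrow> F - G \<in> forms n"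
  using forms_add[of F n "- G"] forms_uminus[of G n] by simp

lemma forms_sum: "(\<And>i. i \<in> A \<Longrightarrow> f i \<in> forms n) \<Longrightarrow> sum f A \<in> forms n"
  by (induction A rule: infinite_finite_induct) (auto intro: forms_add)

lemma forms_mult: "F \<in> forms n \<Longrightarrow> G \<in> forms k \<Longrightarrow> F * G \<in> forms (n + k)"
  using Poly_Mapping.keys_mult[of F G] by (fastforce simp: forms_def mdeg_add)

lemma forms_1 [simp]: "1 \<in> forms 0"
  by (simp add: forms_def)

lemma forms_power: "F \<in> forms n \<Longrightarrow> F ^ k \<in> forms (k * n)"
  by (induction k) (auto intro: forms_mult)

lemma forms_single: "mdeg m = n \<Longrightarrow> single m c \<in> forms n"
  by (auto simp: forms_def)

lemma poly_mapping_sum_single: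
  "F = (\<Sum>m\<in>keys F. single m (lookup F m))"
  by (rule poly_mapping_eqI) (auto simp: lookup_sum lookup_single when_def in_keys_iff)

section \<open>Evaluation of forms along a homomorphism of the coefficients\<close>

definition ring_hom_fun :: "('a::comm_ring_1 \<Rightarrow> 'b::comm_ring_1) \<Rightarrow> bool" where
  "ring_hom_fun h \<longleftrightarrow> h 1 = 1 \<and> (\<forall>x y. h (x + y) = h x + h y) \<and> (\<forall>x y. h (x * y) = h x * h y)"

lemma ring_hom_fun_0: "ring_hom_fun h \<Longrightarrow> h 0 = 0"
  unfolding ring_hom_fun_def by (metis add_cancel_left_left)

lemma ring_hom_fun_sum: "ring_hom_fun h \<Longrightarrow> h (sum f A) = (\<Sum>i\<in>A. h (f i))"
  by (induction A rule: infinite_finite_induct) (auto simp: ring_hom_fun_0 ring_hom_fun_def)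

definition mval :: "(3 \<Rightarrow> 'b::comm_ring_1) \<Rightarrow> (3 \<Rightarrow>\<^sub>0 nat) \<Rightarrow> 'b" where
  "mval v m = (\<Prod>i\<in>UNIV. v i ^ lookup m i)"

lemma mval_add: "mval v (m + m') = mval v m * mval v m'"
  by (simp add: mval_def lookup_add power_add prod.distrib)

lemma mval_0 [simp]: "mval v 0 = 1"
  by (simp add: mval_def)

lemma mval_scale: "mval (\<lambda>i. c * v i) m = c ^ mdeg m * mval v m"
  by (simp add: mval_def mdeg_def power_mult_distrib prod.distrib power_sum)

text \<open>With coefficients sent through \<open>h\<close>, one notion of evaluation serves for
  values at points, for the substitution \<open>homog\<close>, for the passage to nested polynomials
  and for power series along a branch.\<close>

definition ev :: "('a::comm_ring_1 \<Rightarrow> 'b::comm_ring_1) \<Rightarrow> (3 \<Rightarrow> 'b) \<Rightarrow> 'a poly3 \<Rightarrow> 'b" where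
  "ev h v F = (\<Sum>m\<in>keys F. h (lookup F m) * mval v m)"

lemma ev_superset:
  assumes "ring_hom_fun h" "finite A" "keys F \<subseteq> A"
  shows "ev h v F = (\<Sum>m\<in>A. h (lookup F m) * mval v m)"
  unfolding ev_def using assms
  by (intro sum.mono_neutral_left) (auto simp: in_keys_iff ring_hom_fun_0)

lemma ev_0 [simp]: "ev h v 0 = 0"
  by (simp add: ev_def)

lemma ev_single: "ring_hom_fun h \<Longrightarrow> ev h v (single m c) = h c * mval v m"
  by (simp add: ev_def ring_hom_fun_0)

lemma ev_add:
  assumes "ring_hom_fun h" shows "ev h v (F + G) = ev h v F + ev h v G"
proof -
  let ?A = "keys F \<union> keys G"
  have "ev h v (F + G) = (\<Sum>m\<in>?A. h (lookup (F + G) m) * mval v m)"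
    using Poly_Mapping.keys_add[of F G] by (intro ev_superset assms) auto
  also have "\<dots> = (\<Sum>m\<in>?A. h (lookup F m) * mval v m) + (\<Sum>m\<in>?A. h (lookup G m) * mval v m)"
    using assms by (simp add: lookup_add ring_hom_fun_def distrib_right sum.distrib)
  also have "\<dots> = ev h v F + ev h v G"
    using assms by (subst (1 2) ev_superset[where A = ?A]) auto
  finally show ?thesis .
qed

lemma ev_sum: "ring_hom_fun h \<Longrightarrow> ev h v (sum f A) = (\<Sum>i\<in>A. ev h v (f i))"
  by (induction A rule: infinite_finite_induct) (auto simp: ev_add)

lemma ev_mult:
  assumes "ring_hom_fun h" shows "ev h v (F * G) = ev h v F * ev h v G"
proof -
  have "F * G = (\<Sum>m\<in>keys F. \<Sum>m'\<in>keys G.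
      single (m + m') (lookup F m * lookup G m'))"
    by (subst poly_mapping_sum_single[of F], subst poly_mapping_sum_single[of G])
       (simp add: sum_product mult_single)
  then show ?thesis
    using assms
    by (simp add: ev_sum ev_single mval_add ring_hom_fun_def)
       (simp add: ev_def sum_product mult_ac)
qed

lemma ev_1 [simp]: "ring_hom_fun h \<Longrightarrow> ev h v 1 = 1"
  using ev_single[of h v 0 1] by (simp add: ring_hom_fun_def)

lemma ring_hom_fun_ev: "ring_hom_fun h \<Longrightarrow> ring_hom_fun (ev h v)"
  by (simp add: ring_hom_fun_def ev_add ev_mult)

lemma ev_power: "ring_hom_fun h \<Longrightarrow> ev h v (F ^ n) = ev h v F ^ n"
  by (induction n) (auto simp: ev_mult)

lemma ring_hom_fun_uminus: "ring_hom_fun h \<Longrightarrow> h (- x) = - h x"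
  unfolding ring_hom_fun_def by (metis add.inverse_inverse add_cancel_left_left add_eq_0_iff)

lemma ring_hom_fun_diff: "ring_hom_fun h \<Longrightarrow> h (x - y) = h x - h y"
  using ring_hom_fun_uminus[of h y] unfolding ring_hom_fun_def by (metis diff_conv_add_uminus)

lemma ev_diff: "ring_hom_fun h \<Longrightarrow> ev h v (F - G) = ev h v F - ev h v G"
  by (rule ring_hom_fun_diff[OF ring_hom_fun_ev])

lemma ev_scale:
  assumes "F \<in> forms n" shows "ev h (\<lambda>i. c * v i) F = c ^ n * ev h v F"
  using assms by (simp add: ev_def forms_def mval_scale sum_distrib_left mult_ac)

lemma ring_hom_fun_id: "ring_hom_fun (\<lambda>x. x)"
  by (simp add: ring_hom_fun_def)

lemma eval3_conv_ev: "eval3 F v = ev (\<lambda>x. x) (($) v) F"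
  by (simp add: eval3_def ev_def mval_def)

section \<open>Homogeneous factors\<close>

text \<open>After the substitution of \<open>x t\<close> for each variable \<open>x\<close>, forms of degree \<open>n\<close> become monomials
  in \<open>t\<close>; a factor of a monomial is a monomial.\<close>

definition homog :: "'a::field poly3 \<Rightarrow> 'a poly3 poly" where
  "homog F = ev (\<lambda>c. [:single 0 c:])
     (\<lambda>i. monom (single (single i 1) 1) 1) F"

lemma ring_hom_homog: "ring_hom_fun (\<lambda>c. [:single 0 c :: 'a::field poly3:])"
  by (simp add: ring_hom_fun_def single_add mult_single mult.commute)

lemma single_eq_sum: "(\<Sum>i\<in>UNIV. single i (lookup m i)) = (m :: 3 \<Rightarrow>\<^sub>0 nat)"
  by (rule poly_mapping_eqI) (auto simp: lookup_sum lookup_single when_def)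

lemma single_single_power:
  "single (single i 1) (1::'a::comm_ring_1) ^ k =
    single (single (i::3) (k::nat)) 1"
  by (induction k) (auto simp: mult_single simp flip: single_add)

lemma prod_single:
  "(\<Prod>i\<in>A. single (f i) (1::'a::comm_ring_1)) = single (sum f A) 1"
  by (induction A rule: infinite_finite_induct) (auto simp: mult_single)

lemma mval_single_vars:
  "mval (\<lambda>i. single (single i 1) (1::'a::comm_ring_1)) m = single m 1"
  unfolding mval_def single_single_power prod_single single_eq_sum ..

lemma prod_monom: "(\<Prod>i\<in>A. monom (f i) (k i)) = monom (prod f A) (sum k A)"
  by (induction A rule: infinite_finite_induct) (auto simp: Polynomial.mult_monom one_pCons monom_0)

lemma monom_power: "monom (c::'a::comm_ring_1) k ^ n = monom (c ^ n) (n * k)"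
  by (induction n) (auto simp: Polynomial.mult_monom monom_0 one_pCons add.commute)

lemma homog_eq: "homog F = (\<Sum>m\<in>keys F.
    monom (single m (lookup F m)) (mdeg m))"
proof -
  have "mval (\<lambda>i. monom (single (single i 1) 1) 1) m =
     monom (single m (1::'a)) (mdeg m)" for m
    using mval_single_vars[of m, where 'a = 'a]
    by (simp add: mval_def monom_power prod_monom mdeg_def del: One_nat_def)
  then show ?thesis
    by (simp add: homog_def ev_def smult_monom mult_single)
qed

lemma homog_mult: "homog (F * G) = homog F * homog G"
  by (simp add: homog_def ev_mult ring_hom_homog)

lemma coeff_homog: "coeff (homog F) k =
   (\<Sum>m\<in>{m\<in>keys F. mdeg m = k}. single m (lookup F m))"
  by (auto simp: homog_eq coeff_sum sum.If_cases if_distrib Int_def intro!: sum.cong)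

lemma lookup_coeff_homog: "lookup (coeff (homog F) k) m =
   (if mdeg m = k then lookup F m else 0)"
  by (auto simp: coeff_homog lookup_sum lookup_single when_def in_keys_iff)

lemma homog_form: "homog F = monom G k \<longleftrightarrow> F = G \<and> F \<in> forms k"
proof
  assume *: "homog F = monom G k"
  then have l: "lookup (if j = k then G else 0) m = (if mdeg m = j then lookup F m else 0)" for j m
    using lookup_coeff_homog[of F j m] by (simp add: eq_commute[of j k])
  have "mdeg m = k" if "m \<in> keys F" for m
    using l[of "mdeg m" m] that by (auto simp: in_keys_iff split: if_splits)
  then show "F = G \<and> F \<in> forms k"
    using l[of k] by (auto simp: forms_def in_keys_iff intro!: poly_mapping_eqI) metis
next
  assume *: "F = G \<and> F \<in> forms k"
  then show "homog F = monom G k"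
    by (auto simp: poly_eq_iff lookup_coeff_homog forms_def in_keys_iff intro!: poly_mapping_eqI)
qed

text \<open>Over a domain both the degree and the least exponent with nonzero coefficient,
  \<open>lo\<close>, are additive. They agree for a monomial, hence they agree for each of its
  factors.\<close>

lemma poly_mult_eq_monom:
  fixes p q :: "'a::idom poly"
  assumes "p * q = monom c n" "c \<noteq> 0"
  obtains a i b j where "p = monom a i" "q = monom b j" "i + j = n"
proof -
  have nz: "p \<noteq> 0" "q \<noteq> 0" using assms by auto
  have ex: "\<exists>i. coeff r i \<noteq> 0" if "r \<noteq> 0" for r :: "'a poly"
    using that by (auto simp: poly_eq_iff)
  define lo where "lo r = (LEAST i. coeff r i \<noteq> 0)" for r :: "'a poly"
  have lo: "coeff r (lo r) \<noteq> 0" if "r \<noteq> 0" for r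
    unfolding lo_def using ex[OF that] by (rule LeastI_ex)
  have lo0: "coeff r i = 0" if "i < lo r" for r i
    using not_less_Least[of i "\<lambda>i. coeff r i \<noteq> 0"] that by (auto simp: lo_def)
  have lod: "lo r \<le> degree r" if "r \<noteq> 0" for r using lo[OF that] by (rule le_degree)
  have "coeff (p * q) (lo p + lo q) = coeff p (lo p) * coeff q (lo q)"
  proof -
    have "coeff (p * q) (lo p + lo q) =
       (\<Sum>i\<in>{lo p}. coeff p i * coeff q (lo p + lo q - i))"
      unfolding coeff_mult
    proof (intro sum.mono_neutral_right ballI)
      fix i assume "i \<in> {..lo p + lo q} - {lo p}"
      then have "i < lo p \<or> lo p + lo q - i < lo q" by auto
      then show "coeff p i * coeff q (lo p + lo q - i) = 0" using lo0 by auto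
    qed auto
    then show ?thesis by simp
  qed
  then have "coeff (monom c n) (lo p + lo q) \<noteq> 0"
    using lo[OF nz(1)] lo[OF nz(2)] assms by simp
  then have 1: "lo p + lo q = n" by (auto split: if_splits)
  have 2: "degree p + degree q = n"
    using degree_mult_eq[OF nz] assms by (simp add: degree_monom_eq)
  have mono: "r = monom (coeff r (lo r)) (lo r)" if "degree r = lo r" for r
    using that lo0[of _ r] by (auto simp: poly_eq_iff coeff_eq_0 nat_neq_iff)
  have "degree p = lo p" "degree q = lo q"
    using 1 2 lod[OF nz(1)] lod[OF nz(2)] by auto
  with mono 1 that show thesis by metis
qed

lemma forms_factor:
  assumes "F * G \<in> forms n" "F * G \<noteq> 0"
  obtains i j where "F \<in> forms i" "G \<in> forms j" "i + j = n"
proof -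
  have "homog F * homog G = monom (F * G) n"
    using assms by (simp flip: homog_mult add: homog_form)
  from poly_mult_eq_monom[OF this assms(2)] obtain a i b j
    where "homog F = monom a i" "homog G = monom b j" "i + j = n" by metis
  then show thesis by (intro that) (auto simp: homog_form)
qed

lemma forms_unique: "F \<in> forms n \<Longrightarrow> F \<in> forms k \<Longrightarrow> F \<noteq> 0 \<Longrightarrow> n = k"
  unfolding forms_def by (metis (mono_tags, lifting) in_keys_iff lookup_zero mem_Collect_eq poly_mapping_eqI)

lemma forms_dvdE:
  assumes "F * G \<in> forms n" "F \<in> forms d" "F \<noteq> 0" "d \<le> n"
  shows "G \<in> forms (n - d)"
proof (cases "G = 0")
  case False
  with assms obtain i j where "F \<in> forms i" "G \<in> forms j" "i + j = n"
    by (metis forms_factor mult_eq_0_iff)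
  with assms forms_unique[of F i d] show ?thesis by auto
qed auto

lemma forms_0_unit:
  assumes "F \<in> forms 0" "F \<noteq> 0"
  shows "F dvd 1"
proof -
  have k: "m = 0" if "m \<in> keys F" for m
    using assms that by (auto simp: forms_def mdeg_def intro!: poly_mapping_eqI)
  have F: "F = single 0 (lookup F 0)"
    using k by (intro poly_mapping_eqI) (fastforce simp: lookup_single when_def in_keys_iff)
  with assms have "lookup F 0 \<noteq> 0" by auto
  then have "F * single 0 (inverse (lookup F 0)) = 1"
    by (subst F) (simp add: mult_single)
  then show ?thesis by (metis dvdI)
qed

lemma unit_forms_0:
  assumes "F dvd (1 :: 'a::field poly3)" shows "F \<in> forms 0"
proof -
  obtain G where "1 = F * G" using assms by auto
  then show ?thesis using forms_factor[of F G 0] by (metis add_is_0 forms_1 zero_neq_one)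
qed

section \<open>Irreducible forms are prime\<close>

text \<open>Unique factorisation of polynomials is available only for coefficient types with fixed gcd
  operations, so we copy the given field to a type that has them.\<close>

typedef 'a field_copy = "UNIV :: 'a set"
  morphisms of_copy to_copy by simp

setup_lifting type_definition_field_copy

instantiation field_copy :: (field) field
begin

lift_definition zero_field_copy :: "'a field_copy" is 0 .
lift_definition one_field_copy :: "'a field_copy" is 1 .
lift_definition plus_field_copy :: "'a field_copy \<Rightarrow> 'a field_copy \<Rightarrow> 'a field_copy" is "(+)" .
lift_definition minus_field_copy :: "'a field_copy \<Rightarrow> 'a field_copy \<Rightarrow> 'a field_copy" is "(-)" .
lift_definition uminus_field_copy :: "'a field_copy \<Rightarrow> 'a field_copy" is uminus .
lift_definition times_field_copy :: "'a field_copy \<Rightarrow> 'a field_copy \<Rightarrow> 'a field_copy" is "(*)" .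
lift_definition divide_field_copy :: "'a field_copy \<Rightarrow> 'a field_copy \<Rightarrow> 'a field_copy" is "(/)" .
lift_definition inverse_field_copy :: "'a field_copy \<Rightarrow> 'a field_copy" is inverse .

instance
  by standard (transfer; simp add: field_simps)+

end

instantiation field_copy :: (field)
  "{unique_euclidean_ring, normalization_euclidean_semiring, normalization_semidom_multiplicative}"
begin

definition [simp]: "normalize_field_copy = (normalize_field :: 'a field_copy \<Rightarrow> _)"
definition [simp]: "unit_factor_field_copy = (unit_factor_field :: 'a field_copy \<Rightarrow> _)"
definition [simp]: "modulo_field_copy = (mod_field :: 'a field_copy \<Rightarrow> _)"
definition [simp]: "euclidean_size_field_copy = (euclidean_size_field :: 'a field_copy \<Rightarrow> _)"
definition [simp]: "division_segment (x :: 'a field_copy) = 1"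

instance
  by standard (simp_all add: dvd_field_iff field_split_simps split: if_splits)

end

instantiation field_copy :: (field) euclidean_ring_gcd
begin

definition gcd_field_copy :: "'a field_copy \<Rightarrow> 'a field_copy \<Rightarrow> 'a field_copy" where
  "gcd_field_copy = Euclidean_Algorithm.gcd"
definition lcm_field_copy :: "'a field_copy \<Rightarrow> 'a field_copy \<Rightarrow> 'a field_copy" where
  "lcm_field_copy = Euclidean_Algorithm.lcm"
definition Gcd_field_copy :: "'a field_copy set \<Rightarrow> 'a field_copy" where
  "Gcd_field_copy = Euclidean_Algorithm.Gcd"
definition Lcm_field_copy :: "'a field_copy set \<Rightarrow> 'a field_copy" where
  "Lcm_field_copy = Euclidean_Algorithm.Lcm"

instance
  by standard
    (simp_all add: gcd_field_copy_def lcm_field_copy_def Gcd_field_copy_def Lcm_field_copy_def)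

end

instance field_copy :: (field) semiring_gcd_mult_normalize ..

definition nested_const :: "'a::field \<Rightarrow> 'a field_copy poly poly poly" where
  "nested_const c = [:[:[:to_copy c:]:]:]"

definition nested_var :: "3 \<Rightarrow> 'a::field field_copy poly poly poly" where
  "nested_var i = (if i = 1 then [:[:[:0, 1:]:]:] else if i = 2 then [:[:0, 1:]:] else [:0, 1:])"

definition nested :: "'a::field poly3 \<Rightarrow> 'a field_copy poly poly poly" where
  "nested = ev nested_const nested_var"

lemma to_copy_simps: "to_copy (0 :: 'a::field) = 0" "to_copy (1 :: 'a) = 1"
  "to_copy (x + y :: 'a) = to_copy x + to_copy y" "to_copy (x * y) = to_copy x * to_copy y"
  by (simp_all add: zero_field_copy_def one_field_copy_def plus_field_copy.abs_eq times_field_copy.abs_eq)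

lemma to_copy_eq_0: "to_copy (x :: 'a::field) = 0 \<longleftrightarrow> x = 0"
  by (metis UNIV_I to_copy_inject to_copy_simps(1))

lemma ring_hom_nested_const: "ring_hom_fun (nested_const :: 'a::field \<Rightarrow> _)"
  by (simp add: ring_hom_fun_def nested_const_def to_copy_simps one_pCons)

lemma ring_hom_nested: "ring_hom_fun (nested :: 'a::field poly3 \<Rightarrow> _)"
  unfolding nested_def by (rule ring_hom_fun_ev[OF ring_hom_nested_const])

lemma pCons_power: "[:c:] ^ n = [:c ^ n :: 'a::comm_ring_1:]"
  by (induction n) (auto simp: one_pCons)

lemma X_power: "[:0, 1 :: 'a::comm_ring_1:] ^ n = monom 1 n"
  using monom_power[of 1 1 n] by (simp add: monom_altdef)

lemma prod_UNIV_3: "prod f (UNIV :: 3 set) = f 1 * f 2 * f 3"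
  unfolding UNIV_3 by (simp add: mult.assoc)

lemma mval_nested:
  "nested_const c * mval nested_var m = monom (monom (monom (to_copy c)
     (lookup m 1)) (lookup m 2)) (lookup m 3)"
proof -
  have ne: "(3::3) \<noteq> 1" "(3::3) \<noteq> 2" "(2::3) \<noteq> 1" by auto
  have const_mult: "[:x:] * [:y:] = [:x * y:]" "[:x:] * monom y n = monom (x * y) n"
    for x y :: "'b::comm_ring_1" and n
    by (simp_all add: smult_monom)
  have "mval nested_var m = (nested_var 1 ^ lookup m 1 * nested_var 2 ^ lookup m 2 *
      nested_var 3 ^ lookup m 3 :: 'a field_copy poly poly poly)"
    unfolding mval_def prod_UNIV_3 ..
  also have "\<dots> = [:[:monom 1 (lookup m 1):]:] * [:monom 1 (lookup m 2):]
     * monom 1 (lookup m 3)"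
    using ne by (simp only: nested_var_def pCons_power X_power if_True if_False refl)
  finally show ?thesis
    by (simp only: nested_const_def const_mult mult_1_right)
qed

lemma poly_mapping_3_eqI:
  assumes "lookup m 1 = lookup m' 1"
    "lookup m 2 = lookup m' 2"
    "lookup m 3 = lookup m' (3::3)"
  shows "m = m'"
proof (rule poly_mapping_eqI)
  fix k :: 3
  show "lookup m k = lookup m' k"
    using exhaust_3[of k] assms by auto
qed

lemma nested_inj:
  assumes "nested F = 0" shows "F = 0"
proof (rule ccontr)
  assume "F \<noteq> 0"
  then obtain m0 where m0: "m0 \<in> keys F" by (auto simp: poly_mapping_eq_iff in_keys_iff fun_eq_iff)
  let ?c = "\<lambda>p. coeff (coeff (coeff p (lookup m0 3)) (lookup m0 2)) (lookup m0 1)"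
  have "?c (nested F) = (\<Sum>m\<in>keys F. ?c (nested_const (lookup F m) * mval nested_var m))"
    by (simp add: nested_def ev_def coeff_sum)
  also have "\<dots> = (\<Sum>m\<in>keys F. if m = m0 then to_copy (lookup F m) else 0)"
    by (intro sum.cong refl) (auto simp: mval_nested dest: poly_mapping_3_eqI)
  also have "\<dots> = to_copy (lookup F m0)" using m0 by simp
  finally show False using assms m0 by (simp add: to_copy_eq_0 in_keys_iff)
qed

text \<open>The range is closed under sums and products and contains the constants and the three
  variables. Polynomial induction, one layer at a time from the innermost variable outwards, does
  the rest.\<close>

lemma nested_surj: "\<exists>F. nested F = p"
proof -
  define R where "R = range (nested :: 'a poly3 \<Rightarrow> _)"
  note hom = ring_hom_nested[where 'a = 'a, unfolded ring_hom_fun_def]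
  have add: "a + b \<in> R" if "a \<in> R" "b \<in> R" for a b
    using that hom unfolding R_def by (metis (no_types, lifting) imageE rangeI)
  have mult: "a * b \<in> R" if "a \<in> R" "b \<in> R" for a b
    using that hom unfolding R_def by (metis (no_types, lifting) imageE rangeI)
  have const: "[:[:[:c:]:]:] \<in> R" for c
  proof -
    have "nested (single 0 (of_copy c)) = [:[:[:c:]:]:]"
      by (simp add: nested_def ev_single ring_hom_nested_const nested_const_def of_copy_inverse)
    then show ?thesis unfolding R_def by (metis rangeI)
  qed
  have var: "nested_var i \<in> R" for i
  proof -
    have "nested (single (single i 1) (1::'a)) = nested_var i"
    proof -
      have "mval nested_var (single i 1) = (nested_var i :: 'a field_copy poly poly poly)"
        unfolding mval_def by (subst prod.remove[of _ i]) (auto simp: lookup_single when_def intro!: prod.neutral)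
      then show ?thesis
        using ring_hom_nested_const[where 'a = 'a]
        by (simp add: nested_def ev_single[OF ring_hom_nested_const] ring_hom_fun_def del: One_nat_def)
    qed
    then show ?thesis unfolding R_def by (metis rangeI)
  qed
  have v: "[:[:[:0, 1:]:]:] \<in> R" "[:[:0, 1:]:] \<in> R" "[:0, 1:] \<in> R"
    using var[of 1] var[of 2] var[of 3] by (simp_all add: nested_var_def)
  have 1: "[:[:a:]:] \<in> R" for a
  proof (induction a)
    case 0
    then show ?case using const[of 0] by simp
  next
    case (pCons a p)
    have "[:[:pCons a p:]:] = [:[:[:a:]:]:] + [:[:[:0, 1:]:]:] * [:[:p:]:]" by simp
    then show ?case using add[OF const mult[OF v(1) pCons(2)]] by simp
  qed
  have 2: "[:a:] \<in> R" for a
  proof (induction a)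
    case 0
    then show ?case using 1[of 0] by simp
  next
    case (pCons a p)
    have "[:pCons a p:] = [:[:a:]:] + [:[:0, 1:]:] * [:p:]" by simp
    then show ?case using add[OF 1 mult[OF v(2) pCons(2)]] by simp
  qed
  have "p \<in> R"
  proof (induction p)
    case 0
    then show ?case using 2[of 0] by simp
  next
    case (pCons a p)
    have "pCons a p = [:a:] + [:0, 1:] * p" by simp
    then show ?case using add[OF 2 mult[OF v(3) pCons(2)]] by simp
  qed
  then show ?thesis unfolding R_def by auto
qed

lemma nested_eq_iff: "nested F = nested G \<longleftrightarrow> F = G"
  using nested_inj[of "F - G"] ring_hom_fun_diff[OF ring_hom_nested, of F G] by auto

lemma nested_mult: "nested (F * G) = nested F * nested G"
  using ring_hom_nested unfolding ring_hom_fun_def by blast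

lemma nested_dvd_iff: "nested F dvd nested G \<longleftrightarrow> F dvd G"
proof
  assume "nested F dvd nested G"
  then obtain p where "nested G = nested F * p" by auto
  moreover obtain H where "nested H = p" using nested_surj by blast
  ultimately show "F dvd G" by (metis nested_mult nested_eq_iff dvdI)
qed (auto simp: nested_mult)

text \<open>\<open>nested\<close> is a ring isomorphism onto an iterated polynomial ring over a
  field, where irreducible elements are prime by Gauss's lemma. It reflects divisibility, so
  primality can be pulled back.\<close>

theorem irreducible_poly3_imp_prime:
  fixes F :: "'a::field poly3"
  assumes "irreducible F"
  shows "prime_elem F"
proof -
  have one: "nested 1 = (1 :: 'a field_copy poly poly poly)"
    using ring_hom_nested unfolding ring_hom_fun_def by blast
  have zero: "nested 0 = (0 :: 'a field_copy poly poly poly)"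
    using ring_hom_fun_0[OF ring_hom_nested] .
  have "irreducible (nested F)"
  proof (rule Factorial_Ring.irreducibleI)
    show "nested F \<noteq> 0" using assms nested_inj[of F] by (auto simp: Factorial_Ring.irreducible_def)
    show "\<not> nested F dvd 1" using assms nested_dvd_iff[of F 1] one by (auto simp: Factorial_Ring.irreducible_def)
    fix a b assume "nested F = a * b"
    moreover obtain G where "nested G = a" using nested_surj by blast
    moreover obtain H where "nested H = b" using nested_surj by blast
    ultimately have "F = G * H" by (metis nested_mult nested_eq_iff)
    then have "G dvd 1 \<or> H dvd 1" using assms by (auto simp: Factorial_Ring.irreducible_def)
    then show "a dvd 1 \<or> b dvd 1"
      using nested_dvd_iff[of _ 1] one \<open>nested G = a\<close> \<open>nested H = b\<close> by metis
  qed
  then have p: "prime_elem (nested F)" by (rule irreducible_imp_prime_elem)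
  show ?thesis
  proof (rule Factorial_Ring.prime_elemI)
    show "F \<noteq> 0" "\<not> F dvd 1" using assms by (auto simp: Factorial_Ring.irreducible_def)
    fix a b assume "F dvd a * b"
    then have "nested F dvd nested a * nested b" by (simp add: nested_dvd_iff flip: nested_mult)
    with p show "F dvd a \<or> F dvd b" by (auto simp: nested_dvd_iff dest: Factorial_Ring.prime_elem_dvd_multD)
  qed
qed

lemma irreducible_degree_pos:
  assumes "F \<in> forms d" "irreducible F"
  shows "d > 0"
  using assms forms_0_unit[of F] by (cases d) (auto simp: Factorial_Ring.irreducible_def)

text \<open>Forms of degree 0 are units, so both factors of a proper splitting have smaller positive
  degree. Each factor is stored with its degree, so that components can later be sorted by
  degree.\<close>

lemma forms_irreducible_factorization:
  fixes F :: "'a::field poly3"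
  assumes "F \<in> forms n" "F \<noteq> 0" "n > 0"
  shows "\<exists>Fs. F = prod_list (map fst Fs) \<and> sum_list (map snd Fs) = n \<and>
    (\<forall>(G, k)\<in>set Fs. G \<in> forms k \<and> irreducible G)"
  using assms
proof (induction n arbitrary: F rule: less_induct)
  case (less n)
  show ?case
  proof (cases "irreducible F")
    case True
    with less.prems show ?thesis by (intro exI[of _ "[(F, n)]"]) auto
  next
    case False
    have "\<not> F dvd 1" using unit_forms_0[of F] forms_unique[of F 0 n] less.prems by auto
    with False less.prems obtain G H where GH: "F = G * H" "\<not> G dvd 1" "\<not> H dvd 1"
      by (auto simp: Factorial_Ring.irreducible_def)
    with less.prems obtain i j where ij: "G \<in> forms i" "H \<in> forms j" "i + j = n" by (metis forms_factor)
    have nz: "G \<noteq> 0" "H \<noteq> 0" using GH less.prems by auto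
    have pos: "i > 0" "j > 0" using ij nz GH forms_0_unit by (metis gr0I)+
    have "i < n" "j < n" using pos ij by auto
    from less.IH[OF this(1) ij(1) nz(1) pos(1)] obtain Gs where
      "G = prod_list (map fst Gs)" "sum_list (map snd Gs) = i"
      "\<forall>(G, k)\<in>set Gs. G \<in> forms k \<and> irreducible G" by blast
    moreover from less.IH[OF \<open>j < n\<close> ij(2) nz(2) pos(2)] obtain Hs where
      "H = prod_list (map fst Hs)" "sum_list (map snd Hs) = j"
      "\<forall>(G, k)\<in>set Hs. G \<in> forms k \<and> irreducible G" by blast
    ultimately show ?thesis using GH(1) ij(3) by (intro exI[of _ "Gs @ Hs"]) auto
  qed
qed

section \<open>Counting forms\<close>

text \<open>The dimension of the space of forms of degree \<open>n\<close>, a triangular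
  number.\<close>

definition tri :: "nat \<Rightarrow> nat" where
  "tri n = card {m :: 3 \<Rightarrow>\<^sub>0 nat. mdeg m = n}"

lemma mdeg_3: "mdeg m = lookup m 1 + lookup m 2 + lookup m 3"
  by (simp add: mdeg_def sum_3)

lemma bij_betw_mdeg:
  "bij_betw (\<lambda>m. (lookup m 1, lookup m 2)) {m. mdeg m = n} (SIGMA a:{..n}. {..n - a})"
proof (rule bij_betwI')
  fix x y assume "x \<in> {m. mdeg m = n}" "y \<in> {m. mdeg m = n}"
  then show "((lookup x 1, lookup x 2) =
       (lookup y 1, lookup y 2)) = (x = y)"
    by (auto simp: mdeg_3 intro!: poly_mapping_3_eqI)
next
  fix x assume "x \<in> {m. mdeg m = n}"
  then show "(lookup x 1, lookup x 2) \<in> (SIGMA a:{..n}. {..n - a})"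
    by (auto simp: mdeg_3)
next
  fix y assume y: "y \<in> (SIGMA a:{..n}. {..n - a})"
  define x :: "3 \<Rightarrow>\<^sub>0 nat" where "x = single 1 (fst y) + single 2 (snd y) +
    single 3 (n - fst y - snd y)"
  have "mdeg x = n" using y by (auto simp: x_def mdeg_add)
  moreover have "lookup x 1 = fst y" "lookup x 2 = snd y"
    by (simp_all add: x_def lookup_add lookup_single)
  ultimately show "\<exists>x\<in>{m. mdeg m = n}. y = (lookup x 1, lookup x 2)"
    by (intro bexI[of _ x]) auto
qed

lemma finite_mdeg: "finite {m. mdeg m = n}"
  using bij_betw_finite[OF bij_betw_mdeg[of n]] by simp

lemma tri_eq: "2 * tri n = (n + 1) * (n + 2)"
proof -
  have "tri n = (\<Sum>a\<in>{..n}. n - a + 1)"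
    unfolding tri_def bij_betw_same_card[OF bij_betw_mdeg[of n]] by simp
  also have "\<dots> = (\<Sum>a\<in>{..n}. a + 1)"
    by (rule sum.reindex_bij_witness[of _ "\<lambda>a. n - a" "\<lambda>a. n - a"]) auto
  finally have "tri n = (\<Sum>a\<in>{..n}. a + 1)" .
  moreover have "2 * (\<Sum>a\<in>{..n}. a + 1) = (n + 1) * (n + 2)"
    by (induction n) (auto simp: algebra_simps)
  ultimately show ?thesis by simp
qed

lemma bij_betw_forms:
  "bij_betw (\<lambda>F. restrict (lookup F) {m. mdeg m = n}) (forms n) ({m. mdeg m = n} \<rightarrow>\<^sub>E (UNIV :: 'a::field set))"
proof (rule bij_betwI')
  fix F G :: "'a poly3" assume "F \<in> forms n" "G \<in> forms n"
  then have z: "lookup F k = 0" "lookup G k = 0" if "mdeg k \<noteq> n" for k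
    using that by (auto simp: forms_def in_keys_iff)
  show "(restrict (lookup F) {m. mdeg m = n} = restrict (lookup G) {m. mdeg m = n}) = (F = G)"
  proof
    assume eq: "restrict (lookup F) {m. mdeg m = n} = restrict (lookup G) {m. mdeg m = n}"
    show "F = G"
    proof (rule poly_mapping_eqI)
      fix k show "lookup F k = lookup G k"
        using z[of k] fun_cong[OF eq, of k] by (cases "mdeg k = n") auto
    qed
  qed simp
next
  fix f :: "(3 \<Rightarrow>\<^sub>0 nat) \<Rightarrow> 'a" assume f: "f \<in> {m. mdeg m = n} \<rightarrow>\<^sub>E UNIV"
  define F where "F = (\<Sum>m\<in>{m. mdeg m = n}. single m (f m))"
  have "F \<in> forms n" unfolding F_def by (intro forms_sum forms_single) auto
  moreover have "lookup F m = f m" if "mdeg m = n" for m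
    using that finite_mdeg[of n] by (simp add: F_def lookup_sum lookup_single when_def)
  then have "f = restrict (lookup F) {m. mdeg m = n}"
    using f by (auto simp: fun_eq_iff PiE_def extensional_def)
  ultimately show "\<exists>F\<in>forms n. f = restrict (lookup F) {m. mdeg m = n}" by blast
qed auto

lemma card_forms: "card (forms n :: 'a::{field,finite} poly3 set) = CARD('a) ^ tri n"
  by (simp add: bij_betw_same_card[OF bij_betw_forms] card_PiE finite_mdeg tri_def)

lemma finite_forms: "finite (forms n :: 'a::{field,finite} poly3 set)"
  using bij_betw_finite[OF bij_betw_forms[of n, where 'a = 'a]] finite_mdeg[of n] by (simp add: finite_PiE)

lemma one_less_card_field: "1 < CARD('a::{field,finite})"
proof -
  have "card {0, 1 :: 'a} \<le> CARD('a)" by (intro card_mono) auto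
  then show ?thesis by simp
qed

text \<open>This count and its counterpart \<open>card_ge_mult_fibres\<close> take the place of rank
  and nullity.\<close>

lemma card_le_mult_fibres:
  assumes "finite B" "f ` A \<subseteq> B" "\<And>y. y \<in> B \<Longrightarrow> card {x \<in> A. f x = y} \<le> k"
  shows "card A \<le> card B * k"
proof -
  have "(\<Union>y\<in>B. {x \<in> A. f x = y}) = A" using assms by auto
  then have "card A \<le> (\<Sum>y\<in>B. card {x \<in> A. f x = y})"
    using card_UN_le[OF assms(1), of "\<lambda>y. {x \<in> A. f x = y}"] by simp
  also have "\<dots> \<le> card B * k" using sum_bounded_above[of B "\<lambda>y. card {x \<in> A. f x = y}" k] assms by simp
  finally show ?thesis .
qed

lemma card_ge_mult_fibres:
  assumes "finite A" "finite B" "\<And>y. y \<in> B \<Longrightarrow> card {x \<in> A. f x = y} \<ge> k"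
  shows "card B * k \<le> card A"
proof -
  have "card B * k \<le> (\<Sum>y\<in>B. card {x \<in> A. f x = y})"
    using sum_bounded_below[of B k "\<lambda>y. card {x \<in> A. f x = y}"] assms by simp
  also have "\<dots> = card (\<Union>y\<in>B. {x \<in> A. f x = y})"
    using assms by (subst card_UN_disjoint) auto
  also have "\<dots> \<le> card A" using assms by (intro card_mono) auto
  finally show ?thesis .
qed

section \<open>Bezout's theorem by counting\<close>

text \<open>The alternating sum of the dimensions in the Koszul complex of two forms of degrees
  \<open>d\<close> and \<open>e\<close>. It produces the Bezout number \<open>d * e\<close>.\<close>

lemma tri_bezout:
  assumes "d + e \<le> n"
  shows "tri n + tri (n - d - e) = d * e + tri (n - d) + tri (n - e)"
proof -
  obtain k where k: "n = k + d + e" using assms by (metis add.assoc add.commute le_Suc_ex)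
  have "2 * (tri n + tri (n - d - e)) = 2 * (d * e + tri (n - d) + tri (n - e))"
    unfolding distrib_left tri_eq by (simp add: k algebra_simps)
  then show ?thesis by simp
qed

text \<open>The forms of degree \<open>n\<close> modulo those in the ideal of \<open>F\<close> and \<open>H\<close> form a space of
  dimension \<open>d * e\<close> for large \<open>n\<close>.\<close>

lemma bezout_count:
  fixes F H :: "'a::{field,finite} poly3" and T :: "'a poly3 \<Rightarrow> 'b"
  assumes F: "F \<in> forms d" "irreducible F" and H: "H \<in> forms e" "\<not> F dvd H"
    and n: "d + e \<le> n"
    and B: "finite B" "card B = CARD('a) ^ D" "B \<subseteq> T ` forms n"
    and T: "\<And>G A A'. G \<in> forms n \<Longrightarrow> A \<in> forms (n - d) \<Longrightarrow> A' \<in> forms (n - e) \<Longrightarrow> T (G + F * A + H * A') = T G"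
  shows "D \<le> d * e"
proof -
  have pr: "prime_elem F" using F by (intro irreducible_poly3_imp_prime)
  have nz: "F \<noteq> 0" using F by auto
  let ?A = "forms (n - d) \<times> forms (n - e) :: ('a poly3 \<times> 'a poly3) set"
  define \<phi> where "\<phi> = (\<lambda>(A, A'). F * A + H * A')"
  define W where "W = \<phi> ` ?A"
  have Wf: "W \<subseteq> forms n"
    using F(1) H(1) n forms_mult[of F d _ "n - d"] forms_mult[of H e _ "n - e"] by (auto simp: W_def \<phi>_def intro!: forms_add)
  have finW: "finite W" using Wf finite_forms finite_subset by blast
  \<comment> \<open>Each fibre of \<open>\<phi>\<close> lies in a coset of the syzygies
    \<open>(- H * c, F * c)\<close>: as \<open>F\<close> is prime and does not divide
    \<open>H\<close>, it divides the difference of two second components.\<close>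
  have "card ?A \<le> card W * CARD('a) ^ tri (n - d - e)"
  proof (rule card_le_mult_fibres[where f = \<phi>])
    fix y assume "y \<in> W"
    then obtain A0 A0' where 0: "A0 \<in> forms (n - d)" "A0' \<in> forms (n - e)" "y = F * A0 + H * A0'"
      by (auto simp: W_def \<phi>_def)
    have "{x \<in> ?A. \<phi> x = y} \<subseteq> (\<lambda>c. (A0 - H * c, A0' + F * c)) ` forms (n - d - e)"
    proof safe
      fix A A' assume A: "A \<in> forms (n - d)" "A' \<in> forms (n - e)" "y = \<phi> (A, A')"
      have eq: "F * (A - A0) = H * (A0' - A')" using A(3) 0(3) by (simp add: \<phi>_def algebra_simps)
      then have "F dvd H * (A0' - A')" by (metis dvdI)
      then have "F dvd A0' - A'" using pr H(2) by (meson Factorial_Ring.prime_elem_dvd_multD)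
      then have "F dvd A' - A0'" by (metis dvd_minus_iff minus_diff_eq)
      then obtain c where c: "A' - A0' = F * c" by auto
      have "F * c \<in> forms (n - e)" using c A 0 forms_diff by metis
      then have "c \<in> forms (n - e - d)" using forms_dvdE[of F c "n - e" d] F(1) nz n by simp
      then have cf: "c \<in> forms (n - d - e)" by (simp add: add.commute)
      have "F * (A - A0) = F * (- (H * c))" using eq c by (metis minus_diff_eq mult.left_commute mult_minus_right)
      then have "A - A0 = - (H * c)" using nz by (metis mult_cancel_left)
      then have "A = A0 - H * c" by (simp add: algebra_simps)
      moreover have "A' = A0' + F * c" using c by (simp add: algebra_simps)
      ultimately show "(A, A') \<in> (\<lambda>c. (A0 - H * c, A0' + F * c)) ` forms (n - d - e)" using cf by blast
    qed
    then have "card {x \<in> ?A. \<phi> x = y} \<le> card ((\<lambda>c. (A0 - H * c, A0' + F * c)) ` forms (n - d - e))"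
      by (intro card_mono finite_imageI finite_forms)
    also have "\<dots> \<le> card (forms (n - d - e) :: 'a poly3 set)" by (intro card_image_le finite_forms)
    finally show "card {x \<in> ?A. \<phi> x = y} \<le> CARD('a) ^ tri (n - d - e)" by (simp add: card_forms)
  qed (use finW in \<open>auto simp: W_def\<close>)
  then have 1: "CARD('a) ^ (tri (n - d) + tri (n - e)) \<le> card W * CARD('a) ^ tri (n - d - e)"
    by (simp add: card_cartesian_product card_forms power_add)
  \<comment> \<open>\<open>T\<close> records the values at given points or the first coefficients
    along a branch. A fibre of \<open>T\<close> over a point of \<open>B\<close> contains a whole
    coset of \<open>W\<close>, so \<open>W\<close> has index at least \<open>card B\<close>.\<close>
  have "card B * card W \<le> card (forms n :: 'a poly3 set)"
  proof (rule card_ge_mult_fibres[where f = T])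
    fix y assume "y \<in> B"
    then obtain G where G: "G \<in> forms n" "y = T G" using B by auto
    have "(\<lambda>w. G + w) ` W \<subseteq> {x \<in> forms n. T x = y}"
    proof safe
      fix w assume w: "w \<in> W"
      show "G + w \<in> forms n" using forms_add G Wf w by blast
      show "T (G + w) = y" using w T[OF G(1)] G(2) by (auto simp: W_def \<phi>_def simp flip: add.assoc)
    qed
    then have "card ((\<lambda>w. G + w) ` W) \<le> card {x \<in> forms n. T x = y}"
      by (intro card_mono) (auto simp: finite_forms)
    then show "card W \<le> card {x \<in> forms n. T x = y}" by (simp add: card_image inj_on_def)
  qed (auto simp: B finite_forms)
  then have 2: "CARD('a) ^ D * card W \<le> CARD('a) ^ tri n" by (simp add: B card_forms)
  have "CARD('a) ^ (D + tri (n - d) + tri (n - e)) \<le> CARD('a) ^ D * (card W * CARD('a) ^ tri (n - d - e))"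
    using 1 by (simp add: power_add mult.assoc)
  also have "\<dots> \<le> CARD('a) ^ (tri n + tri (n - d - e))"
    using 2 by (simp add: power_add flip: mult.assoc)
  finally have "D + tri (n - d) + tri (n - e) \<le> tri n + tri (n - d - e)"
    using power_le_imp_le_exp[OF one_less_card_field] by blast
  then show ?thesis using tri_bezout[OF n] by simp
qed

section \<open>Vectors and linear forms\<close>

definition dot3 :: "'a::field ^ 3 \<Rightarrow> 'a ^ 3 \<Rightarrow> 'a" where
  "dot3 u v = u $ 1 * v $ 1 + u $ 2 * v $ 2 + u $ 3 * v $ 3"

text \<open>The cross product. For nonzero vectors it vanishes exactly when they span the same point
  of the plane.\<close>

definition cr :: "'a::field ^ 3 \<Rightarrow> 'a ^ 3 \<Rightarrow> 'a ^ 3" where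
  "cr u v = vector [u $ 2 * v $ 3 - u $ 3 * v $ 2, u $ 3 * v $ 1 - u $ 1 * v $ 3, u $ 1 * v $ 2 - u $ 2 * v $ 1]"

lemma cr_simps [simp]:
  "cr u v $ 1 = u $ 2 * v $ 3 - u $ 3 * v $ 2"
  "cr u v $ 2 = u $ 3 * v $ 1 - u $ 1 * v $ 3"
  "cr u v $ 3 = u $ 1 * v $ 2 - u $ 2 * v $ 1"
  by (simp_all add: cr_def)

lemma vec3_eq_iff: "u = v \<longleftrightarrow> u $ 1 = v $ 1 \<and> u $ 2 = v $ 2 \<and> u $ 3 = (v $ 3 :: 'a)" for u v :: "'a ^ 3"
  by (simp add: vec_eq_iff forall_3)

lemma cr_eq_0D:
  assumes "cr u v = 0" "u \<noteq> 0"
  obtains c where "v = c *s u"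
proof -
  from assms(2) obtain i where i: "u $ i \<noteq> 0" by (auto simp: vec_eq_iff)
  have "v = (v $ i / u $ i) *s u"
    using exhaust_3[of i] assms(1) i by (auto simp: vec3_eq_iff field_simps)
  then show thesis by (rule that)
qed

definition linf :: "'a::field ^ 3 \<Rightarrow> 'a poly3" where
  "linf a = (\<Sum>i\<in>UNIV. single (single i 1) (a $ i))"

lemma linf_forms: "linf a \<in> forms 1"
  unfolding linf_def by (intro forms_sum forms_single) simp

lemma mval_single: "mval v (single i 1) = v i"
  unfolding mval_def by (subst prod.remove[of _ i]) (auto simp: lookup_single when_def intro!: prod.neutral)

lemma ev_linf: "ring_hom_fun h \<Longrightarrow> ev h v (linf a) = h (a $ 1) * v 1 + h (a $ 2) * v 2 + h (a $ 3) * v 3"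
  unfolding linf_def ev_sum by (simp only: ev_single mval_single sum_3)

lemma eval3_linf: "eval3 (linf a) v = dot3 a v"
  by (simp add: eval3_conv_ev ev_linf ring_hom_fun_id dot3_def)

lemma eval3_add: "eval3 (F + G) v = eval3 F v + eval3 G v"
  and eval3_mult: "eval3 (F * G) v = eval3 F v * eval3 G v"
  and eval3_power: "eval3 (F ^ n) v = eval3 F v ^ n"
  and eval3_sum: "eval3 (sum f A) v = (\<Sum>i\<in>A. eval3 (f i) v)"
  and eval3_1: "eval3 1 v = 1"
  by (simp_all add: eval3_conv_ev ev_add ev_mult ev_power ev_sum ring_hom_fun_id)

lemma eval3_0 [simp]: "eval3 0 v = 0" by (simp add: eval3_def)

lemma eval3_scale: "F \<in> forms n \<Longrightarrow> eval3 F (c *s v) = c ^ n * eval3 F v"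
  using ev_scale[of F n "\<lambda>x. x" c "($) v"] by (simp add: eval3_conv_ev vector_scalar_mult_def vec_lambda_inverse)

lemma eval3_prod: "eval3 (prod f A) v = (\<Prod>i\<in>A. eval3 (f i) v)"
  by (induction A rule: infinite_finite_induct) (auto simp: eval3_1 eval3_mult)

definition const3 :: "'a::field \<Rightarrow> 'a poly3" where "const3 c = single 0 c"

lemma const3_forms: "const3 c \<in> forms 0"
  by (simp add: const3_def forms_single)

lemma eval3_const3 [simp]: "eval3 (const3 c) v = c"
  by (simp add: const3_def eval3_conv_ev ev_single ring_hom_fun_id)

text \<open>A set of points is handled through representing vectors, at which forms have values; the
  condition says that they represent pairwise different points.\<close>

definition proj_distinct :: "('a::field ^ 3) set \<Rightarrow> bool" where
  "proj_distinct V \<longleftrightarrow> 0 \<notin> V \<and> (\<forall>v\<in>V. \<forall>w\<in>V. v \<noteq> w \<longrightarrow> cr v w \<noteq> 0)"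

text \<open>The cross product of \<open>w\<close> with a unit vector works: its dot product with
  \<open>v\<close> is a coordinate of \<open>cr v w\<close>, and one of these is nonzero.\<close>

lemma ex_linf_separating:
  assumes "cr v w \<noteq> (0 :: 'a::field ^ 3)"
  obtains a where "dot3 a w = 0" "dot3 a v \<noteq> 0"
proof -
  from assms consider "cr v w $ 1 \<noteq> 0" | "cr v w $ 2 \<noteq> 0" | "cr v w $ 3 \<noteq> 0"
    by (metis vec3_eq_iff zero_index)
  then show thesis
  proof cases
    case 1
    show thesis using 1 by (intro that[of "vector [0, w $ 3, - w $ 2]"]) (auto simp: dot3_def algebra_simps)
  next
    case 2
    show thesis using 2 by (intro that[of "vector [- w $ 3, 0, w $ 1]"]) (auto simp: dot3_def algebra_simps)
  next
    case 3
    show thesis using 3 by (intro that[of "vector [w $ 2, - w $ 1, 0]"]) (auto simp: dot3_def algebra_simps)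
  qed
qed

lemma ex_linf_nonzero:
  assumes "v \<noteq> (0 :: 'a::field ^ 3)"
  obtains a where "dot3 a v = 1"
proof -
  from assms obtain i where i: "v $ i \<noteq> 0" by (auto simp: vec_eq_iff)
  have "dot3 (axis i (inverse (v $ i))) v = 1"
    using exhaust_3[of i] i by (auto simp: dot3_def axis_def)
  then show thesis by (rule that)
qed

text \<open>For each other point take a linear form that vanishes there but not at \<open>v\<close>.
  Their product is padded to degree \<open>n\<close> with a power of a linear form that is nonzero
  at \<open>v\<close>, and then scaled.\<close>

lemma ex_form_separating:
  fixes V :: "('a::field ^ 3) set"
  assumes "proj_distinct V" "finite V" "v \<in> V" "card V \<le> n + 1"
  obtains G where "G \<in> forms n" "eval3 G v = 1" "\<And>w. w \<in> V \<Longrightarrow> w \<noteq> v \<Longrightarrow> eval3 G w = 0"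
proof -
  have "\<exists>a. dot3 a w = 0 \<and> dot3 a v \<noteq> 0" if "w \<in> V - {v}" for w
    using assms(1,3) that ex_linf_separating[of v w] unfolding proj_distinct_def by (metis Diff_iff insertI1)
  then obtain a where a: "\<And>w. w \<in> V - {v} \<Longrightarrow> dot3 (a w) w = 0 \<and> dot3 (a w) v \<noteq> 0" by metis
  have "v \<noteq> 0" using assms by (auto simp: proj_distinct_def)
  then obtain b where b: "dot3 b v = 1" using ex_linf_nonzero by blast
  define G0 where "G0 = (\<Prod>w\<in>V-{v}. linf (a w)) * linf b ^ (n + 1 - card V)"
  have 1: "(\<Prod>w\<in>A. linf (a w)) \<in> forms (card A)" for A
  proof (induction A rule: infinite_finite_induct)
    case (insert x A)
    then show ?case using forms_mult[OF linf_forms[of "a x"]] by fastforce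
  qed auto
  have card: "card (V - {v}) = card V - 1" using assms by simp
  have "card V > 0" using assms by (auto simp: card_gt_0_iff)
  then have G0: "G0 \<in> forms n"
    using forms_mult[OF 1[of "V - {v}"] forms_power[OF linf_forms[of b], of "n + 1 - card V"]] assms(4)
    by (simp add: G0_def card)
  have nz: "eval3 G0 v \<noteq> 0" using assms(2) a b by (simp add: G0_def eval3_mult eval3_prod eval3_power eval3_linf)
  have z: "eval3 G0 w = 0" if "w \<in> V" "w \<noteq> v" for w
    using that a[of w] assms(2) by (auto simp: G0_def eval3_mult eval3_prod eval3_power eval3_linf)
  show thesis
  proof (rule that[of "const3 (inverse (eval3 G0 v)) * G0"])
    show "const3 (inverse (eval3 G0 v)) * G0 \<in> forms n" using forms_mult[OF const3_forms G0] by simp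
  qed (use nz z in \<open>auto simp: eval3_mult\<close>)
qed

text \<open>In large degree forms take arbitrary values on \<open>V\<close>, and adding multiples of
  \<open>F\<close> and \<open>H\<close> does not change these values. So \<open>bezout_count\<close>
  applies with restriction to \<open>V\<close> as \<open>T\<close> and with \<open>card V\<close> as
  \<open>D\<close>.\<close>

theorem bezout_points:
  fixes F H :: "'a::{field,finite} poly3"
  assumes F: "F \<in> forms d" "irreducible F" and H: "H \<in> forms e" "\<not> F dvd H"
    and V: "proj_distinct V" "\<And>v. v \<in> V \<Longrightarrow> eval3 F v = 0" "\<And>v. v \<in> V \<Longrightarrow> eval3 H v = 0"
  shows "card V \<le> d * e"
proof -
  define n where "n = d + e + card V"
  have fin: "finite V" by simp
  have "\<exists>G. \<forall>v\<in>V. G v \<in> forms n \<and> eval3 (G v) v = 1 \<and> (\<forall>w\<in>V. w \<noteq> v \<longrightarrow> eval3 (G v) w = 0)"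
    using ex_form_separating[OF V(1) fin, of _ n] by (intro bchoice ballI) (metis le_add2 n_def trans_le_add1)
  then obtain G where G: "\<And>v. v \<in> V \<Longrightarrow> G v \<in> forms n" "\<And>v. v \<in> V \<Longrightarrow> eval3 (G v) v = 1"
    "\<And>v w. v \<in> V \<Longrightarrow> w \<in> V \<Longrightarrow> w \<noteq> v \<Longrightarrow> eval3 (G v) w = 0" by metis
  show ?thesis
  proof (rule bezout_count[OF F H, where n = n and B = "V \<rightarrow>\<^sub>E (UNIV :: 'a set)" and T = "\<lambda>G. restrict (eval3 G) V"])
    show "(V \<rightarrow>\<^sub>E UNIV) \<subseteq> (\<lambda>G. restrict (eval3 G) V) ` forms n"
    proof
      fix f :: "'a ^ 3 \<Rightarrow> 'a" assume f: "f \<in> V \<rightarrow>\<^sub>E UNIV"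
      let ?H = "\<Sum>v\<in>V. const3 (f v) * G v"
      have "const3 (f v) * G v \<in> forms n" if "v \<in> V" for v using forms_mult[OF const3_forms G(1)[OF that], of "f v"] by simp
      then have "?H \<in> forms n" by (intro forms_sum)
      moreover have "eval3 ?H w = f w" if "w \<in> V" for w
      proof -
        have "eval3 ?H w = (\<Sum>v\<in>V. if v = w then f w else 0)"
          unfolding eval3_sum using that G by (intro sum.cong) (auto simp: eval3_mult)
        then show ?thesis using that by simp
      qed
      then have "f = restrict (eval3 ?H) V" using f by (auto simp: fun_eq_iff PiE_def extensional_def)
      ultimately show "f \<in> (\<lambda>G. restrict (eval3 G) V) ` forms n" by blast
    qed
  qed (auto simp: card_PiE n_def eval3_add eval3_mult V fun_eq_iff restrict_def finite_PiE)
qed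

section \<open>Branches at smooth points\<close>

lemma poly_add_expansion:
  fixes p :: "'b::idom poly"
  shows "\<exists>r. poly p (s + e) = poly p s + e * poly (pderiv p) s + e\<^sup>2 * r"
proof (induction p)
  case (pCons a p)
  then obtain r where r: "poly p (s + e) = poly p s + e * poly (pderiv p) s + e\<^sup>2 * r" by blast
  have "poly (pCons a p) (s + e) = poly (pCons a p) s + e * poly (pderiv (pCons a p)) s +
      e\<^sup>2 * (poly (pderiv p) s + (s + e) * r)"
    unfolding poly_pCons pderiv_pCons poly_add r by (simp add: algebra_simps power2_eq_square)
  then show ?case by blast
qed (simp add: exI[of _ 0])

lemma poly_fps_nth_cong:
  fixes f :: "'a::field fps poly"
  assumes "\<And>k. k \<le> n \<Longrightarrow> fps_nth a k = fps_nth b k" "k \<le> n"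
  shows "fps_nth (poly f a) k = fps_nth (poly f b) k"
  using assms(2)
proof (induction f arbitrary: k)
  case (pCons c f)
  have "fps_nth (a * poly f a) k = fps_nth (b * poly f b) k"
    unfolding fps_mult_nth using pCons assms(1) by (intro sum.cong) auto
  then show ?case by simp
qed auto

text \<open>Newton's iteration, one coefficient at a time. It always divides by the constant term of
  the derivative at 0, which suffices because the approximations have no constant term.\<close>

fun hensel_approx :: "'a::field fps poly \<Rightarrow> nat \<Rightarrow> 'a fps" where
  "hensel_approx f 0 = 0"
| "hensel_approx f (Suc n) = hensel_approx f n +
     fps_const (- (fps_nth (poly f (hensel_approx f n)) (Suc n)) / (fps_nth (poly (pderiv f) 0) 0)) * fps_X ^ Suc n"

lemma hensel_approx_0: "fps_nth (hensel_approx f n) 0 = 0"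
  by (induction n) (simp_all del: power_Suc add: fps_X_power_nth)

lemma hensel_approx_stable: "k \<le> n \<Longrightarrow> fps_nth (hensel_approx f (n + j)) k = fps_nth (hensel_approx f n) k"
  by (induction j) (simp_all del: power_Suc add: fps_X_power_nth)

lemma hensel_approx_root:
  fixes f :: "'a::field fps poly"
  assumes "fps_nth (poly f 0) 0 = 0" "fps_nth (poly (pderiv f) 0) 0 \<noteq> 0" "k \<le> n"
  shows "fps_nth (poly f (hensel_approx f n)) k = 0"
  using assms(3)
proof (induction n arbitrary: k)
  case 0
  then show ?case using assms by simp
next
  case (Suc n)
  define \<phi> where "\<phi> = hensel_approx f n"
  define d where "d = fps_nth (poly (pderiv f) 0) 0"
  define c where "c = - (fps_nth (poly f \<phi>) (Suc n)) / d"
  define e where "e = fps_const c * fps_X ^ Suc n"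
  obtain r where r: "poly f (\<phi> + e) = poly f \<phi> + e * poly (pderiv f) \<phi> + e\<^sup>2 * r"
    using poly_add_expansion by blast
  \<comment> \<open>The square of the correction has order at least \<open>2 * Suc n\<close>, so it
    does not reach the coefficients up to \<open>Suc n\<close>.\<close>
  have e2: "e\<^sup>2 * r = fps_X ^ (2 * Suc n) * (fps_const c ^ 2 * r)"
    unfolding e_def power_mult_distrib power_mult[symmetric] by (simp only: mult_ac)
  have "fps_nth (poly (pderiv f) \<phi>) 0 = d"
    unfolding d_def \<phi>_def by (rule poly_fps_nth_cong[of 0]) (simp_all add: hensel_approx_0)
  then have step: "fps_nth (poly f (\<phi> + e)) k = fps_nth (poly f \<phi>) k + (if k = Suc n then c * d else 0)" if "k \<le> Suc n" for k
    using that unfolding r fps_add_nth e2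
    by (simp add: e_def mult.assoc fps_X_power_mult_nth del: power_Suc)
  have "c * d = - (fps_nth (poly f \<phi>) (Suc n))" using assms by (simp add: c_def d_def)
  with step[OF Suc.prems] Suc.IH[of k] Suc.prems have "fps_nth (poly f (\<phi> + e)) k = 0"
    by (cases "k = Suc n") (auto simp: \<phi>_def)
  then show ?case by (simp add: \<phi>_def e_def c_def d_def)
qed

lemma fps_hensel:
  fixes f :: "'a::field fps poly"
  assumes "fps_nth (poly f 0) 0 = 0" "fps_nth (poly (pderiv f) 0) 0 \<noteq> 0"
  obtains s where "fps_nth s 0 = 0" "poly f s = 0"
proof -
  define s where "s = Abs_fps (\<lambda>n. fps_nth (hensel_approx f n) n)"
  have "poly f s = 0"
  proof (rule fps_ext)
    fix n
    have "fps_nth s k = fps_nth (hensel_approx f n) k" if "k \<le> n" for k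
      using hensel_approx_stable[of k k f "n - k"] that by (simp add: s_def)
    then have "fps_nth (poly f s) n = fps_nth (poly f (hensel_approx f n)) n"
      by (intro poly_fps_nth_cong[of n]) auto
    then show "fps_nth (poly f s) n = fps_nth 0 n" using hensel_approx_root[OF assms, of n n] by simp
  qed
  moreover have "fps_nth s 0 = 0" by (simp add: s_def)
  ultimately show thesis using that by blast
qed

text \<open>The formal partial derivative. If the exponent of the variable is 0, truncated
  subtraction leaves the monomial unchanged, but its coefficient is then 0.\<close>

definition pd :: "3 \<Rightarrow> 'a::field poly3 \<Rightarrow> 'a poly3" where
  "pd i F = (\<Sum>m\<in>keys F. single (m - single i 1)
     (of_nat (lookup m i) * lookup F m))"

lemma lookup_minus_single:
  "lookup (m - single i (1::nat)) j = (if i = j then lookup m j - 1 else lookup m j)"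
  by (metis (full_types) lookup_minus lookup_single_eq lookup_single_not_eq diff_zero)

lemma pd_forms:
  assumes "F \<in> forms n" shows "pd i F \<in> forms (n - 1)"
  unfolding pd_def
proof (intro forms_sum)
  fix m assume m: "m \<in> keys F"
  then have d: "mdeg m = n" using assms by (auto simp: forms_def)
  show "single (m - single i 1) (of_nat (lookup m i) * lookup F m) \<in> forms (n - 1)"
  proof (cases "lookup m i = 0")
    case False
    then show ?thesis using d exhaust_3[of i]
      by (intro forms_single) (auto simp: mdeg_3 lookup_minus_single simp del: One_nat_def)
  qed auto
qed

lemma pderiv_mval:
  assumes "\<And>j. pderiv (v j) = (if j = i then 1 else 0)"
  shows "pderiv (mval v m) = of_nat (lookup m i) * mval v (m - single i 1)"
proof -
  have pw: "pderiv (v j ^ k) = (if j = i then of_nat k * v j ^ (k - 1) else 0)" for j k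
    by (cases k) (auto simp: pderiv_power_Suc assms of_nat_poly simp del: power_Suc of_nat_Suc)
  have e: "mval v k = v 1 ^ lookup k 1 * v 2 ^ lookup k 2 * v 3 ^ lookup k 3" for k
    by (simp only: mval_def prod_UNIV_3)
  have ne: "(1::3) \<noteq> 2" "(1::3) \<noteq> 3" "(2::3) \<noteq> 3" "(2::3) \<noteq> 1" "(3::3) \<noteq> 1" "(3::3) \<noteq> 2" by simp_all
  show ?thesis
    using exhaust_3[of i]
    by (elim disjE; simp only: e pderiv_mult pw lookup_minus_single ne if_True if_False refl mult_zero_left
        mult_zero_right add_0_left add_0_right mult_ac)
qed

lemma pderiv_ev:
  fixes h :: "'a::field \<Rightarrow> 'b::idom poly"
  assumes h: "ring_hom_fun h" "\<And>c. pderiv (h c) = 0"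
    and v: "\<And>j. pderiv (v j) = (if j = i then 1 else 0)"
  shows "pderiv (ev h v F) = ev h v (pd i F)"
proof -
  have hn: "h (of_nat k) = of_nat k" for k
    using h(1) by (induction k) (auto simp: ring_hom_fun_def ring_hom_fun_0[OF h(1)])
  have hm: "h (x * y) = h x * h y" for x y using h(1) by (simp add: ring_hom_fun_def)
  have "pderiv (ev h v F) = (\<Sum>m\<in>keys F. pderiv (h (lookup F m) * mval v m))"
    unfolding ev_def by (induction rule: infinite_finite_induct) (auto simp: pderiv_add)
  also have "\<dots> = ev h v (pd i F)"
    unfolding pd_def ev_sum[OF h(1)] ev_single[OF h(1)]
    by (intro sum.cong refl) (simp add: pderiv_mult h(2) pderiv_mval[OF v] hm hn mult_ac del: One_nat_def)
  finally show ?thesis .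
qed

lemma ev_comp:
  assumes "ring_hom_fun h" "ring_hom_fun g"
  shows "g (ev h v F) = ev (\<lambda>c. g (h c)) (\<lambda>i. g (v i)) F"
proof -
  have pw: "g (x ^ k) = g x ^ k" for x k using assms(2) by (induction k) (auto simp: ring_hom_fun_def)
  have mv: "g (mval v m) = mval (\<lambda>i. g (v i)) m" for m
    using assms(2) by (simp add: mval_def prod_UNIV_3 ring_hom_fun_def pw)
  show ?thesis
    unfolding ev_def ring_hom_fun_sum[OF assms(2)] using assms(2) by (simp add: mv ring_hom_fun_def)
qed

lemma euler_forms:
  assumes "F \<in> forms n"
  shows "(\<Sum>i\<in>UNIV. single (single i 1) 1 * pd i F) = of_nat n * F"
proof -
  have "single (single i 1) 1 * pd i F =
     (\<Sum>m\<in>keys F. single m (of_nat (lookup m i) * lookup F m))" for i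
    unfolding pd_def sum_distrib_left
  proof (intro sum.cong refl)
    fix m assume "m \<in> keys F"
    show "single (single i 1) 1 * single (m - single i 1) (of_nat (lookup m i) * lookup F m)
      = single m (of_nat (lookup m i) * lookup F m)"
    proof (cases "lookup m i = 0")
      case False
      then have "single i 1 + (m - single i 1) = m"
        by (intro poly_mapping_eqI) (auto simp: lookup_add lookup_minus lookup_single when_def)
      then show ?thesis by (simp add: mult_single del: One_nat_def)
    qed auto
  qed
  then have "(\<Sum>i\<in>UNIV. single (single i 1) 1 * pd i F) =
     (\<Sum>m\<in>keys F. \<Sum>i\<in>UNIV. single m (of_nat (lookup m i) * lookup F m))"
    by (simp only: sum.swap[of _ UNIV])
  also have "\<dots> = (\<Sum>m\<in>keys F. single m (of_nat n * lookup F m))"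
  proof (intro sum.cong refl)
    fix m assume "m \<in> keys F"
    then have "mdeg m = n" using assms by (auto simp: forms_def)
    then show "(\<Sum>i\<in>UNIV. single m (of_nat (lookup m i) * lookup F m)) =
      single m (of_nat n * lookup F m)"
      by (auto simp: mdeg_3 sum_3 algebra_simps simp flip: single_add)
  qed
  also have "\<dots> = of_nat n * F"
  proof -
    have "single m (of_nat n * c) = of_nat n * single m (c::'a)"
      for m :: "3 \<Rightarrow>\<^sub>0 nat" and c
      using mult_single[of 0 "of_nat n :: 'a" m c] by (simp add: single_of_nat)
    then show ?thesis
      using poly_mapping_sum_single[of F, symmetric] by (simp flip: sum_distrib_left)
  qed
  finally show ?thesis .
qed

lemma eval3_euler:
  assumes "F \<in> forms n"
  shows "p $ 1 * eval3 (pd 1 F) p + p $ 2 * eval3 (pd 2 F) p + p $ 3 * eval3 (pd 3 F) p = of_nat n * eval3 F p"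
proof -
  have "eval3 (single (single i 1) 1) p = p $ i" for i
    by (simp add: eval3_conv_ev ev_single ring_hom_fun_id mval_single del: One_nat_def)
  moreover have "eval3 (of_nat n) p = of_nat n"
    by (induction n) (auto simp: eval3_add eval3_1)
  ultimately show ?thesis
    using arg_cong[OF euler_forms[OF assms], of "\<lambda>G. eval3 G p"]
    by (simp only: sum_3 eval3_add eval3_mult)
qed

lemma ring_hom_fps_const: "ring_hom_fun fps_const"
  by (simp add: ring_hom_fun_def)

text \<open>The branch follows the line from \<open>p\<close> in direction \<open>u\<close>,
  corrected in coordinate \<open>i\<close> by Hensel's lemma. Two linear forms have orders 1 and 0
  along it, so products of their powers realise every initial segment of coefficients. Truncation
  can then serve as \<open>T\<close> in \<open>bezout_count\<close>, which bounds the order of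
  \<open>H\<close> by the Bezout number.\<close>

theorem ex_branch:
  fixes F :: "'a::{field,finite} poly3"
  assumes F: "F \<in> forms d" "irreducible F"
    and p: "eval3 F p = 0" "eval3 (pd i F) p \<noteq> 0" "p \<noteq> 0"
  obtains xi :: "3 \<Rightarrow> 'a fps" where "ev fps_const xi F = 0"
    "\<And>H e. H \<in> forms e \<Longrightarrow> \<not> F dvd H \<Longrightarrow> ev fps_const xi H \<noteq> 0 \<and> subdegree (ev fps_const xi H) \<le> d * e"
proof -
  \<comment> \<open>The coefficients of the line joining \<open>p\<close> to the unit vector of
    coordinate \<open>i\<close>. If these two points coincided, Euler's identity would make the
    derivative in that coordinate vanish at \<open>p\<close>.\<close>
  define la where "la = cr p (axis i 1)"
  have "la \<noteq> 0"
  proof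
    assume "la = 0"
    then have "p $ j = 0" if "j \<noteq> i" for j
      using exhaust_3[of i] exhaust_3[of j] that by (auto simp: la_def vec3_eq_iff axis_def)
    then have pj: "p = axis i (p $ i)" by (auto simp: vec_eq_iff axis_def)
    have "p $ i * eval3 (pd i F) p = of_nat d * eval3 F p"
      using eval3_euler[OF F(1), of p] exhaust_3[of i] pj by (auto simp: axis_def vec3_eq_iff)
    then have "p $ i = 0" using p by simp
    then show False using p(3) pj by (metis axis_eq_0_iff)
  qed
  then obtain u where u: "dot3 u la = 1" using ex_linf_nonzero by blast
  obtain mu where mu: "dot3 mu p = 1" using ex_linf_nonzero[OF p(3)] by blast
  \<comment> \<open>The polynomial variable is the unknown correction in coordinate
    \<open>i\<close>; the rest is the line from \<open>p\<close> in direction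
    \<open>u\<close>.\<close>
  define v where "v = (\<lambda>j. [:fps_const (p $ j) + fps_const (u $ j) * fps_X:] + (if j = i then [:0, 1:] else 0) :: 'a fps poly)"
  define h where "h = (\<lambda>c::'a. [:fps_const c:])"
  have h: "ring_hom_fun h" by (simp add: ring_hom_fun_def h_def one_pCons)
  define f where "f = ev h v F"
  define xi where "xi s = (\<lambda>j. fps_const (p $ j) + fps_const (u $ j) * fps_X + (if j = i then s else 0))" for s
  have polyf: "poly (ev h v G) s = ev fps_const (xi s) G" for G s
  proof -
    have "ring_hom_fun (\<lambda>q. poly q s)" by (simp add: ring_hom_fun_def)
    then have "poly (ev h v G) s = ev (\<lambda>c. poly (h c) s) (\<lambda>j. poly (v j) s) G" by (rule ev_comp[OF h])
    also have "(\<lambda>c. poly (h c) s) = fps_const" by (simp add: h_def)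
    also have "(\<lambda>j. poly (v j) s) = xi s" by (auto simp: v_def xi_def)
    finally show ?thesis .
  qed
  have nth0: "fps_nth (ev fps_const (xi s) G) 0 = eval3 G p" if "fps_nth s 0 = 0" for s G
  proof -
    have "ring_hom_fun (\<lambda>q :: 'a fps. fps_nth q 0)" by (simp add: ring_hom_fun_def)
    then have "fps_nth (ev fps_const (xi s) G) 0 = ev (\<lambda>c. fps_nth (fps_const c) 0) (\<lambda>j. fps_nth (xi s j) 0) G"
      by (rule ev_comp[OF ring_hom_fps_const])
    also have "(\<lambda>j. fps_nth (xi s j) 0) = ($) p" using that by (auto simp: xi_def)
    finally show ?thesis by (simp add: eval3_conv_ev)
  qed
  have "pderiv f = ev h v (pd i F)"
    unfolding f_def
  proof (rule pderiv_ev[OF h])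
    fix j show "pderiv (v j) = (if j = i then 1 else 0)"
      by (auto simp: v_def pderiv_add pderiv_pCons one_pCons)
  qed (simp add: h_def pderiv_pCons)
  then have 1: "fps_nth (poly (pderiv f) 0) 0 \<noteq> 0" using p nth0[of 0] by (simp add: polyf)
  have 0: "fps_nth (poly f 0) 0 = 0" using p nth0[of 0] by (simp add: polyf f_def)
  obtain s where s: "fps_nth s 0 = 0" "poly f s = 0" using fps_hensel[OF 0 1] by blast
  let ?xi = "xi s"
  have FX: "ev fps_const ?xi F = 0" using s(2) by (simp add: f_def polyf)
  \<comment> \<open>The linear form vanishes at \<open>p\<close> and ignores the corrected
    coordinate, so along the branch it is the local parameter itself.\<close>
  have L: "ev fps_const ?xi (linf la) = fps_X"
  proof -
    have "dot3 la p = 0" "la $ i = 0" using exhaust_3[of i] by (auto simp: la_def dot3_def axis_def algebra_simps)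
    moreover have "ev fps_const ?xi (linf la) = fps_const (dot3 la p) + fps_const (dot3 u la) * fps_X + fps_const (la $ i) * s"
      using exhaust_3[of i]
      by (auto simp: ev_linf[OF ring_hom_fps_const] xi_def dot3_def algebra_simps
          simp flip: fps_const_add fps_const_mult)
    ultimately show ?thesis using u by simp
  qed
  have M: "fps_nth (ev fps_const ?xi (linf mu)) 0 = 1"
    using nth0[OF s(1)] mu by (simp add: eval3_linf)
  have main: "D \<le> d * e" if H: "H \<in> forms e" "\<not> F dvd H" and D: "\<And>k. k < D \<Longrightarrow> fps_nth (ev fps_const ?xi H) k = 0" for H e D
  proof -
    define n where "n = d + e + D"
    define T where "T G = restrict (fps_nth (ev fps_const ?xi G)) {..<D}" for G
    show ?thesis
    proof (rule bezout_count[OF F H, where n = n and B = "{..<D} \<rightarrow>\<^sub>E (UNIV :: 'a set)" and T = T])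
      show "({..<D} \<rightarrow>\<^sub>E UNIV) \<subseteq> T ` forms n"
      proof
        fix c :: "nat \<Rightarrow> 'a" assume c: "c \<in> {..<D} \<rightarrow>\<^sub>E UNIV"
        \<comment> \<open>The coefficients are prescribed one at a time:
          \<open>linf la ^ j * linf mu ^ (n - j)\<close> has order \<open>j\<close> and leading
          coefficient 1.\<close>
        have "\<exists>G\<in>forms n. \<forall>k<j. fps_nth (ev fps_const ?xi G) k = c k" if "j \<le> D" for j
          using that
        proof (induction j)
          case (Suc j)
          then obtain G where G: "G \<in> forms n" "\<And>k. k < j \<Longrightarrow> fps_nth (ev fps_const ?xi G) k = c k" by auto
          define a where "a = c j - fps_nth (ev fps_const ?xi G) j"
          define G' where "G' = const3 a * (linf la ^ j * linf mu ^ (n - j))"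
          have jn: "j \<le> n" using Suc by (simp add: n_def)
          have G': "G' \<in> forms n"
            using jn forms_mult[OF const3_forms forms_mult[OF forms_power[OF linf_forms, of la j] forms_power[OF linf_forms, of mu "n - j"]], of a]
            by (simp add: G'_def)
          have "ev fps_const ?xi G' = fps_const a * (fps_X ^ j * ev fps_const ?xi (linf mu) ^ (n - j))"
            by (simp add: G'_def ev_mult[OF ring_hom_fps_const] ev_power[OF ring_hom_fps_const] L const3_def ev_single[OF ring_hom_fps_const])
          moreover have "fps_nth (ev fps_const ?xi (linf mu) ^ (n - j)) 0 = 1" using M by (simp add: fps_nth_power_0)
          ultimately have "fps_nth (ev fps_const ?xi G') k = (if k = j then a else 0)" if "k \<le> j" for k
            using that by (simp add: fps_X_power_mult_nth)
          then have "fps_nth (ev fps_const ?xi (G + G')) k = c k" if "k < Suc j" for k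
            using that G(2)[of k] by (cases "k = j") (auto simp: ev_add[OF ring_hom_fps_const] a_def)
          then show ?case using forms_add[OF G(1) G'] by blast
        qed (use forms_0 in blast)
        from this[of D] obtain G where "G \<in> forms n" "\<And>k. k < D \<Longrightarrow> fps_nth (ev fps_const ?xi G) k = c k" by auto
        moreover from this(2) have "c = T G" using c by (auto simp: T_def fun_eq_iff PiE_def extensional_def)
        ultimately show "c \<in> T ` forms n" by blast
      qed
    next
      fix G A A' :: "'a poly3" assume "G \<in> forms n" "A \<in> forms (n - d)" "A' \<in> forms (n - e)"
      have "fps_nth (ev fps_const ?xi H * ev fps_const ?xi A') k = 0" if "k < D" for k
        unfolding fps_mult_nth using D that by (intro sum.neutral) auto
      then show "T (G + F * A + H * A') = T G"
        by (auto simp: T_def fun_eq_iff restrict_def ev_add[OF ring_hom_fps_const] ev_mult[OF ring_hom_fps_const] FX)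
    qed (auto simp: card_PiE finite_PiE n_def)
  qed
  show thesis
  proof (rule that[of ?xi])
    fix H e assume H: "H \<in> forms e" "\<not> F dvd H"
    show "ev fps_const ?xi H \<noteq> 0 \<and> subdegree (ev fps_const ?xi H) \<le> d * e"
    proof
      show "ev fps_const ?xi H \<noteq> 0" using main[OF H, of "d * e + 1"] by auto
      show "subdegree (ev fps_const ?xi H) \<le> d * e" using main[OF H] nth_less_subdegree_zero by blast
    qed
  qed (rule FX)
qed

section \<open>Smooth points in characteristic 2\<close>

lemma char2_add_self: "(1::'b::comm_ring_1) + 1 = 0 \<Longrightarrow> (x::'b) + x = 0"
  by (metis distrib_left mult.right_neutral mult_zero_right)

lemma char2_square_add:
  assumes "(1::'b::comm_ring_1) + 1 = 0" shows "((x::'b) + y)\<^sup>2 = x\<^sup>2 + y\<^sup>2"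
proof -
  have "(2::'b) = 0" using assms by simp
  then show ?thesis by (simp add: power2_sum)
qed

lemma char2_square_sum: "(1::'b::comm_ring_1) + 1 = 0 \<Longrightarrow> (sum f A)\<^sup>2 = (\<Sum>i\<in>A. (f i :: 'b)\<^sup>2)"
  by (induction A rule: infinite_finite_induct) (auto simp: char2_square_add)

lemma char2_power2_inj:
  assumes "(1::'a::field) + 1 = 0" "x\<^sup>2 = (y::'a)\<^sup>2" shows "x = y"
proof -
  have "(x + y)\<^sup>2 = y\<^sup>2 + y\<^sup>2" using assms char2_square_add by metis
  then have "x + y = 0" using char2_add_self[OF assms(1)] by simp
  then show ?thesis using char2_add_self[OF assms(1), of y] by (metis add_right_cancel)
qed

lemma char2_sqrt:
  assumes "(1::'a::{field,finite}) + 1 = 0"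
  obtains y where "y\<^sup>2 = (x::'a)"
proof -
  have "inj (\<lambda>y::'a. y\<^sup>2)" using char2_power2_inj[OF assms] by (auto simp: inj_def)
  then have "surj (\<lambda>y::'a. y\<^sup>2)" by (simp add: finite_UNIV_inj_surj)
  then show thesis using that by (metis surjD)
qed

text \<open>An odd exponent would survive in a derivative, so all exponents are even. Halve them and
  take square roots of the coefficients, which exist because squaring is injective on a finite field
  of characteristic 2.\<close>

lemma pd_all_0_imp_square:
  fixes F :: "'a::{field,finite} poly3"
  assumes char: "(1::'a) + 1 = 0" and pd: "\<And>i. pd i F = 0"
  obtains G where "F = G\<^sup>2"
proof -
  have ev: "even (lookup m i)" if m: "m \<in> keys F" for m i
  proof (rule ccontr)
    assume odd: "odd (lookup m i)"
    let ?m = "m - single i 1"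
    have uniq: "m' = m" if "m' - single i 1 = ?m" "lookup m' i \<noteq> 0" for m'
    proof (rule poly_mapping_eqI)
      fix k
      have "lookup (m' - single i 1) k = lookup ?m k" using that by simp
      moreover have "lookup m i \<noteq> 0" using odd by (intro notI) simp
      ultimately show "lookup m' k = lookup m k"
        unfolding lookup_minus_single using that(2) by (cases "i = k") auto
    qed
    have "lookup (pd i F) ?m = (\<Sum>m'\<in>keys F. if m' = m then of_nat (lookup m i) * lookup F m else 0)"
      unfolding pd_def lookup_sum
    proof (intro sum.cong refl)
      fix m' assume "m' \<in> keys F"
      show "lookup (single (m' - single i 1) (of_nat (lookup m' i) * lookup F m')) ?m
        = (if m' = m then of_nat (lookup m i) * lookup F m else 0)"
        using uniq[of m'] by (cases "lookup m' i = 0") (auto simp: lookup_single when_def)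
    qed
    then have "of_nat (lookup m i) * lookup F m = 0" using pd[of i] m by simp
    then have "of_nat (lookup m i) = (0::'a)" using m by (simp add: in_keys_iff)
    moreover have "of_nat (2 * k + 1) = (1::'a)" for k
    proof -
      have "(2::'a) = 0" using char by simp
      then show ?thesis by simp
    qed
    ultimately show False using odd by (metis oddE zero_neq_one)
  qed
  define hf where "hf m = Poly_Mapping.map (\<lambda>k. k div 2) m" for m :: "3 \<Rightarrow>\<^sub>0 nat"
  have hf: "hf m + hf m = m" if "m \<in> keys F" for m
  proof (rule poly_mapping_eqI)
    fix k
    have "lookup (hf m) k = lookup m k div 2"
      by (auto simp: hf_def map.rep_eq when_def)
    then show "lookup (hf m + hf m) k = lookup m k"
      using ev[OF that, of k] by (simp add: lookup_add) (metis dvd_div_mult_self mult_2_right)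
  qed
  define r where "r = (\<lambda>x::'a. SOME y. y\<^sup>2 = x)"
  have r: "(r x)\<^sup>2 = x" for x unfolding r_def by (rule someI_ex) (metis char2_sqrt[OF char])
  have char': "(1 :: 'a poly3) + 1 = 0" using char by (metis single_add single_one single_zero)
  define G where "G = (\<Sum>m\<in>keys F. single (hf m) (r (lookup F m)))"
  have "G\<^sup>2 = (\<Sum>m\<in>keys F. (single (hf m) (r (lookup F m)))\<^sup>2)"
    unfolding G_def by (rule char2_square_sum[OF char'])
  also have "\<dots> = (\<Sum>m\<in>keys F. single m (lookup F m))"
    using hf r by (intro sum.cong) (simp_all add: power2_eq_square mult_single)
  also have "\<dots> = F" using poly_mapping_sum_single[of F] by simp
  finally show thesis using that by metis
qed

text \<open>An irreducible form is not a square, so some derivative is nonzero. Its degree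
  \<open>d - 1\<close> is too small for a multiple of \<open>F\<close>, and by Bezout it cannot
  vanish on all of \<open>V\<close>.\<close>

lemma ex_smooth_point:
  fixes F :: "'a::{field,finite} poly3"
  assumes char: "(1::'a) + 1 = 0" and F: "F \<in> forms d" "irreducible F"
    and V: "proj_distinct V" "\<And>v. v \<in> V \<Longrightarrow> eval3 F v = 0" and card: "card V > d * (d - 1)"
  obtains p i where "p \<in> V" "eval3 (pd i F) p \<noteq> 0"
proof -
  have "\<exists>i. pd i F \<noteq> 0"
  proof (rule ccontr)
    assume "\<nexists>i. pd i F \<noteq> 0"
    then obtain G where "F = G\<^sup>2" using pd_all_0_imp_square[OF char] by blast
    then show False using F(2) unfolding Factorial_Ring.irreducible_def power2_eq_square
      by (metis dvd_mult_unit_iff dvd_refl mult_dvd_mono mult_1_left)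
  qed
  then obtain i where i: "pd i F \<noteq> 0" by blast
  have "\<not> F dvd pd i F"
  proof
    assume "F dvd pd i F"
    then obtain c where c: "pd i F = F * c" by auto
    then obtain j k where "F \<in> forms j" "j + k = d - 1" using forms_factor[of F c] pd_forms[OF F(1), of i] i by metis
    moreover have "F \<noteq> 0" using F by auto
    ultimately show False using forms_unique[OF F(1), of j] irreducible_degree_pos[OF F] by simp
  qed
  then have "\<exists>p\<in>V. eval3 (pd i F) p \<noteq> 0"
    using bezout_points[OF F pd_forms[OF F(1)], of i V] V card by (meson not_le)
  then show thesis using that by blast
qed

section \<open>Stepanov's bound in characteristic 2\<close>

lemma finite_field_power_card: "(x::'a::{field,finite}) ^ CARD('a) = x"
proof (cases "x = 0")
  case False
  let ?U = "UNIV - {0::'a}"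
  have "bij_betw ((*) x) ?U ?U"
    using False by (intro bij_betwI[where g = "\<lambda>y. y / x"]) auto
  then have "(\<Prod>y\<in>?U. x * y) = \<Prod>?U"
    using prod.reindex_bij_betw[of "(*) x" ?U ?U "\<lambda>y. y"] by simp
  then have "x ^ card ?U * \<Prod>?U = 1 * \<Prod>?U" by (simp add: prod.distrib)
  moreover have "\<Prod>?U \<noteq> 0" by simp
  ultimately have "x ^ card ?U = 1" by (metis mult_cancel_right)
  moreover have "CARD('a) = Suc (card ?U)" using card_Suc_Diff1[of UNIV "0::'a"] by simp
  ultimately show ?thesis by (simp only: power_Suc mult_1_right)
qed (simp add: power_0_left)

lemma char2_power_sum:
  assumes "(1::'b::comm_ring_1) + 1 = 0"
  shows "(sum f A) ^ (2 ^ k) = (\<Sum>i\<in>A. (f i :: 'b) ^ (2 ^ k))"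
proof (induction k)
  case (Suc k)
  have "(sum f A) ^ (2 ^ Suc k) = ((sum f A) ^ (2 ^ k))\<^sup>2" by (simp add: mult.commute flip: power_mult)
  also have "\<dots> = (\<Sum>i\<in>A. (f i ^ (2 ^ k))\<^sup>2)" by (simp add: Suc char2_square_sum[OF assms])
  also have "\<dots> = (\<Sum>i\<in>A. f i ^ (2 ^ Suc k))" by (simp add: mult.commute flip: power_mult)
  finally show ?case .
qed simp

lemma char2_power_add:
  assumes "(1::'b::comm_ring_1) + 1 = 0"
  shows "((x::'b) + y) ^ (2 ^ k) = x ^ (2 ^ k) + y ^ (2 ^ k)"
proof (induction k)
  case (Suc k)
  have "(x + y) ^ (2 ^ Suc k) = ((x + y) ^ (2 ^ k))\<^sup>2" by (simp add: mult.commute flip: power_mult)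
  also have "\<dots> = (x ^ (2 ^ k))\<^sup>2 + (y ^ (2 ^ k))\<^sup>2" by (simp only: Suc char2_square_add[OF assms])
  also have "\<dots> = x ^ (2 ^ Suc k) + y ^ (2 ^ Suc k)" by (simp add: mult.commute flip: power_mult)
  finally show ?case .
qed simp

lemma char2_diff:
  assumes "(1::'b::comm_ring_1) + 1 = 0"
  shows "(x::'b) - y = x + y"
  using minus_unique[OF char2_add_self[OF assms, of y]] by (simp only: diff_conv_add_uminus)

lemma char2_power_diff:
  assumes "(1::'b::comm_ring_1) + 1 = 0"
  shows "((x::'b) - y) ^ (2 ^ k) = x ^ (2 ^ k) - y ^ (2 ^ k)"
  by (simp add: char2_diff[OF assms] char2_power_add[OF assms])

text \<open>The number of points is bounded with a form \<open>H\<close> whose 32nd power agrees at rational points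
  with a form \<open>E\<close> divisible by \<open>F\<close>. That \<open>F\<close> does not divide \<open>H\<close> is seen on a branch, where the
  summands of \<open>H\<close> have distinct orders.\<close>

theorem stepanov_bound:
  fixes F :: "'a::{field,finite} poly3"
  assumes char: "(1::'a) + 1 = 0" and q: "CARD('a) = 32 * q'"
    and F: "F \<in> forms d" "irreducible F"
    and V: "proj_distinct V" "\<And>v. v \<in> V \<Longrightarrow> eval3 F v = 0" "card V > d * (d - 1)"
    and dl: "d * l < q'" "d \<le> l" "d \<le> m"
    and num: "tri (32 * l + m) + (tri m - tri (m - d)) * tri (l - d) <
       (tri m - tri (m - d)) * tri l + tri (32 * l + m - d)"
  shows "card V \<le> d * (l + q' * m)"
proof -
  let ?q = "CARD('a)"
  have q1: "1 < ?q" by (rule one_less_card_field)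
  have Fnz: "F \<noteq> 0" using F(2) by auto
  define n where "n = 32 * l + m"
  obtain p i where p: "p \<in> V" "eval3 (pd i F) p \<noteq> 0" using ex_smooth_point[OF char F V] by blast
  have "p \<noteq> 0" using p V by (auto simp: proj_distinct_def)
  then obtain xi where xi: "ev fps_const xi F = 0"
    "\<And>H e. H \<in> forms e \<Longrightarrow> \<not> F dvd H \<Longrightarrow> ev fps_const xi H \<noteq> 0 \<and> subdegree (ev fps_const xi H) \<le> d * e"
    using ex_branch[OF F V(2)[OF p(1)] p(2)] by blast
  define br where "br = ev fps_const xi"
  have br_mult: "br (G * H) = br G * br H" and br_diff: "br (G - H) = br G - br H"
    and br_power: "br (G ^ k) = br G ^ k" for G H k
    by (simp_all add: br_def ev_mult ev_diff ev_power ring_hom_fps_const)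
  have br_sum: "br (sum f A) = (\<Sum>a\<in>A. br (f a))" for f :: "nat \<Rightarrow> 'a poly3" and A
    by (simp add: br_def ev_sum ring_hom_fps_const)
  have br_F: "br H = 0 \<longleftrightarrow> F dvd H" if "H \<in> forms e" for H e
    using xi that by (auto simp: br_def ev_mult ring_hom_fps_const)
  have br_sub: "subdegree (br H) \<le> d * e" if "H \<in> forms e" for H e
    using xi(2)[OF that] br_F[OF that] by (cases "F dvd H") (auto simp: br_def)

  \<comment> \<open>The orders along the branch of forms of degree \<open>m\<close>. The
    coefficients at these orders determine a form modulo \<open>F\<close>, so their number
    \<open>r\<close> is at least \<open>tri m - tri (m - d)\<close>.\<close>
  define Vals where "Vals = (\<lambda>g. subdegree (br g)) ` {g \<in> forms m. br g \<noteq> 0}"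
  define r where "r = card Vals"
  have finV: "finite Vals" by (simp add: Vals_def finite_forms)
  have "card (forms m :: 'a poly3 set) \<le> card (Vals \<rightarrow>\<^sub>E (UNIV :: 'a set)) * card (forms (m - d) :: 'a poly3 set)"
  proof (rule card_le_mult_fibres[where f = "\<lambda>g. restrict (fps_nth (br g)) Vals"])
    fix y :: "nat \<Rightarrow> 'a"
    let ?fib = "{x \<in> forms m. restrict (fps_nth (br x)) Vals = y}"
    show "card ?fib \<le> card (forms (m - d) :: 'a poly3 set)"
    proof (cases "?fib = {}")
      case True
      then show ?thesis by (simp only: card.empty)
    next
      case False
      then obtain g0 where g0: "g0 \<in> forms m" "restrict (fps_nth (br g0)) Vals = y" by auto
      have "?fib \<subseteq> (\<lambda>c. g0 + F * c) ` forms (m - d)"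
      proof safe
        fix g assume g: "g \<in> forms m" "y = restrict (fps_nth (br g)) Vals"
        have "br (g - g0) = 0"
        proof (rule ccontr)
          assume nz: "br (g - g0) \<noteq> 0"
          then have k: "subdegree (br (g - g0)) \<in> Vals" using forms_diff[OF g(1) g0(1)] by (auto simp: Vals_def)
          have "fps_nth (br g) k = fps_nth (br g0) k" if "k \<in> Vals" for k
            using fun_cong[OF g0(2)[unfolded g(2)], of k] that by simp
          from this[OF k] have "fps_nth (br (g - g0)) (subdegree (br (g - g0))) = 0" by (simp add: br_diff)
          with nz show False by simp
        qed
        then have "F dvd g - g0" using br_F[OF forms_diff[OF g(1) g0(1)]] by simp
        then obtain c where c: "g - g0 = F * c" by auto
        then have "c \<in> forms (m - d)" using forms_dvdE[of F c m d] forms_diff[OF g(1) g0(1)] F(1) Fnz dl by simp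
        moreover have "g = g0 + F * c" using c by (simp add: algebra_simps)
        ultimately show "g \<in> (\<lambda>c. g0 + F * c) ` forms (m - d)" by blast
      qed
      then have "card ?fib \<le> card ((\<lambda>c. g0 + F * c) ` forms (m - d))" by (intro card_mono finite_imageI finite_forms)
      also have "\<dots> \<le> card (forms (m - d) :: 'a poly3 set)" by (intro card_image_le finite_forms)
      finally show ?thesis .
    qed
  qed (use finV in \<open>auto simp: finite_PiE\<close>)
  then have "?q ^ tri m \<le> ?q ^ (r + tri (m - d))"
    using finV by (simp add: card_forms card_PiE r_def power_add)
  then have "tri m \<le> r + tri (m - d)" by (rule power_le_imp_le_exp[OF q1])
  then have r: "tri m - tri (m - d) \<le> r" by simp

  have "\<forall>\<nu>\<in>Vals. \<exists>g. g \<in> forms m \<and> br g \<noteq> 0 \<and> subdegree (br g) = \<nu>" by (auto simp: Vals_def)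
  then obtain gam where gam: "\<And>\<nu>. \<nu> \<in> Vals \<Longrightarrow> gam \<nu> \<in> forms m" "\<And>\<nu>. \<nu> \<in> Vals \<Longrightarrow> br (gam \<nu>) \<noteq> 0"
    "\<And>\<nu>. \<nu> \<in> Vals \<Longrightarrow> subdegree (br (gam \<nu>)) = \<nu>" by metis
  define Tup where "Tup = (Vals \<rightarrow>\<^sub>E (forms l :: 'a poly3 set))"
  \<comment> \<open>In \<open>H f ^ 32\<close> the forms \<open>gam \<nu>\<close> occur with
    exponent \<open>CARD('a)\<close>, which does not change their values at rational points; this
    leaves \<open>E f\<close>. The gain is that \<open>E f\<close> has degree only
    \<open>32 * l + m\<close>, while the 32nd powers keep it additive in \<open>f\<close>.\<close>
  define E where "E f = (\<Sum>\<nu>\<in>Vals. f \<nu> ^ 32 * gam \<nu>)" for f :: "nat \<Rightarrow> 'a poly3"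
  define H where "H f = (\<Sum>\<nu>\<in>Vals. f \<nu> * gam \<nu> ^ q')" for f :: "nat \<Rightarrow> 'a poly3"
  have Ef: "E f \<in> forms n" if "f \<in> Tup" for f
    unfolding E_def n_def using that gam by (intro forms_sum forms_mult forms_power) (auto simp: Tup_def)
  have Hf: "H f \<in> forms (l + q' * m)" if "f \<in> Tup" for f
    unfolding H_def using that gam by (intro forms_sum forms_mult forms_power) (auto simp: Tup_def)
  have char': "(1 :: 'a poly3) + 1 = 0" using char by (metis single_add single_one single_zero)
  have E_diff: "E (\<lambda>\<nu>\<in>Vals. f \<nu> - g \<nu>) = E f - E g" for f g
    unfolding E_def sum_subtractf[symmetric]
    using char2_power_diff[OF char', of _ _ 5] by (intro sum.cong) (simp_all add: left_diff_distrib)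
  have finT: "finite Tup" unfolding Tup_def by (intro finite_PiE finV finite_forms)
  define La where "La = {f \<in> Tup. F dvd E f}"
  \<comment> \<open>Differences of elements of one fibre of
    \<open>(f, c) \<mapsto> E f + F * c\<close> have \<open>E\<close> divisible by \<open>F\<close>.
    As the values lie in \<open>forms n\<close>, this bounds the size of \<open>La\<close> from
    below.\<close>
  have "card (Tup \<times> (forms (n - d) :: 'a poly3 set)) \<le> card (forms n :: 'a poly3 set) * card La"
  proof (rule card_le_mult_fibres[where f = "\<lambda>(f, c). E f + F * c"])
    fix y :: "'a poly3"
    let ?fib = "{x \<in> Tup \<times> forms (n - d). (case x of (f, c) \<Rightarrow> E f + F * c) = y}"
    show "card ?fib \<le> card La"
    proof (cases "?fib = {}")
      case True
      then show ?thesis by (simp only: card.empty)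
    next
      case False
      then obtain f0 c0 where 0: "f0 \<in> Tup" "c0 \<in> forms (n - d)" "E f0 + F * c0 = y" by auto
      show ?thesis
      proof (rule card_inj_on_le[where f = "\<lambda>(f, c). \<lambda>\<nu>\<in>Vals. f \<nu> - f0 \<nu>"])
        show "inj_on (\<lambda>(f, c). \<lambda>\<nu>\<in>Vals. f \<nu> - f0 \<nu>) ?fib"
        proof (rule inj_onI, clarify)
          fix f f' :: "nat \<Rightarrow> 'a poly3" and c c' :: "'a poly3" assume *: "f \<in> Tup" "f' \<in> Tup" "(\<lambda>\<nu>\<in>Vals. f \<nu> - f0 \<nu>) = (\<lambda>\<nu>\<in>Vals. f' \<nu> - f0 \<nu>)"
            "E f' + F * c' = E f + F * c"
          have ff: "f = f'"
          proof
            fix x show "f x = f' x"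
              using fun_cong[OF *(3), of x] *(1,2) by (cases "x \<in> Vals") (auto simp: Tup_def PiE_def extensional_def)
          qed
          then have "F * c' = F * c" using *(4) by simp
          then show "f = f' \<and> c = c'" using ff Fnz by simp
        qed
        show "(\<lambda>(f, c). \<lambda>\<nu>\<in>Vals. f \<nu> - f0 \<nu>) ` ?fib \<subseteq> La"
        proof (rule image_subsetI, clarify)
          fix f :: "nat \<Rightarrow> 'a poly3" and c :: "'a poly3" assume *: "f \<in> Tup" "c \<in> forms (n - d)" "y = E f + F * c"
          have "E f - E f0 = F * (c0 - c)" using 0(3) *(3) by (simp add: algebra_simps)
          then have "F dvd E (\<lambda>\<nu>\<in>Vals. f \<nu> - f0 \<nu>)" unfolding E_diff by simp
          moreover have "(\<lambda>\<nu>\<in>Vals. f \<nu> - f0 \<nu>) \<in> Tup" using 0(1) *(1) by (auto simp: Tup_def intro!: forms_diff)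
          ultimately show "(\<lambda>\<nu>\<in>Vals. f \<nu> - f0 \<nu>) \<in> La" by (simp add: La_def)
        qed
      qed (use finT in \<open>simp add: La_def\<close>)
    qed
  next
    show "(\<lambda>(f, c). E f + F * c) ` (Tup \<times> forms (n - d)) \<subseteq> forms n"
    proof (rule image_subsetI, clarify)
      fix f :: "nat \<Rightarrow> 'a poly3" and c :: "'a poly3" assume *: "f \<in> Tup" "c \<in> forms (n - d)"
      have "d + (n - d) = n" using dl by (simp add: n_def)
      then show "E f + F * c \<in> forms n" using forms_add[OF Ef[OF *(1)]] forms_mult[OF F(1) *(2)] by metis
    qed
  qed (rule finite_forms)
  then have La: "?q ^ (r * tri l + tri (n - d)) \<le> ?q ^ tri n * card La"
    unfolding card_cartesian_product Tup_def card_PiE[OF finV] prod_constant card_forms r_def[symmetric]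
      power_add mult.commute[of r] power_mult .
  \<comment> \<open>If all entries of all \<open>f\<close> in \<open>La\<close> were multiples of
    \<open>F\<close>, then \<open>La\<close> would have at most
    \<open>CARD('a) ^ (r * tri (l - d))\<close> elements, fewer than \<open>num\<close>
    guarantees.\<close>
  have "\<exists>f\<in>La. \<exists>\<nu>\<in>Vals. \<not> F dvd f \<nu>"
  proof (rule ccontr)
    assume "\<not> (\<exists>f\<in>La. \<exists>\<nu>\<in>Vals. \<not> F dvd f \<nu>)"
    then have "La \<subseteq> Vals \<rightarrow>\<^sub>E {x \<in> forms l. F dvd x}" by (auto simp: La_def Tup_def PiE_def)
    then have "card La \<le> card (Vals \<rightarrow>\<^sub>E {x \<in> forms l. F dvd x})"
      by (intro card_mono finite_PiE finV) (auto simp: finite_forms)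
    also have "\<dots> = card {x \<in> forms l. F dvd x} ^ r" using finV by (simp add: card_PiE r_def)
    also have "\<dots> \<le> (?q ^ tri (l - d)) ^ r"
    proof (intro power_mono)
      have "{x \<in> forms l. F dvd x} \<subseteq> (\<lambda>c. F * c) ` forms (l - d)"
      proof
        fix x assume x: "x \<in> {x \<in> forms l. F dvd x}"
        then obtain c where c: "x = F * c" by (auto elim: dvdE)
        then have "c \<in> forms (l - d)" using forms_dvdE[OF _ F(1) Fnz dl(2)] x by simp
        then show "x \<in> (\<lambda>c. F * c) ` forms (l - d)" unfolding c by (rule imageI)
      qed
      then have "card {x \<in> forms l. F dvd x} \<le> card ((\<lambda>c. F * c) ` forms (l - d))"
        by (intro card_mono finite_imageI finite_forms)
      also have "\<dots> \<le> card (forms (l - d) :: 'a poly3 set)" by (intro card_image_le finite_forms)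
      finally show "card {x \<in> forms l. F dvd x} \<le> ?q ^ tri (l - d)" by (simp add: card_forms)
    qed simp
    finally have "?q ^ tri n * card La \<le> ?q ^ (tri n + r * tri (l - d))"
      unfolding power_add mult.commute[of r] power_mult by (rule mult_le_mono2)
    with La have "?q ^ (r * tri l + tri (n - d)) \<le> ?q ^ (tri n + r * tri (l - d))" by simp
    then have le: "r * tri l + tri (n - d) \<le> tri n + r * tri (l - d)" using power_le_imp_le_exp[OF q1] by blast
    \<comment> \<open>\<open>num\<close> is stated for the lower bound of \<open>r\<close>. A larger
      \<open>r\<close> only helps, since \<open>tri (l - d) \<le> tri l\<close>.\<close>
    obtain j where j: "r = tri m - tri (m - d) + j" using r le_Suc_ex by blast
    have tl: "tri (l - d) \<le> tri l"
    proof -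
      have "(l - d + 1) * (l - d + 2) \<le> (l + 1) * (l + 2)" by (intro mult_mono) auto
      then show ?thesis using tri_eq[of l] tri_eq[of "l - d"] by simp
    qed
    then have "j * tri (l - d) \<le> j * tri l" by simp
    with le num show False unfolding j n_def[symmetric] by (simp add: distrib_right)
  qed
  then obtain f where f: "f \<in> Tup" "F dvd E f" "\<exists>\<nu>\<in>Vals. \<not> F dvd f \<nu>" by (auto simp: La_def)

  have fl: "f \<nu> \<in> forms l" if "\<nu> \<in> Vals" for \<nu> using f(1) that by (auto simp: Tup_def)
  \<comment> \<open>The orders of the entries \<open>f \<nu>\<close> are at most
    \<open>d * l < q'\<close>, while those of \<open>gam \<nu> ^ q'\<close> are the multiples
    \<open>q' * \<nu>\<close>. Hence the summand with the least \<open>\<nu>\<close> in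
    \<open>J\<close> has strictly the smallest order, and nothing cancels its leading
    coefficient.\<close>
  define J where "J = {\<nu> \<in> Vals. \<not> F dvd f \<nu>}"
  define \<nu>0 where "\<nu>0 = Min J"
  have J: "finite J" "J \<noteq> {}" using finV f(3) by (auto simp: J_def)
  have \<nu>0: "\<nu>0 \<in> J" "\<And>\<nu>. \<nu> \<in> J \<Longrightarrow> \<nu>0 \<le> \<nu>" using J by (auto simp: \<nu>0_def)
  define K where "K = subdegree (br (f \<nu>0)) + q' * \<nu>0"
  have t: "fps_nth (br (f \<nu> * gam \<nu> ^ q')) K = 0" if "\<nu> \<in> Vals - {\<nu>0}" for \<nu>
  proof (cases "\<nu> \<in> J")
    case True
    then have "\<nu>0 + 1 \<le> \<nu>" using \<nu>0(2)[OF True] that by auto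
    then have "q' * (\<nu>0 + 1) \<le> q' * \<nu>" by (rule mult_le_mono2)
    moreover have "subdegree (br (f \<nu>0)) < q'" using br_sub[OF fl, of \<nu>0] \<nu>0(1) dl(1) by (auto simp: J_def)
    moreover have "br (f \<nu>) \<noteq> 0" using True br_F[OF fl] by (auto simp: J_def)
    then have "subdegree (br (f \<nu> * gam \<nu> ^ q')) = subdegree (br (f \<nu>)) + q' * \<nu>"
      using gam that by (simp add: br_mult br_power)
    ultimately show ?thesis by (intro nth_less_subdegree_zero) (simp add: K_def)
  next
    case False
    then have "br (f \<nu>) = 0" using that br_F[OF fl] by (auto simp: J_def)
    then show ?thesis by (simp add: br_mult)
  qed
  have "fps_nth (br (H f)) K = (\<Sum>\<nu>\<in>Vals. fps_nth (br (f \<nu> * gam \<nu> ^ q')) K)"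
    by (simp add: H_def br_sum fps_sum_nth)
  also have "\<dots> = fps_nth (br (f \<nu>0 * gam \<nu>0 ^ q')) K"
    using t \<nu>0(1) finV by (subst sum.remove[of _ \<nu>0]) (auto simp: J_def)
  also have "\<dots> \<noteq> 0"
  proof -
    have 1: "\<nu>0 \<in> Vals" "br (f \<nu>0) \<noteq> 0" using \<nu>0(1) br_F[OF fl] by (auto simp: J_def)
    then have "br (f \<nu>0 * gam \<nu>0 ^ q') \<noteq> 0" using gam by (simp add: br_mult br_power)
    moreover have "subdegree (br (f \<nu>0 * gam \<nu>0 ^ q')) = K" using gam 1 by (simp add: br_mult br_power K_def)
    ultimately show ?thesis using nth_subdegree_nonzero by metis
  qed
  finally have "br (H f) \<noteq> 0" by auto
  then have ndvd: "\<not> F dvd H f" using br_F[OF Hf[OF f(1)]] by simp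

  have zero: "eval3 (H f) v = 0" if v: "v \<in> V" for v
  proof -
    obtain c where "E f = F * c" using f(2) by auto
    then have "0 = eval3 (E f) v" using V(2)[OF v] by (simp add: eval3_mult)
    also have "\<dots> = (\<Sum>\<nu>\<in>Vals. eval3 (f \<nu>) v ^ 32 * eval3 (gam \<nu>) v ^ (q' * 32))"
      using finite_field_power_card[where 'a = 'a] q
      by (simp add: E_def eval3_sum eval3_mult eval3_power mult.commute)
    also have "\<dots> = (eval3 (H f) v) ^ 2 ^ 5"
      unfolding H_def eval3_sum char2_power_sum[OF char]
      by (intro sum.cong) (auto simp: eval3_mult eval3_power power_mult_distrib power_mult)
    finally show ?thesis by simp
  qed
  show ?thesis using bezout_points[OF F Hf[OF f(1)] ndvd V(1,2) zero] .
qed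

text \<open>The pairs \<open>(l, m)\<close> in the proof satisfy \<open>d * l < 64\<close>, and \<open>m\<close> is nearly the least value that meets
  the numerical hypothesis of Stepanov's bound.\<close>

lemma stepanov_bounds:
  fixes F :: "'a::{field,finite} poly3"
  assumes char: "(1::'a) + 1 = 0" and q: "CARD('a) = 32 * q'" "64 \<le> q'"
    and F: "F \<in> forms d" "irreducible F"
    and V: "proj_distinct V" "\<And>v. v \<in> V \<Longrightarrow> eval3 F v = 0"
  shows "3 \<le> d \<Longrightarrow> d \<le> 5 \<Longrightarrow> card V \<le> 45 * q' + 63" "3 \<le> d \<Longrightarrow> d \<le> 7 \<Longrightarrow> card V \<le> 63 * q' + 63"
proof -
  have tri: "tri k = (k + 1) * (k + 2) div 2" for k using tri_eq[of k] by simp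
  have *: "card V \<le> d * (l + q' * m)" if "d * l < q'" "d \<le> l" "d \<le> m" "d * (d - 1) \<le> d * l"
    "tri (32 * l + m) + (tri m - tri (m - d)) * tri (l - d) < (tri m - tri (m - d)) * tri l + tri (32 * l + m - d)" for l m
  proof (cases "card V > d * (d - 1)")
    case True
    show ?thesis by (rule stepanov_bound[OF char q(1) F V True that(1,2,3,5)])
  next
    case False
    then have "card V \<le> d * l" using that(4) by linarith
    also have "\<dots> \<le> d * (l + q' * m)" by simp
    finally show ?thesis .
  qed
  have 3: "card V \<le> 33 * q' + 63" if "d = 3" using *[of 21 11] q(2) that by (simp add: tri)
  have 4: "card V \<le> 36 * q' + 60" if "d = 4" using *[of 15 9] q(2) that by (simp add: tri)
  have 5: "card V \<le> 45 * q' + 60" if "d = 5" using *[of 12 9] q(2) that by (simp add: tri)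
  have 6: "card V \<le> 48 * q' + 60" if "d = 6" using *[of 10 8] q(2) that by (simp add: tri)
  have 7: "card V \<le> 63 * q' + 63" if "d = 7" using *[of 9 9] q(2) that by (simp add: tri)
  show "card V \<le> 45 * q' + 63" if "3 \<le> d" "d \<le> 5"
  proof -
    from that consider "d = 3" | "d = 4" | "d = 5" by linarith
    then show ?thesis using 3 4 5 by cases auto
  qed
  show "card V \<le> 63 * q' + 63" if "3 \<le> d" "d \<le> 7"
  proof -
    from that consider "d = 3" | "d = 4" | "d = 5" | "d = 6" | "d = 7" by linarith
    then show ?thesis using 3 4 5 6 7 by cases auto
  qed
qed

section \<open>Points, lines and pencils\<close>

abbreviation pt :: "'a::field ^ 3 \<Rightarrow> ('a ^ 3) set" where
  "pt v \<equiv> vec.span {v}"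

lemma pt_eq: "pt v = range (\<lambda>c. c *s v)"
  by (rule vec.span_singleton)

lemma pt_in_pg_points: "v \<noteq> 0 \<Longrightarrow> pt v \<in> pg_points"
  using vec.dim_eq_card_independent[of "{v}"] by (auto simp: pg_points_def)

lemma pg_pointsE:
  assumes "P \<in> pg_points"
  obtains v where "v \<noteq> 0" "P = pt v"
proof -
  obtain B where B: "B \<subseteq> P" "vec.independent B" "P \<subseteq> vec.span B" "card B = vec.dim P"
    using vec.basis_exists[of P] by metis
  then have "card B = 1" using assms by (simp add: pg_points_def)
  then obtain v where v: "B = {v}" by (auto simp: card_1_singleton_iff)
  have "P = pt v"
    using B v assms vec.span_minimal[of B P] by (auto simp: pg_points_def)
  moreover have "v \<noteq> 0" using B(2) v vec.dependent_zero[of B] by auto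
  ultimately show thesis using that by blast
qed

lemma pt_scale:
  assumes c: "c \<noteq> 0" shows "pt (c *s v) = pt v"
  unfolding pt_eq
proof (intro subset_antisym subsetI; elim imageE)
  fix x k assume "x = k *s (c *s v)"
  then have "x = (k * c) *s v" by (simp add: vector_smult_assoc)
  then show "x \<in> range (\<lambda>c. c *s v)" by (rule image_eqI) simp
next
  fix x k assume "x = k *s v"
  then have "x = (k / c) *s (c *s v)" using c by (simp add: vector_smult_assoc)
  then show "x \<in> range (\<lambda>k. k *s (c *s v))" by (rule image_eqI) simp
qed

lemma mem_pt [simp]: "v \<in> pt v"
  by (simp add: vec.span_base)

lemma pt_0_notin: "pt 0 \<notin> pg_points"
  by (auto simp: pg_points_def)

lemma cr_scale [simp]: "cr v (c *s v) = 0" "cr (c *s v) v = 0"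
  by (simp_all add: vec3_eq_iff)

lemma pt_eqD:
  assumes "pt v = pt w" shows "cr v w = 0"
proof -
  have "w \<in> pt v" using assms mem_pt[of w] by simp
  then obtain c where "w = c *s v" unfolding pt_eq by auto
  then show ?thesis by simp
qed

lemma pt_eqI:
  assumes "cr v w = 0" "v \<noteq> 0" "w \<noteq> 0" shows "pt v = pt w"
proof -
  obtain c where "w = c *s v" using cr_eq_0D[OF assms(1,2)] by blast
  then show ?thesis using pt_scale[of c v] assms(3) by (cases "c = 0") auto
qed

lemma pt_eq_iff: "v \<noteq> 0 \<Longrightarrow> w \<noteq> 0 \<Longrightarrow> pt v = pt w \<longleftrightarrow> cr v w = 0"
  using pt_eqI pt_eqD by blast

lemma pt_subset_iff: "vec.subspace S \<Longrightarrow> pt v \<subseteq> S \<longleftrightarrow> v \<in> S"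
  using vec.span_minimal[of "{v}" S] by auto

lemma pt_in_curve_points:
  assumes "F \<in> forms n"
  shows "pt v \<in> curve_points F \<longleftrightarrow> v \<noteq> 0 \<and> eval3 F v = 0"
  using pt_in_pg_points[of v] pt_0_notin eval3_scale[OF assms, of _ v]
  by (cases "v = 0") (auto simp: curve_points_def pt_eq)

lemma curve_pointsE:
  assumes "P \<in> curve_points F"
  obtains v where "v \<noteq> 0" "P = pt v" "eval3 F v = 0"
  using assms pg_pointsE[of P] unfolding curve_points_def by (metis (mono_tags, lifting) mem_Collect_eq mem_pt)

lemma ex_representatives:
  fixes S :: "('a::{field,finite} ^ 3) set set"
  assumes "S \<subseteq> pg_points"
  obtains V where "proj_distinct V" "card V = card S" "\<And>v. v \<in> V \<Longrightarrow> pt v \<in> S"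
proof -
  have "\<forall>P\<in>S. \<exists>v. v \<noteq> 0 \<and> pt v = P" using assms pg_pointsE by (metis subsetD)
  then obtain f where f: "\<And>P. P \<in> S \<Longrightarrow> f P \<noteq> 0 \<and> pt (f P) = P" by metis
  then have inj: "inj_on f S" by (metis inj_onI)
  have "proj_distinct (f ` S)"
    unfolding proj_distinct_def
  proof (intro conjI ballI impI notI)
    show False if "0 \<in> f ` S" using that f by auto
    fix v w assume "v \<in> f ` S" "w \<in> f ` S" and ne: "v \<noteq> w" "cr v w = 0"
    then obtain P Q where PQ: "P \<in> S" "Q \<in> S" "v = f P" "w = f Q" by auto
    then have "P = Q" using pt_eqI[OF ne(2)] f[OF PQ(1)] f[OF PQ(2)] by simp
    then show False using PQ ne(1) by simp
  qed
  moreover have "card (f ` S) = card S" by (rule card_image[OF inj])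
  ultimately show thesis using f by (intro that[of "f ` S"]) auto
qed

lemma bezout_curves:
  fixes F H :: "'a::{field,finite} poly3"
  assumes "F \<in> forms d" "irreducible F" "H \<in> forms e" "\<not> F dvd H"
  shows "card (curve_points F \<inter> curve_points H) \<le> d * e"
proof -
  obtain V where V: "proj_distinct V" "card V = card (curve_points F \<inter> curve_points H)"
    "\<And>v. v \<in> V \<Longrightarrow> pt v \<in> curve_points F \<inter> curve_points H"
    using ex_representatives[of "curve_points F \<inter> curve_points H"] by (auto simp: curve_points_def)
  then show ?thesis
    using bezout_points[OF assms V(1)] pt_in_curve_points[OF assms(1)] pt_in_curve_points[OF assms(3)] by auto
qed

definition det3 :: "'a::field ^ 3 \<Rightarrow> 'a ^ 3 \<Rightarrow> 'a ^ 3 \<Rightarrow> 'a" where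
  "det3 u v w = dot3 u (cr v w)"

lemma det3_eq: "det3 u v w = u $ 1 * v $ 2 * w $ 3 - u $ 1 * v $ 3 * w $ 2 + u $ 2 * v $ 3 * w $ 1
    - u $ 2 * v $ 1 * w $ 3 + u $ 3 * v $ 1 * w $ 2 - u $ 3 * v $ 2 * w $ 1"
  by (simp add: det3_def dot3_def algebra_simps)

lemma cramer3:
  "det3 p y z *s x = det3 x y z *s p + det3 p x z *s y + det3 p y x *s z"
  unfolding vec3_eq_iff by (simp add: det3_eq algebra_simps)

lemma basis3_expand:
  assumes "det3 p y z \<noteq> 0"
  obtains a b c where "x = a *s p + b *s y + c *s z"
proof -
  let ?d = "det3 p y z"
  have "x = (1 / ?d) *s (?d *s x)" using assms by (simp add: vector_smult_assoc)
  also have "\<dots> = (det3 x y z / ?d) *s p + (det3 p x z / ?d) *s y + (det3 p y x / ?d) *s z"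
    unfolding cramer3[of p y z x] by (simp add: vector_smult_assoc vec.scale_right_distrib)
  finally show thesis by (rule that)
qed

lemma ex_third:
  assumes "cr p u \<noteq> 0"
  obtains w where "det3 p u w \<noteq> 0"
proof -
  obtain a where "dot3 a (cr p u) = 1" using ex_linf_nonzero[OF assms] by blast
  then have "det3 p u a \<noteq> 0" by (auto simp: det3_eq dot3_def algebra_simps)
  then show thesis by (rule that)
qed

lemma ex_second:
  assumes "p \<noteq> (0 :: 'a::field ^ 3)"
  obtains u where "cr p u \<noteq> 0"
proof -
  from assms obtain i where i: "p $ i \<noteq> 0" by (auto simp: vec_eq_iff)
  consider "cr p (axis 1 1) \<noteq> 0" | "cr p (axis 2 1) \<noteq> 0"
    using i exhaust_3[of i] by (auto simp: vec3_eq_iff axis_def)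
  then show thesis using that by cases blast+
qed

lemma span2: "vec.span {p, u} = {a *s p + b *s u | a b. True}"
proof -
  have "x \<in> vec.span {p, u} \<longleftrightarrow> (\<exists>a b. x = a *s p + b *s u)" for x
    by (auto simp: vec.span_insert pt_eq vec.span_breakdown_eq algebra_simps)
  then show ?thesis by auto
qed

lemma indep2: assumes "cr p u \<noteq> 0" shows "vec.independent {p, u}" "p \<noteq> u"
proof -
  have "p \<noteq> 0" "u \<noteq> 0" using assms by (auto simp: vec3_eq_iff)
  moreover have "p \<notin> pt u" using assms by (auto simp: pt_eq)
  ultimately show "vec.independent {p, u}" by (simp add: vec.independent_insert)
  show "p \<noteq> u" using assms by (auto simp: vec3_eq_iff)
qed

lemma span2_in_pg_lines: "cr p u \<noteq> 0 \<Longrightarrow> vec.span {p, u} \<in> pg_lines"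
  using indep2[of p u] vec.dim_eq_card_independent[of "{p, u}"] by (simp add: pg_lines_def)

lemma pg_linesE:
  assumes "l \<in> pg_lines"
  obtains p u where "cr p u \<noteq> 0" "l = vec.span {p, u}"
proof -
  obtain B where B: "B \<subseteq> l" "vec.independent B" "l \<subseteq> vec.span B" "card B = vec.dim l"
    using vec.basis_exists[of l] by metis
  then have "card B = 2" using assms by (simp add: pg_lines_def)
  then obtain p u where pu: "B = {p, u}" "p \<noteq> u" by (auto simp: card_2_iff)
  have "l = vec.span {p, u}"
    using B pu assms vec.span_minimal[of B l] by (auto simp: pg_lines_def)
  moreover have "cr p u \<noteq> 0"
  proof
    assume "cr p u = 0"
    moreover have "p \<noteq> 0" using B(2) pu vec.dependent_zero[of B] by auto
    ultimately obtain c where "u = c *s p" by (metis cr_eq_0D)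
    then have "u \<in> pt p" by (auto simp: pt_eq)
    then show False using B(2) pu vec.independent_insert[of u "{p}"] by (auto simp: insert_commute)
  qed
  ultimately show thesis using that by blast
qed

lemma cr_plus_scale: "cr p (u + s *s p) = cr p u" "cr (u + s *s p) (u + t *s p) = (s - t) *s cr p u"
  by (simp_all add: vec3_eq_iff algebra_simps)

lemma cr_0 [simp]: "cr p 0 = 0" "cr 0 p = 0"
  by (simp_all add: vec3_eq_iff)

lemma dot3_0 [simp]: "dot3 a 0 = 0"
  by (simp add: dot3_def)

lemma plus_scale_nonzero: "cr p u \<noteq> 0 \<Longrightarrow> u + s *s p \<noteq> (0 :: 'a::field ^ 3)"
  by (metis cr_plus_scale(1) cr_0(1))

lemma pt_pencil_inj:
  assumes "cr p u \<noteq> 0"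
  shows "pt (u + s *s p) = pt (u + t *s p) \<longleftrightarrow> s = t" "pt (u + s *s p) \<noteq> pt p"
  using pt_eqD[of "u + s *s p" "u + t *s p"] pt_eqD[of p "u + s *s p"] assms
  by (auto simp: cr_plus_scale)

lemma pg_points_on_line:
  assumes "cr p u \<noteq> (0 :: 'a::field ^ 3)"
  shows "{P \<in> pg_points. P \<subseteq> vec.span {p, u}} = insert (pt p) (range (\<lambda>s. pt (u + s *s p)))"
proof -
  have nz: "p \<noteq> 0" "u \<noteq> 0" using assms by (auto simp: vec3_eq_iff)
  show ?thesis
  proof (intro subset_antisym subsetI)
    fix P assume "P \<in> {P \<in> pg_points. P \<subseteq> vec.span {p, u}}"
    then obtain v where v: "v \<noteq> 0" "P = pt v" "v \<in> vec.span {p, u}" using pg_pointsE by (metis (no_types, lifting) mem_Collect_eq mem_pt subsetD)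
    then obtain a b where ab: "v = a *s p + b *s u" by (auto simp: span2)
    show "P \<in> insert (pt p) (range (\<lambda>s. pt (u + s *s p)))"
    proof (cases "b = 0")
      case True
      then show ?thesis using v ab pt_scale[of a p] by auto
    next
      case False
      then have "v = b *s (u + (a / b) *s p)" unfolding ab by (simp add: vector_smult_assoc vec.scale_right_distrib add.commute)
      then show ?thesis using v pt_scale[OF False] by auto
    qed
  next
    fix P assume "P \<in> insert (pt p) (range (\<lambda>s. pt (u + s *s p)))"
    moreover have sub: "vec.subspace (vec.span {p, u})" by simp
    moreover have "pt p \<subseteq> vec.span {p, u}" unfolding pt_subset_iff[OF sub] by (simp add: vec.span_base)
    moreover have "pt (u + s *s p) \<subseteq> vec.span {p, u}" for s
      unfolding pt_subset_iff[OF sub] by (intro vec.span_add vec.span_scale) (simp_all add: vec.span_base)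
    ultimately show "P \<in> {P \<in> pg_points. P \<subseteq> vec.span {p, u}}"
      using pt_in_pg_points[OF nz(1)] pt_in_pg_points[OF plus_scale_nonzero[OF assms]] by blast
  qed
qed

lemma card_on_line:
  fixes S :: "('a::{field,finite} ^ 3) set set"
  assumes "cr p u \<noteq> 0" "S \<subseteq> pg_points"
  shows "card {P \<in> S. P \<subseteq> vec.span {p, u}} = (if pt p \<in> S then 1 else 0) + card {s. pt (u + s *s p) \<in> S}"
proof -
  have img: "card ((\<lambda>s. pt (u + s *s p)) ` {s. pt (u + s *s p) \<in> S}) = card {s. pt (u + s *s p) \<in> S}"
    by (intro card_image inj_onI) (simp only: pt_pencil_inj(1)[OF assms(1)])
  have "{P \<in> S. P \<subseteq> vec.span {p, u}} = S \<inter> {P \<in> pg_points. P \<subseteq> vec.span {p, u}}" using assms(2) by auto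
  also have "\<dots> = (if pt p \<in> S then {pt p} else {}) \<union> (\<lambda>s. pt (u + s *s p)) ` {s. pt (u + s *s p) \<in> S}"
    unfolding pg_points_on_line[OF assms(1)] by auto
  finally have e: "{P \<in> S. P \<subseteq> vec.span {p, u}} =
    (if pt p \<in> S then {pt p} else {}) \<union> (\<lambda>s. pt (u + s *s p)) ` {s. pt (u + s *s p) \<in> S}" .
  have "card ((if pt p \<in> S then {pt p} else {}) \<union> (\<lambda>s. pt (u + s *s p)) ` {s. pt (u + s *s p) \<in> S}) =
    card (if pt p \<in> S then {pt p} else {}) + card ((\<lambda>s. pt (u + s *s p)) ` {s. pt (u + s *s p) \<in> S})"
    using pt_pencil_inj(2)[OF assms(1)] by (intro card_Un_disjoint) auto
  then show ?thesis unfolding e img by simp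
qed

lemma det3_pencil:
  assumes "det3 p y z \<noteq> 0"
  shows "cr p (y + r *s z) \<noteq> 0" "cr p z \<noteq> 0" "cr p y \<noteq> 0"
proof -
  have "det3 p y z = dot3 z (cr p (y + r *s z))" "det3 p y z = dot3 (- y) (cr p z)" "det3 p y z = dot3 z (cr p y)"
    by (simp_all add: det3_eq dot3_def algebra_simps)
  then show "cr p (y + r *s z) \<noteq> 0" "cr p z \<noteq> 0" "cr p y \<noteq> 0"
    using assms by (metis dot3_0)+
qed

lemma pencil_lines_distinct:
  assumes d: "det3 p y z \<noteq> 0"
  shows "pt (y + r *s z + s *s p) = pt (y + r' *s z + s' *s p) \<longleftrightarrow> r = r' \<and> s = s'"
    "pt (y + r *s z + s *s p) \<noteq> pt (z + s' *s p)"
proof -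
  have "r = r' \<and> s = s'" if "pt (y + r *s z + s *s p) = pt (y + r' *s z + s' *s p)"
  proof -
    have "cr (y + r *s z + s *s p) (y + r' *s z + s' *s p) = 0" using that by (rule pt_eqD)
    moreover have "dot3 p (cr (y + r *s z + s *s p) (y + r' *s z + s' *s p)) = (r' - r) * det3 p y z"
      by (simp add: det3_eq dot3_def algebra_simps)
    ultimately have "r = r'" using d by (metis dot3_0 eq_iff_diff_eq_0 mult_eq_0_iff)
    then show ?thesis using that pt_pencil_inj(1)[OF det3_pencil(1)[OF d]] by simp
  qed
  then show "pt (y + r *s z + s *s p) = pt (y + r' *s z + s' *s p) \<longleftrightarrow> r = r' \<and> s = s'" by auto
  show "pt (y + r *s z + s *s p) \<noteq> pt (z + s' *s p)"
  proof
    assume "pt (y + r *s z + s *s p) = pt (z + s' *s p)"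
    then have "cr (y + r *s z + s *s p) (z + s' *s p) = 0" by (rule pt_eqD)
    moreover have "dot3 p (cr (y + r *s z + s *s p) (z + s' *s p)) = det3 p y z"
      by (simp add: det3_eq dot3_def algebra_simps)
    ultimately show False using d by (metis dot3_0)
  qed
qed

lemma pencil_cases:
  assumes d: "det3 p y z \<noteq> 0" and "P \<in> pg_points"
  obtains "P = pt p" | s where "P = pt (z + s *s p)" | r s where "P = pt (y + r *s z + s *s p)"
proof -
  obtain v where v: "v \<noteq> 0" "P = pt v" using pg_pointsE[OF assms(2)] .
  obtain a b c where abc: "v = a *s p + b *s y + c *s z" using basis3_expand[OF d] by blast
  consider "b \<noteq> 0" | "b = 0" "c \<noteq> 0" | "b = 0" "c = 0" "a \<noteq> 0" using abc v(1) by fastforce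
  then show thesis
  proof cases
    case 1
    then have "v = b *s (y + (c / b) *s z + (a / b) *s p)" unfolding abc by (simp add: vector_smult_assoc vec.scale_right_distrib)
    then show thesis using that(3) v(2) pt_scale[OF 1] by metis
  next
    case 2
    then have "v = c *s (z + (a / c) *s p)" unfolding abc by (simp add: vector_smult_assoc vec.scale_right_distrib)
    then show thesis using that(2) v(2) pt_scale[OF 2(2)] by metis
  next
    case 3
    then show thesis using that(1) v(2) pt_scale[OF 3(3)] abc by simp
  qed
qed

text \<open>The points other than \<open>p\<close> are sorted by the line joining them to
  \<open>p\<close>. Such a line is given by \<open>y + r *s z\<close> for one \<open>r\<close>, or
  by \<open>z\<close>.\<close>

lemma card_pencil:
  fixes S :: "('a::{field,finite} ^ 3) set set"
  assumes d: "det3 p y z \<noteq> 0" and S: "S \<subseteq> pg_points"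
  shows "card S = (if pt p \<in> S then 1 else 0) + card {s. pt (z + s *s p) \<in> S} +
     (\<Sum>r\<in>UNIV. card {s. pt (y + r *s z + s *s p) \<in> S})"
proof -
  let ?A = "\<lambda>r. (\<lambda>s. pt (y + r *s z + s *s p)) ` {s. pt (y + r *s z + s *s p) \<in> S}"
  let ?B = "(\<lambda>s. pt (z + s *s p)) ` {s. pt (z + s *s p) \<in> S}"
  let ?C = "if pt p \<in> S then {pt p} else {}"
  have "S \<subseteq> ?C \<union> ?B \<union> (\<Union>r\<in>UNIV. ?A r)"
  proof
    fix P assume P: "P \<in> S"
    then have "P \<in> pg_points" using S by auto
    from d this P show "P \<in> ?C \<union> ?B \<union> (\<Union>r\<in>UNIV. ?A r)" by (cases rule: pencil_cases) auto
  qed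
  then have S: "S = ?C \<union> ?B \<union> (\<Union>r\<in>UNIV. ?A r)" by (auto split: if_splits)
  have "card (\<Union>r\<in>UNIV. ?A r) = (\<Sum>r\<in>UNIV. card (?A r))"
    using pencil_lines_distinct(1)[OF d] by (intro card_UN_disjoint) auto
  also have "\<dots> = (\<Sum>r\<in>UNIV. card {s. pt (y + r *s z + s *s p) \<in> S})"
    by (intro sum.cong card_image inj_onI refl) (simp only: pencil_lines_distinct(1)[OF d])
  finally have A: "card (\<Union>r\<in>UNIV. ?A r) = (\<Sum>r\<in>UNIV. card {s. pt (y + r *s z + s *s p) \<in> S})" .
  have B: "card ?B = card {s. pt (z + s *s p) \<in> S}"
    by (intro card_image inj_onI) (simp only: pt_pencil_inj(1)[OF det3_pencil(2)[OF d]])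
  have CB: "?C \<inter> ?B = {}" using pt_pencil_inj(2)[OF det3_pencil(2)[OF d]] by auto
  have "pt p \<noteq> pt (y + r *s z + s *s p)" for r s using pt_pencil_inj(2)[OF det3_pencil(1)[OF d]] by metis
  moreover have "pt (z + s' *s p) \<noteq> pt (y + r *s z + s *s p)" for r s s' using pencil_lines_distinct(2)[OF d] by metis
  ultimately have CBA: "(?C \<union> ?B) \<inter> (\<Union>r\<in>UNIV. ?A r) = {}" by (auto split: if_splits)
  have "card S = card (?C \<union> ?B \<union> (\<Union>r\<in>UNIV. ?A r))" using S by (rule arg_cong)
  also have "\<dots> = card ?C + card ?B + card (\<Union>r\<in>UNIV. ?A r)"
    using CB CBA by (subst card_Un_disjoint, simp, simp, simp) (subst card_Un_disjoint, auto)
  finally show ?thesis unfolding A B by simp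
qed

text \<open>Two lines of the pencil share only the vertex, so each line counted here uses up a point
  of \<open>S\<close> of its own.\<close>

lemma card_bad_lines:
  fixes S :: "('a::{field,finite} ^ 3) set set"
  assumes d: "det3 p y z \<noteq> 0"
  shows "card {r. \<exists>s. pt (y + r *s z + s *s p) \<in> S} \<le> card S"
proof -
  let ?R = "{r. \<exists>s. pt (y + r *s z + s *s p) \<in> S}"
  have "\<forall>r\<in>?R. \<exists>s. pt (y + r *s z + s *s p) \<in> S" by auto
  from bchoice[OF this] obtain s where s: "\<forall>r\<in>?R. pt (y + r *s z + s r *s p) \<in> S" by blast
  show ?thesis
  proof (rule card_inj_on_le[where f = "\<lambda>r. pt (y + r *s z + s r *s p)"])
    show "inj_on (\<lambda>r. pt (y + r *s z + s r *s p)) ?R"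
      by (intro inj_onI) (simp only: pencil_lines_distinct(1)[OF d])
  qed (use s in auto)
qed

section \<open>Maximal arcs of degree 4\<close>

lemma maximal_arc4_line:
  assumes "maximal_arc4 K" "cr p u \<noteq> 0"
  shows "(if pt p \<in> K then 1 else 0) + card {s. pt (u + s *s p) \<in> K} \<in> {0, 4}"
proof -
  have "card {P \<in> K. P \<subseteq> vec.span {p, u}} \<in> {0, 4}"
    using assms(1) span2_in_pg_lines[OF assms(2)] unfolding maximal_arc4_def by blast
  moreover have "K \<subseteq> pg_points" using assms(1) by (simp add: maximal_arc4_def)
  ultimately show ?thesis using card_on_line[OF assms(2), of K] by simp
qed

text \<open>For q > 4 the plane has more points than the arc. Counting along the lines through a
  point off the arc gives a multiple of 4, so 4 divides 3 q + 4.\<close>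

lemma maximal_arc4_even:
  fixes K :: "('a::{field,finite} ^ 3) set set"
  assumes K: "maximal_arc4 K" and q: "CARD('a) > 4"
  shows "4 dvd CARD('a)"
proof -
  have "\<exists>v. v \<noteq> 0 \<and> pt v \<notin> K"
  proof (rule ccontr)
    assume "\<nexists>v. v \<noteq> 0 \<and> pt v \<notin> K"
    then have all: "v \<noteq> 0 \<Longrightarrow> pt v \<in> K" for v by blast
    define p y z :: "'a ^ 3" where "p = axis 1 1" and "y = axis 2 1" and "z = axis 3 1"
    have d: "det3 p y z \<noteq> 0" by (simp add: det3_eq p_def y_def z_def axis_def)
    have "y + r *s z + s *s p \<noteq> 0" for r s by (rule plus_scale_nonzero[OF det3_pencil(1)[OF d]])
    then have "{s. pt (y + r *s z + s *s p) \<in> K} = UNIV" for r using all by blast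
    then have "CARD('a) * CARD('a) \<le> card K"
      using card_pencil[OF d, of K] K by (simp add: maximal_arc4_def)
    also have "\<dots> = 3 * CARD('a) + 4" using K by (simp add: maximal_arc4_def)
    finally have "CARD('a) * CARD('a) \<le> 3 * CARD('a) + 4" .
    moreover have "4 * CARD('a) < CARD('a) * CARD('a)" using q by simp
    ultimately show False using q by linarith
  qed
  then obtain p where p: "p \<noteq> 0" "pt p \<notin> K" by blast
  obtain y where y: "cr p y \<noteq> 0" using ex_second[OF p(1)] .
  obtain z where d: "det3 p y z \<noteq> 0" using ex_third[OF y] .
  have "4 dvd card {s. pt (u + s *s p) \<in> K}" if "cr p u \<noteq> 0" for u
    using maximal_arc4_line[OF K that] p by auto
  then have "4 dvd card K"
    using card_pencil[OF d, of K] K p det3_pencil[OF d] by (auto simp: maximal_arc4_def intro!: dvd_add dvd_sum)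
  then have "4 dvd 3 * CARD('a)" using K by (simp add: maximal_arc4_def)
  moreover have "coprime 4 (3::nat)" by (simp add: coprime_iff_gcd_eq_1 gcd_nat.simps)
  ultimately show ?thesis using coprime_dvd_mult_right_iff by blast
qed

text \<open>Otherwise the nonzero elements would fall into pairs \<open>{x, - x}\<close>, and the
  field would have an odd number of elements.\<close>

lemma even_card_imp_char2:
  assumes "even CARD('a::{field,finite})"
  shows "(1::'a) + 1 = 0"
proof (rule ccontr)
  assume ne: "(1::'a) + 1 \<noteq> 0"
  define P where "P = (\<lambda>x::'a. {x, - x}) ` (UNIV - {0})"
  have neq: "x \<noteq> - x" if "x \<noteq> 0" for x :: 'a
  proof
    assume "x = - x"
    then have "x + x = 0" by (metis add.right_inverse)
    then have "x * (1 + 1) = 0" by (simp only: distrib_left mult_1_right)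
    then show False using ne that by (metis mult_eq_0_iff)
  qed
  have "card (\<Union>P) = (\<Sum>A\<in>P. card A)"
    by (rule card_Union_disjoint) (auto simp: P_def pairwise_def disjnt_def)
  also have "\<dots> = (\<Sum>A\<in>P. 2)"
  proof (intro sum.cong refl)
    fix A assume "A \<in> P"
    then obtain x where "A = {x, - x}" "x \<noteq> 0" by (auto simp: P_def)
    then show "card A = 2" using neq[of x] unfolding card_2_iff by blast
  qed
  finally have "even (card (\<Union>P))" by simp
  moreover have "\<Union>P = UNIV - {0}" by (auto simp: P_def)
  ultimately have "even (card (UNIV - {0::'a}))" by simp
  moreover have "CARD('a) = Suc (card (UNIV - {0::'a}))" using card_Suc_Diff1[of UNIV "0::'a"] by simp
  ultimately show False using assms by (metis even_Suc)
qed

text \<open>A largest additive subgroup of 2-power order is the whole field: an element outside it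
  would give a disjoint coset, and the union would be such a subgroup of twice the size.\<close>

lemma char2_card_power2:
  assumes char: "(1::'a::{field,finite}) + 1 = 0"
  obtains h where "CARD('a) = 2 ^ h"
proof -
  define sg where "sg H \<longleftrightarrow> (0::'a) \<in> H \<and> (\<forall>x\<in>H. \<forall>y\<in>H. x + y \<in> H) \<and> (\<exists>h. card H = 2 ^ h)" for H
  have "sg {0}" by (auto simp: sg_def intro: exI[of _ 0])
  moreover have "\<forall>H. sg H \<longrightarrow> card H < Suc (CARD('a))" by (auto intro: card_mono simp: less_Suc_eq_le)
  ultimately obtain H where H: "sg H" "\<forall>H'. sg H' \<longrightarrow> card H' \<le> card H"
    using ex_has_greatest_nat[of sg "{0}" card "Suc (CARD('a))"] by blast
  have "H = UNIV"
  proof (rule ccontr)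
    assume "H \<noteq> UNIV"
    then obtain a where a: "a \<notin> H" by auto
    have self: "x + x = 0" for x :: 'a using char2_add_self[OF char] .
    let ?H' = "H \<union> (+) a ` H"
    have disj: "H \<inter> (+) a ` H = {}"
    proof (rule ccontr)
      assume "H \<inter> (+) a ` H \<noteq> {}"
      then obtain x where x: "x \<in> H" "a + x \<in> H" by auto
      then have "a + x + x \<in> H" using H(1) unfolding sg_def by blast
      moreover have "a + x + x = a" by (simp only: add.assoc self add_0_right)
      ultimately show False using a by simp
    qed
    have "card ?H' = 2 * card H" using disj by (subst card_Un_disjoint) (auto simp: card_image)
    moreover obtain h where h: "card H = 2 ^ h" using H(1) by (auto simp: sg_def)
    ultimately have c: "card ?H' = 2 ^ Suc h" "card ?H' > card H" by simp_all
    have mixed: "x + (a + y) \<in> ?H'" "(a + x) + y \<in> ?H'" "(a + x) + (a + y) \<in> ?H'" if "x \<in> H" "y \<in> H" for x y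
    proof -
      have xy: "x + y \<in> H" using H(1) that by (auto simp: sg_def)
      have "x + (a + y) = a + (x + y)" "(a + x) + y = a + (x + y)" "(a + x) + (a + y) = (a + a) + (x + y)"
        by (simp_all only: add_ac)
      then show "x + (a + y) \<in> ?H'" "(a + x) + y \<in> ?H'" "(a + x) + (a + y) \<in> ?H'" using xy self[of a] by auto
    qed
    have "sg ?H'"
      unfolding sg_def
    proof (intro conjI ballI)
      show "0 \<in> ?H'" using H(1) by (auto simp: sg_def)
      show "\<exists>h. card ?H' = 2 ^ h" using c by blast
      fix x y assume "x \<in> ?H'" "y \<in> ?H'"
      then show "x + y \<in> ?H'" using mixed H(1) by (elim UnE imageE) (auto simp: sg_def)
    qed
    then show False using H(2) c by (metis not_le)
  qed
  then show thesis using H(1) that by (auto simp: sg_def)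
qed

text \<open>Since 2^10 < 6^4, the exponent of q is at least 11.\<close>

lemma char2_card_32:
  assumes char: "(1::'a::{field,finite}) + 1 = 0" and q: "CARD('a) > 6 ^ 4"
  obtains q' where "CARD('a) = 32 * q'" "64 \<le> q'"
proof -
  obtain h where h: "CARD('a) = 2 ^ h" using char2_card_power2[OF char] .
  have "(2::nat) ^ 10 < 2 ^ h" using q h by simp
  then have "11 \<le> h" using power_less_imp_less_exp[of "2::nat" 10 h] by simp
  then have h5: "h = 5 + (h - 5)" "6 \<le> h - 5" by simp_all
  have "CARD('a) = 2 ^ (5 + (h - 5))" using h h5(1) by simp
  then have "CARD('a) = 32 * 2 ^ (h - 5)" by (simp only: power_add) simp
  moreover have "(2::nat) ^ 6 \<le> 2 ^ (h - 5)" using h5(2) by (intro power_increasing) auto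
  ultimately show thesis by (intro that[of "2 ^ (h - 5)"]) simp_all
qed

section \<open>Conics in characteristic 2\<close>

definition cf :: "'a::field poly3 \<Rightarrow> nat \<Rightarrow> nat \<Rightarrow> nat \<Rightarrow> 'a" where
  "cf F a b c = lookup F (single 1 a + single 2 b + single 3 c)"

lemma ev_forms_expand:
  assumes "F \<in> forms n" "ring_hom_fun h"
  shows "ev h v F = (\<Sum>a\<le>n. \<Sum>b\<le>n - a. h (cf F a b (n - a - b)) * (v 1 ^ a * v 2 ^ b * v 3 ^ (n - a - b)))"
proof -
  have "ev h v F = (\<Sum>m\<in>{m. mdeg m = n}. h (lookup F m) * mval v m)"
    using assms by (intro ev_superset finite_mdeg) (auto simp: forms_def)
  also have "\<dots> = (\<Sum>(a, b)\<in>(SIGMA a:{..n}. {..n - a}). h (cf F a b (n - a - b)) * (v 1 ^ a * v 2 ^ b * v 3 ^ (n - a - b)))"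
  proof (subst sum.reindex_bij_betw[OF bij_betw_mdeg[of n], symmetric], intro sum.cong refl)
    fix m :: "3 \<Rightarrow>\<^sub>0 nat" assume m: "m \<in> {m. mdeg m = n}"
    let ?a = "lookup m 1" and ?b = "lookup m 2" and ?c = "lookup m 3"
    have c: "n - ?a - ?b = ?c" using m by (auto simp: mdeg_3)
    have "m = single 1 ?a + single 2 ?b + single 3 ?c"
      by (rule poly_mapping_3_eqI) (simp_all add: lookup_add lookup_single)
    then have "cf F ?a ?b ?c = lookup F m" by (simp add: cf_def)
    moreover have "mval v m = v 1 ^ ?a * v 2 ^ ?b * v 3 ^ ?c" by (simp only: mval_def prod_UNIV_3)
    ultimately show "h (lookup F m) * mval v m =
      (case (?a, ?b) of (a, b) \<Rightarrow> h (cf F a b (n - a - b)) * (v 1 ^ a * v 2 ^ b * v 3 ^ (n - a - b)))"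
      by (simp only: prod.case c)
  qed
  also have "\<dots> = (\<Sum>a\<le>n. \<Sum>b\<le>n - a. h (cf F a b (n - a - b)) * (v 1 ^ a * v 2 ^ b * v 3 ^ (n - a - b)))"
    by (simp add: sum.Sigma)
  finally show ?thesis .
qed

lemma atMost_2: "{..2::nat} = {0, 1, 2}" and atMost_3: "{..3::nat} = {0, 1, 2, 3}" and atMost_1: "{..1::nat} = {0, 1}"
  by auto

lemma ev_forms_1:
  assumes "F \<in> forms 1" "ring_hom_fun h"
  shows "ev h v F = h (cf F 1 0 0) * v 1 + h (cf F 0 1 0) * v 2 + h (cf F 0 0 1) * v 3"
  unfolding ev_forms_expand[OF assms] by (simp add: atMost_1[unfolded One_nat_def])

lemma ev_forms_2:
  assumes "F \<in> forms 2" "ring_hom_fun h"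
  shows "ev h v F = h (cf F 2 0 0) * (v 1)\<^sup>2 + h (cf F 0 2 0) * (v 2)\<^sup>2 + h (cf F 0 0 2) * (v 3)\<^sup>2 +
    h (cf F 1 1 0) * (v 1 * v 2) + h (cf F 1 0 1) * (v 1 * v 3) + h (cf F 0 1 1) * (v 2 * v 3)"
  unfolding ev_forms_expand[OF assms] by (simp add: atMost_2 atMost_1[unfolded One_nat_def] add_ac)

text \<open>In characteristic 2 the polar form of a conic is alternating, so in three variables it
  has the shape \<open>det3 n u v\<close>. The vector \<open>n\<close> consists of the mixed
  coefficients and represents the nucleus if the conic is non-degenerate.\<close>

definition nuc :: "'a::field poly3 \<Rightarrow> 'a ^ 3" where
  "nuc C = vector [cf C 0 1 1, cf C 1 0 1, cf C 1 1 0]"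

lemma eval3_forms_2:
  assumes "C \<in> forms 2"
  shows "eval3 C v = cf C 2 0 0 * (v $ 1)\<^sup>2 + cf C 0 2 0 * (v $ 2)\<^sup>2 + cf C 0 0 2 * (v $ 3)\<^sup>2 +
    nuc C $ 3 * (v $ 1 * v $ 2) + nuc C $ 2 * (v $ 1 * v $ 3) + nuc C $ 1 * (v $ 2 * v $ 3)"
  unfolding eval3_conv_ev ev_forms_2[OF assms ring_hom_fun_id] by (simp add: nuc_def)

text \<open>A line gives a quadratic polynomial whose middle coefficient vanishes exactly if the
  line passes through the nucleus (or \<open>nuc C\<close> is 0). The equation is an integral
  identity up to a multiple of 2.\<close>

lemma eval3_conic_polar:
  fixes C :: "'a::field poly3"
  assumes char: "(1::'a) + 1 = 0" and C: "C \<in> forms 2"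
  shows "eval3 C (u + s *s v) = eval3 C u + s * det3 (nuc C) u v + s\<^sup>2 * eval3 C v"
proof -
  have "eval3 C (u + s *s v) = eval3 C u + s * det3 (nuc C) u v + s\<^sup>2 * eval3 C v +
    2 * (s * (cf C 2 0 0 * u $ 1 * v $ 1 + cf C 0 2 0 * u $ 2 * v $ 2 + cf C 0 0 2 * u $ 3 * v $ 3
      + nuc C $ 1 * u $ 3 * v $ 2 + nuc C $ 2 * u $ 1 * v $ 3 + nuc C $ 3 * u $ 2 * v $ 1))"
    unfolding eval3_forms_2[OF C] det3_eq by (simp add: power2_eq_square algebra_simps)
  moreover have "(2::'a) = 0" using char by simp
  ultimately show ?thesis by simp
qed

lemma det3_swap: "det3 n v u = - det3 n u v"
  by (simp add: det3_eq)

lemma det3_same [simp]: "det3 u v u = 0" "det3 u v v = 0" "det3 v v u = 0"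
  by (simp_all add: det3_eq)

lemma det3_rotate: "det3 u v w = det3 v w u" "det3 u v w = det3 w u v"
  by (simp_all add: det3_eq algebra_simps)

lemma char2_uminus: "(1::'b::comm_ring_1) + 1 = 0 \<Longrightarrow> - x = (x::'b)"
  by (rule minus_unique[OF char2_add_self])

lemma ex_plane_basis:
  fixes a :: "'a::field ^ 3"
  obtains p u where "cr p u \<noteq> 0" "dot3 a p = 0" "dot3 a u = 0"
proof (cases "a = 0")
  case True
  then show thesis by (intro that[of "axis 1 1" "axis 2 1"]) (auto simp: vec3_eq_iff axis_def dot3_def)
next
  case False
  then obtain y where "cr a y \<noteq> 0" by (rule ex_second)
  then obtain w where w: "det3 a y w \<noteq> 0" by (rule ex_third)
  have "cr (cr a y) (cr a w) = det3 a y w *s a"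
    by (simp add: vec3_eq_iff det3_eq algebra_simps)
  moreover have "det3 a y w *s a \<noteq> 0" using w False by simp
  ultimately have "cr (cr a y) (cr a w) \<noteq> 0" by simp
  moreover have "dot3 a (cr a y) = 0" "dot3 a (cr a w) = 0" by (simp_all add: dot3_def algebra_simps)
  ultimately show thesis by (rule that)
qed

text \<open>A form of degree at least 2 does not divide a linear form, so by Bezout the
  \<open>CARD('a)\<close> points of the line other than \<open>pt p\<close> number at most
  \<open>d\<close>.\<close>

lemma irreducible_not_on_line:
  fixes F :: "'a::{field,finite} poly3"
  assumes F: "F \<in> forms d" "irreducible F" "d \<ge> 2"
    and line: "cr p u \<noteq> 0" "\<And>s. eval3 F (u + s *s p) = 0"
  shows "CARD('a) \<le> d"
proof -
  define L where "L = linf (cr p u)"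
  have L: "L \<in> forms 1" unfolding L_def by (rule linf_forms)
  obtain a where "dot3 a (cr p u) = 1" using ex_linf_nonzero[OF line(1)] .
  then have "eval3 L a = 1" by (simp add: L_def eval3_linf dot3_def mult.commute)
  then have "L \<noteq> 0" by auto
  have "\<not> F dvd L"
  proof
    assume "F dvd L"
    then obtain c where c: "L = F * c" by auto
    then obtain i j where "F \<in> forms i" "i + j = 1" using forms_factor[of F c 1] L \<open>L \<noteq> 0\<close> by metis
    moreover have "F \<noteq> 0" using F by auto
    ultimately show False using forms_unique[OF F(1), of i] F(3) by simp
  qed
  then have le: "card (curve_points F \<inter> curve_points L) \<le> d * 1" by (rule bezout_curves[OF F(1,2) L])
  have "eval3 L (u + s *s p) = 0" for s by (simp add: L_def eval3_linf dot3_def algebra_simps)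
  then have "pt (u + s *s p) \<in> curve_points F \<inter> curve_points L" for s
    using plus_scale_nonzero[OF line(1)] line(2)
    by (simp add: pt_in_curve_points[OF F(1)] pt_in_curve_points[OF L])
  then have "card (range (\<lambda>s. pt (u + s *s p))) \<le> card (curve_points F \<inter> curve_points L)"
    by (intro card_mono) auto
  moreover have "card (range (\<lambda>s. pt (u + s *s p))) = CARD('a)"
    by (intro card_image inj_onI) (simp only: pt_pencil_inj(1)[OF line(1)])
  ultimately show ?thesis using le by simp
qed

text \<open>If \<open>nuc C\<close> is 0, the conic is the square of a linear form and contains a
  line. If it is a nonzero point of the conic, the line joining it to another point is contained in
  the conic. The second point is needed: two conjugate lines over the quadratic extension form an
  irreducible conic whose only rational point is its nucleus.\<close>

lemma irreducible_conic_nuc: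
  fixes C :: "'a::{field,finite} poly3"
  assumes char: "(1::'a) + 1 = 0" and q: "CARD('a) > 2"
    and C: "C \<in> forms 2" "irreducible C" and pts: "card (curve_points C) \<ge> 2"
  shows "eval3 C (nuc C) \<noteq> 0"
proof
  assume 0: "eval3 C (nuc C) = 0"
  have "\<forall>x::'a. \<exists>y. y\<^sup>2 = x" using char2_sqrt[OF char] by blast
  from choice[OF this] obtain r :: "'a \<Rightarrow> 'a" where r: "\<And>x. (r x)\<^sup>2 = x" by blast
  show False
  proof (cases "nuc C = 0")
    case True
    define al :: "'a ^ 3" where "al = vector [r (cf C 2 0 0), r (cf C 0 2 0), r (cf C 0 0 2)]"
    have "eval3 C v = (dot3 al v)\<^sup>2" for v
      by (simp add: eval3_forms_2[OF C(1)] True dot3_def al_def char2_square_add[OF char] power_mult_distrib r)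
    moreover obtain p u where pu: "cr p u \<noteq> 0" "dot3 al p = 0" "dot3 al u = 0" by (rule ex_plane_basis)
    moreover have "dot3 al (u + s *s p) = dot3 al u + s * dot3 al p" for s by (simp add: dot3_def algebra_simps)
    ultimately have "eval3 C (u + s *s p) = 0" for s by simp
    from irreducible_not_on_line[OF C _ pu(1) this] q show False by simp
  next
    case False
    have "\<not> curve_points C \<subseteq> {pt (nuc C)}"
    proof
      assume "curve_points C \<subseteq> {pt (nuc C)}"
      then have "card (curve_points C) \<le> card {pt (nuc C)}" by (intro card_mono) auto
      then show False using pts by simp
    qed
    then obtain P where P: "P \<in> curve_points C" "P \<noteq> pt (nuc C)" by auto
    from P(1) obtain w where w: "w \<noteq> 0" "P = pt w" "eval3 C w = 0" by (rule curve_pointsE)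
    have "cr (nuc C) w \<noteq> 0" using P(2) w pt_eqI[of "nuc C" w] False by auto
    moreover have "eval3 C (w + s *s nuc C) = 0" for s
      unfolding eval3_conic_polar[OF char C(1)] using 0 w(3) by simp
    ultimately have "CARD('a) \<le> 2" using irreducible_not_on_line[OF C] by blast
    then show False using q by simp
  qed
qed

text \<open>The image of the Artin--Schreier map.\<close>

definition AS :: "'a::field set" where
  "AS = range (\<lambda>z. z\<^sup>2 + z)"

lemma AS_fibre:
  assumes char: "(1::'a::{field,finite}) + 1 = 0"
  shows "card {z::'a. z\<^sup>2 + z = t} = (if t \<in> AS then 2 else 0)"
proof (cases "t \<in> AS")
  case True
  then obtain z0 where z0: "t = z0\<^sup>2 + z0" by (auto simp: AS_def)
  have "z\<^sup>2 + z = t \<longleftrightarrow> z = z0 \<or> z = z0 + 1" for z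
  proof -
    have "z\<^sup>2 + z = t \<longleftrightarrow> z\<^sup>2 + z - t = 0" by simp
    also have "z\<^sup>2 + z - t = (z - z0) * (z - (z0 + 1)) + 2 * (z + z * z0 - z0\<^sup>2 - z0)"
      by (simp add: z0 power2_eq_square algebra_simps)
    also have "\<dots> = (z - z0) * (z - (z0 + 1))" using char by simp
    finally show ?thesis by (simp add: eq_diff_eq)
  qed
  then have "{z. z\<^sup>2 + z = t} = {z0, z0 + 1}" by auto
  then show ?thesis using True by simp
next
  case False
  then have "{z. z\<^sup>2 + z = t} = {}" by (auto simp: AS_def)
  then show ?thesis using False by simp
qed

lemma AS_add:
  assumes char: "(1::'a::field) + 1 = 0" and "x \<in> AS" "y \<in> AS"
  shows "(x::'a) + y \<in> AS"
proof -
  obtain z w where "x = z\<^sup>2 + z" "y = w\<^sup>2 + w" using assms by (auto simp: AS_def)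
  then have "x + y = (z + w)\<^sup>2 + (z + w)" by (simp add: char2_square_add[OF char])
  then show ?thesis unfolding AS_def by (rule range_eqI)
qed

text \<open>The two sums differ by \<open>x^2 + x\<close>, an element of the subgroup. In this way
  squares are replaced by their roots, which makes quadratic terms linear.\<close>

lemma AS_square_iff:
  assumes char: "(1::'a::field) + 1 = 0"
  shows "x\<^sup>2 + y \<in> AS \<longleftrightarrow> (x::'a) + y \<in> AS"
proof -
  have "x\<^sup>2 + x \<in> AS" by (auto simp: AS_def)
  moreover have "x\<^sup>2 + x + (x\<^sup>2 + y) = x + y + 2 * x\<^sup>2" "x\<^sup>2 + x + (x + y) = x\<^sup>2 + y + 2 * x" by (simp_all add: algebra_simps)
  then have "x\<^sup>2 + x + (x\<^sup>2 + y) = x + y" "x\<^sup>2 + x + (x + y) = x\<^sup>2 + y" using char by simp_all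
  ultimately show ?thesis using AS_add[OF char] by metis
qed

lemma card_AS:
  assumes char: "(1::'a::{field,finite}) + 1 = 0"
  shows "CARD('a) = 2 * card (AS :: 'a set)"
proof -
  have "CARD('a) = card (\<Union>t\<in>AS. {z::'a. z\<^sup>2 + z = t})" by (rule arg_cong[where f = card]) (auto simp: AS_def)
  also have "\<dots> = (\<Sum>t\<in>AS. card {z::'a. z\<^sup>2 + z = t})" by (intro card_UN_disjoint) auto
  also have "\<dots> = (\<Sum>t\<in>(AS :: 'a set). 2)" by (intro sum.cong) (simp_all add: AS_fibre[OF char])
  finally show ?thesis by simp
qed

text \<open>The translate of \<open>AS\<close> by \<open>x\<close> is disjoint from
  \<open>AS\<close>. Both contain half of the field, so the translate is the complement and contains
  \<open>y\<close>.\<close>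

lemma not_AS_add:
  assumes char: "(1::'a::{field,finite}) + 1 = 0" and x: "x \<notin> AS" and y: "y \<notin> AS"
  shows "(x::'a) + y \<in> AS"
proof -
  have disj: "AS \<inter> (+) x ` AS = {}"
  proof (rule ccontr)
    assume "AS \<inter> (+) x ` AS \<noteq> {}"
    then obtain t where "t \<in> AS" "x + t \<in> AS" by auto
    then have "x + t + t \<in> AS" using AS_add[OF char] by blast
    moreover have "x + t + t = x" using char2_add_self[OF char, of t] by (simp only: add.assoc add_0_right)
    ultimately show False using x by simp
  qed
  have "card (AS \<union> (+) x ` AS) = card (AS :: 'a set) + card ((+) x ` AS)" using disj by (intro card_Un_disjoint) auto
  also have "\<dots> = CARD('a)" unfolding card_AS[OF char] by (simp add: card_image)
  finally have "AS \<union> (+) x ` AS = UNIV" by (metis card_subset_eq finite_UNIV finite subset_UNIV)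
  then obtain t where t: "t \<in> AS" "y = x + t" using y by auto
  have "x + y = t" unfolding t(2) by (simp only: add.assoc[symmetric] char2_add_self[OF char] add_0_left)
  then show ?thesis using t(1) by (simp only:)
qed

lemma AS_add_iff:
  assumes char: "(1::'a::{field,finite}) + 1 = 0"
  shows "x + y \<in> AS \<longleftrightarrow> ((x::'a) \<in> AS \<longleftrightarrow> y \<in> AS)"
proof -
  have "y \<in> AS" if "x + y \<in> AS" "x \<in> AS" for x y :: 'a
  proof -
    have "x + (x + y) = y" by (simp only: add.assoc[symmetric] char2_add_self[OF char] add_0_left)
    then show ?thesis using AS_add[OF char that(2,1)] by (simp only:)
  qed
  then show ?thesis using AS_add[OF char] not_AS_add[OF char] by (metis add.commute)
qed

text \<open>If \<open>a\<close> and \<open>b\<close> are nonzero, the substitution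
  \<open>s = b / a * z\<close> turns the equation into \<open>z^2 + z = a * c / b^2\<close>. If only
  \<open>a\<close> is nonzero, the root is the unique square root of \<open>c / a\<close>.\<close>

lemma card_quadratic_roots:
  assumes char: "(1::'a::{field,finite}) + 1 = 0"
  shows "a \<noteq> 0 \<Longrightarrow> b \<noteq> 0 \<Longrightarrow> card {s::'a. c + s * b + s\<^sup>2 * a = 0} = (if a * c / b\<^sup>2 \<in> AS then 2 else 0)"
    and "a = 0 \<Longrightarrow> b \<noteq> 0 \<Longrightarrow> card {s::'a. c + s * b + s\<^sup>2 * a = 0} = 1"
    and "a \<noteq> 0 \<Longrightarrow> b = 0 \<Longrightarrow> card {s::'a. c + s * b + s\<^sup>2 * a = 0} = 1"
proof -
  show "card {s::'a. c + s * b + s\<^sup>2 * a = 0} = (if a * c / b\<^sup>2 \<in> AS then 2 else 0)" if ab: "a \<noteq> 0" "b \<noteq> 0"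
  proof -
    have key: "c + (b / a * z) * b + (b / a * z)\<^sup>2 * a = 0 \<longleftrightarrow> z\<^sup>2 + z = a * c / b\<^sup>2" for z
    proof -
      have "c + (b / a * z) * b + (b / a * z)\<^sup>2 * a = (b\<^sup>2 / a) * (a * c / b\<^sup>2 + (z\<^sup>2 + z))"
        using ab by (simp add: field_simps power2_eq_square)
      then have "c + (b / a * z) * b + (b / a * z)\<^sup>2 * a = 0 \<longleftrightarrow> a * c / b\<^sup>2 + (z\<^sup>2 + z) = 0" using ab by simp
      also have "\<dots> \<longleftrightarrow> z\<^sup>2 + z = - (a * c / b\<^sup>2)" by (simp only: eq_neg_iff_add_eq_0 add.commute)
      finally show ?thesis by (simp only: char2_uminus[OF char])
    qed
    have img: "{s. c + s * b + s\<^sup>2 * a = 0} = (\<lambda>z. b / a * z) ` {z. z\<^sup>2 + z = a * c / b\<^sup>2}"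
    proof (intro subset_antisym subsetI)
      fix s assume s: "s \<in> {s. c + s * b + s\<^sup>2 * a = 0}"
      have sz: "s = b / a * (s * a / b)" using ab by simp
      with s have "s * a / b \<in> {z. z\<^sup>2 + z = a * c / b\<^sup>2}" using key[of "s * a / b"] by simp
      with sz show "s \<in> (\<lambda>z. b / a * z) ` {z. z\<^sup>2 + z = a * c / b\<^sup>2}" by (rule image_eqI)
    next
      fix s assume "s \<in> (\<lambda>z. b / a * z) ` {z. z\<^sup>2 + z = a * c / b\<^sup>2}"
      then obtain z where "s = b / a * z" "z\<^sup>2 + z = a * c / b\<^sup>2" by blast
      then show "s \<in> {s. c + s * b + s\<^sup>2 * a = 0}" using key[of z] by simp
    qed
    have "card {s. c + s * b + s\<^sup>2 * a = 0} = card {z. z\<^sup>2 + z = a * c / b\<^sup>2}"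
      unfolding img using ab by (intro card_image inj_onI) simp
    then show ?thesis unfolding AS_fibre[OF char] .
  qed
  show "card {s::'a. c + s * b + s\<^sup>2 * a = 0} = 1" if ab: "a = 0" "b \<noteq> 0"
  proof -
    have "c + s * b + s\<^sup>2 * a = 0 \<longleftrightarrow> s = - c / b" for s
    proof -
      have "c + s * b + s\<^sup>2 * a = (s - (- c / b)) * b" using ab by (simp add: field_simps)
      then show ?thesis using ab(2) by (simp only: mult_eq_0_iff right_minus_eq simp_thms)
    qed
    then have "{s. c + s * b + s\<^sup>2 * a = 0} = {- c / b}" by auto
    then show ?thesis by simp
  qed
  show "card {s::'a. c + s * b + s\<^sup>2 * a = 0} = 1" if ab: "a \<noteq> 0" "b = 0"
  proof -
    obtain w where w: "w\<^sup>2 = c / a" by (rule char2_sqrt[OF char])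
    have "c + s * b + s\<^sup>2 * a = 0 \<longleftrightarrow> s = w" for s
    proof -
      have "c + s * b + s\<^sup>2 * a = 0 \<longleftrightarrow> s\<^sup>2 * a = - c" using ab by (simp add: eq_neg_iff_add_eq_0 add.commute)
      also have "\<dots> \<longleftrightarrow> s\<^sup>2 = w\<^sup>2" unfolding char2_uminus[OF char] w using ab by (simp add: eq_divide_eq)
      also have "\<dots> \<longleftrightarrow> s = w" using char2_power2_inj[OF char] by auto
      finally show ?thesis .
    qed
    then have "{s. c + s * b + s\<^sup>2 * a = 0} = {w}" by auto
    then show ?thesis by simp
  qed
qed

lemma card_conic_line:
  fixes C :: "'a::{field,finite} poly3"
  assumes char: "(1::'a) + 1 = 0" and C: "C \<in> forms 2"
  shows "det3 (nuc C) u p \<noteq> 0 \<Longrightarrow> eval3 C p \<noteq> 0 \<Longrightarrow>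
      card {s. eval3 C (u + s *s p) = 0} = (if eval3 C p * eval3 C u / (det3 (nuc C) u p)\<^sup>2 \<in> AS then 2 else 0)"
    "det3 (nuc C) u p \<noteq> 0 \<Longrightarrow> eval3 C p = 0 \<Longrightarrow> card {s. eval3 C (u + s *s p) = 0} = 1"
    "det3 (nuc C) u p = 0 \<Longrightarrow> eval3 C p \<noteq> 0 \<Longrightarrow> card {s. eval3 C (u + s *s p) = 0} = 1"
  unfolding eval3_conic_polar[OF char C] using card_quadratic_roots[OF char] by auto

lemma curve_points_subset: "curve_points F \<subseteq> pg_points"
  by (auto simp: curve_points_def)

text \<open>Each of the q + 1 lines through the nucleus carries exactly one point of the
  conic.\<close>

lemma card_conic:
  fixes C :: "'a::{field,finite} poly3"
  assumes char: "(1::'a) + 1 = 0" and C: "C \<in> forms 2" "eval3 C (nuc C) \<noteq> 0"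
  shows "card (curve_points C) = CARD('a) + 1"
proof -
  have e0: "eval3 C 0 = 0" using eval3_scale[OF C(1), of 0 0] by simp
  then have nz: "nuc C \<noteq> 0" using C(2) by auto
  obtain y where y: "cr (nuc C) y \<noteq> 0" using ex_second[OF nz] .
  obtain z where d: "det3 (nuc C) y z \<noteq> 0" using ex_third[OF y] .
  have "card {s. pt (u + s *s nuc C) \<in> curve_points C} = 1" if "cr (nuc C) u \<noteq> 0" for u
  proof -
    have "{s. pt (u + s *s nuc C) \<in> curve_points C} = {s. eval3 C (u + s *s nuc C) = 0}"
      using plus_scale_nonzero[OF that] by (simp add: pt_in_curve_points[OF C(1)])
    then show ?thesis using card_conic_line(3)[OF char C(1) _ C(2)] by simp
  qed
  then show ?thesis
    using card_pencil[OF d curve_points_subset[of C]] det3_pencil[OF d] C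
    by (simp add: pt_in_curve_points[OF C(1)])
qed

text \<open>On a line that misses the nucleus the quadratic polynomial has a nonzero middle
  coefficient, and the number of points of the conic is 0 or 2, never 1.\<close>

lemma conic_nucleus:
  fixes C :: "'a::{field,finite} poly3"
  assumes char: "(1::'a) + 1 = 0" and C: "C \<in> forms 2" "eval3 C (nuc C) \<noteq> 0"
  shows "is_nucleus C (pt (nuc C))"
proof -
  have e0: "eval3 C 0 = 0" using eval3_scale[OF C(1), of 0 0] by simp
  then have nz: "nuc C \<noteq> 0" using C(2) by auto
  have "pt (nuc C) \<subseteq> t" if t: "tangent_line C t" for t
  proof (rule ccontr)
    assume nsub: "\<not> pt (nuc C) \<subseteq> t"
    obtain p u where pu: "cr p u \<noteq> 0" "t = vec.span {p, u}" using t pg_linesE unfolding tangent_line_def by blast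
    have "det3 (nuc C) u p \<noteq> 0"
    proof
      assume d: "det3 (nuc C) u p = 0"
      obtain w where w: "det3 p u w \<noteq> 0" using ex_third[OF pu(1)] .
      have "det3 p u w *s nuc C = det3 (nuc C) u w *s p + det3 p (nuc C) w *s u + det3 p u (nuc C) *s w"
        by (rule cramer3)
      moreover have "det3 p u (nuc C) = 0" using d det3_rotate(1)[of "nuc C" u p] det3_swap[of "nuc C" p u] det3_rotate(1)[of "nuc C" p u] by simp
      ultimately have "det3 p u w *s nuc C = det3 (nuc C) u w *s p + det3 p (nuc C) w *s u" by simp
      then have "det3 p u w *s nuc C \<in> t" unfolding pu(2) span2 by blast
      moreover have sub: "vec.subspace t" unfolding pu(2) by simp
      ultimately have "pt (det3 p u w *s nuc C) \<subseteq> t" using pt_subset_iff[OF sub] by blast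
      then show False using nsub pt_scale[OF w] by simp
    qed
    \<comment> \<open>The parameter \<open>s\<close> does not reach \<open>p\<close> itself. If
      \<open>p\<close> is on the conic, it makes up the second point.\<close>
    then have "card {s. eval3 C (u + s *s p) = 0} \<in> (if eval3 C p = 0 then {1} else {0, 2})"
      using card_conic_line[OF char C(1), of u p] by auto
    moreover have "{s. pt (u + s *s p) \<in> curve_points C} = {s. eval3 C (u + s *s p) = 0}"
      using plus_scale_nonzero[OF pu(1)] by (simp add: pt_in_curve_points[OF C(1)])
    moreover have "p \<noteq> 0" using pu(1) by auto
    moreover have "card {P \<in> curve_points C. P \<subseteq> t} = 1" using t by (simp add: tangent_line_def)
    ultimately show False
      using card_on_line[OF pu(1) curve_points_subset[of C]] unfolding pu(2)[symmetric]
      by (auto simp: pt_in_curve_points[OF C(1)] split: if_splits)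
  qed
  then show ?thesis using pt_in_pg_points[OF nz] by (simp add: is_nucleus_def)
qed

text \<open>If the conic were a product of two linear forms over the closure, the vector
  \<open>nuc C\<close> would be the cross product of their coefficient vectors, at which both
  factors vanish.\<close>

lemma conic_nondegenerate:
  fixes C :: "'a::field poly3"
  assumes char: "(1::'a) + 1 = 0" and C: "C \<in> forms 2" "eval3 C (nuc C) \<noteq> 0"
  shows "nondegenerate_conic C"
proof -
  have Cnz: "C \<noteq> 0" using C(2) by auto
  define D where "D = Poly_Mapping.map to_ac C"
  have lookup: "lookup D m = to_ac (lookup C m)" for m
    by (simp add: D_def map.rep_eq when_def)
  have keys: "keys D = keys C" by (auto simp: in_keys_iff lookup)
  have D: "D \<in> forms 2" using C(1) by (simp add: forms_def keys)
  have Dnz: "D \<noteq> 0" using Cnz keys by (metis keys_eq_empty)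
  have hom: "ring_hom_fun (to_ac :: 'a \<Rightarrow> 'a alg_closure)" by (simp add: ring_hom_fun_def)
  have cfD: "cf D i j k = to_ac (cf C i j k)" for i j k by (simp add: cf_def lookup)
  have "irreducible D"
  proof (rule Factorial_Ring.irreducibleI)
    show "\<not> D dvd 1" using unit_forms_0[of D] forms_unique[OF D, of 0] Dnz by auto
    fix a b assume ab: "D = a * b"
    show "a dvd 1 \<or> b dvd 1"
    proof (rule ccontr)
      assume nu: "\<not> (a dvd 1 \<or> b dvd 1)"
      obtain i j where ij: "a \<in> forms i" "b \<in> forms j" "i + j = 2" using forms_factor[of a b 2] D Dnz ab by metis
      have nz: "a \<noteq> 0" "b \<noteq> 0" using Dnz ab by auto
      have "i \<noteq> 0" "j \<noteq> 0" using ij nz nu forms_0_unit by metis+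
      then have "i = 1" "j = 1" using ij(3) by auto
      then have a: "a \<in> forms 1" and b: "b \<in> forms 1" using ij by auto
      define x1 x2 x3 y1 y2 y3 where xy: "x1 = cf a 1 0 0" "x2 = cf a 0 1 0" "x3 = cf a 0 0 1"
        "y1 = cf b 1 0 0" "y2 = cf b 0 1 0" "y3 = cf b 0 0 1"
      define vv where "vv p q r = (\<lambda>i::3. if i = 1 then p else if i = 2 then q else r)" for p q r :: "'a alg_closure"
      have vv: "vv p q r 1 = p" "vv p q r 2 = q" "vv p q r 3 = r" for p q r by (simp_all add: vv_def)
      \<comment> \<open>Evaluating at vectors with entries 0 and 1 compares coefficients on both
        sides.\<close>
      have eq: "cf D 2 0 0 * p\<^sup>2 + cf D 0 2 0 * q\<^sup>2 + cf D 0 0 2 * r\<^sup>2 + cf D 1 1 0 * (p * q) + cf D 1 0 1 * (p * r) + cf D 0 1 1 * (q * r)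
        = (x1 * p + x2 * q + x3 * r) * (y1 * p + y2 * q + y3 * r)" for p q r
        using ev_mult[OF ring_hom_fun_id, of "vv p q r" a b]
        unfolding ab[symmetric] ev_forms_2[OF D ring_hom_fun_id] ev_forms_1[OF a ring_hom_fun_id] ev_forms_1[OF b ring_hom_fun_id] vv xy .
      have 1: "cf D 2 0 0 = x1 * y1" using eq[of 1 0 0] by simp
      have 2: "cf D 0 2 0 = x2 * y2" using eq[of 0 1 0] by simp
      have 3: "cf D 0 0 2 = x3 * y3" using eq[of 0 0 1] by simp
      have 12: "cf D 1 1 0 = x1 * y2 + x2 * y1" using eq[of 1 1 0] 1 2 by (simp add: algebra_simps)
      have 13: "cf D 1 0 1 = x1 * y3 + x3 * y1" using eq[of 1 0 1] 1 3 by (simp add: algebra_simps)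
      have 23: "cf D 0 1 1 = x2 * y3 + x3 * y2" using eq[of 0 1 1] 2 3 by (simp add: algebra_simps)
      let ?n1 = "cf D 0 1 1" and ?n2 = "cf D 1 0 1" and ?n3 = "cf D 1 1 0"
      have "(1::'a alg_closure) + 1 = 0" using char by (metis to_ac_1 to_ac_add to_ac_0)
      then have two: "(2::'a alg_closure) = 0" by simp
      have "to_ac (eval3 C (nuc C)) = cf D 2 0 0 * ?n1\<^sup>2 + cf D 0 2 0 * ?n2\<^sup>2 + cf D 0 0 2 * ?n3\<^sup>2 + cf D 1 1 0 * (?n1 * ?n2) + cf D 1 0 1 * (?n1 * ?n3) + cf D 0 1 1 * (?n2 * ?n3)"
        by (simp add: eval3_forms_2[OF C(1)] cfD nuc_def)
      also have "\<dots> = (x1 * ?n1 + x2 * ?n2 + x3 * ?n3) * (y1 * ?n1 + y2 * ?n2 + y3 * ?n3)" by (rule eq)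
      also have "x1 * ?n1 + x2 * ?n2 + x3 * ?n3 = 2 * (x1 * x2 * y3 + x1 * x3 * y2 + x2 * x3 * y1)"
        unfolding 12 13 23 by (simp add: algebra_simps)
      finally show False using C(2) two by simp
    qed
  qed (rule Dnz)
  then show ?thesis using C(1) Cnz by (simp add: nondegenerate_conic_def plane_curve_iff absolutely_irreducible_def D_def)
qed

section \<open>Exceptional points\<close>

text \<open>The points at which the arc differs from the sum of the three sets taken with
  multiplicity. On a line avoiding them, numbers of points on the arc are sums over the three
  sets.\<close>

definition exceptional :: "('a::field ^ 3) set set \<Rightarrow> ('a ^ 3) set set \<Rightarrow> ('a ^ 3) set set \<Rightarrow> ('a ^ 3) set set \<Rightarrow> ('a ^ 3) set set" where
  "exceptional K A B C = {Q. of_bool (Q \<in> K) \<noteq> (of_bool (Q \<in> A) + of_bool (Q \<in> B) + of_bool (Q \<in> C) :: nat)}"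

lemma card_of_bool: "card A = (\<Sum>x\<in>UNIV. of_bool (x \<in> A))" for A :: "'b::finite set"
  by (simp add: of_bool_def sum.If_cases)

text \<open>The inequality holds point by point for the indicator functions. The factor 2 accounts
  for points of \<open>K\<close> on none of the three sets: they are exceptional, belong to
  \<open>K\<close> and lie in \<open>M\<close>.\<close>

lemma card_exceptional:
  fixes K :: "('a::{field,finite} ^ 3) set set"
  assumes "K \<subseteq> A \<union> B \<union> C \<union> M" "M \<subseteq> K"
  shows "card (exceptional K A B C) + card K \<le> card A + card B + card C + 2 * card M"
proof -
  let ?E = "exceptional K A B C"
  have "card ?E + card K = (\<Sum>Q\<in>UNIV. of_bool (Q \<in> ?E) + of_bool (Q \<in> K))"
    unfolding sum.distrib by (simp only: card_of_bool)
  also have "\<dots> \<le> (\<Sum>Q\<in>UNIV. of_bool (Q \<in> A) + of_bool (Q \<in> B) + of_bool (Q \<in> C) + 2 * of_bool (Q \<in> M))"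
    using assms by (intro sum_mono) (auto simp: exceptional_def)
  also have "\<dots> = card A + card B + card C + 2 * card M"
    unfolding sum.distrib sum_distrib_left[symmetric] by (simp only: card_of_bool)
  finally show ?thesis .
qed

lemma pencil_count:
  fixes K :: "('a::{field,finite} ^ 3) set set"
  assumes K: "maximal_arc4 K" and d: "det3 p y z \<noteq> 0"
    and F: "F1 \<in> forms n1" "F2 \<in> forms n2" "F3 \<in> forms n3"
    and r: "\<nexists>s. pt (y + r *s z + s *s p) \<in> exceptional K (curve_points F1) (curve_points F2) (curve_points F3)"
  shows "of_bool (pt p \<in> K) + (card {s. eval3 F1 (y + r *s z + s *s p) = 0} + card {s. eval3 F2 (y + r *s z + s *s p) = 0}
     + card {s. eval3 F3 (y + r *s z + s *s p) = 0}) \<in> {0, 4}"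
proof -
  let ?v = "\<lambda>s. y + r *s z + s *s p"
  have cb: "card {s. P s} = (\<Sum>s\<in>UNIV. of_bool (P s))" for P :: "'a \<Rightarrow> bool"
    using card_of_bool[of "{s. P s}"] by simp
  have nz: "?v s \<noteq> 0" for s by (rule plus_scale_nonzero[OF det3_pencil(1)[OF d]])
  have "card {s. pt (?v s) \<in> K} = (\<Sum>s\<in>UNIV. of_bool (pt (?v s) \<in> K))" by (rule cb)
  also have "\<dots> = (\<Sum>s\<in>UNIV. of_bool (eval3 F1 (?v s) = 0) + of_bool (eval3 F2 (?v s) = 0) + of_bool (eval3 F3 (?v s) = 0))"
    using r nz by (intro sum.cong refl)
      (simp add: exceptional_def pt_in_curve_points[OF F(1)] pt_in_curve_points[OF F(2)] pt_in_curve_points[OF F(3)])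
  also have "\<dots> = card {s. eval3 F1 (?v s) = 0} + card {s. eval3 F2 (?v s) = 0} + card {s. eval3 F3 (?v s) = 0}"
    unfolding sum.distrib cb ..
  finally have "card {s. pt (?v s) \<in> K} = card {s. eval3 F1 (?v s) = 0} + card {s. eval3 F2 (?v s) = 0} + card {s. eval3 F3 (?v s) = 0}" .
  then show ?thesis using maximal_arc4_line[OF K det3_pencil(1)[OF d], of r] by (simp add: of_bool_def)
qed

lemma card_linear_le_1:
  assumes "b \<noteq> 0 \<or> c \<noteq> (0::'a::{field,finite})"
  shows "card {r. c + r * b = 0} \<le> 1"
proof (cases "b = 0")
  case True
  then show ?thesis using assms by simp
next
  case False
  have "r = r'" if "c + r * b = 0" "c + r' * b = 0" for r r'
  proof -
    have "(r - r') * b = (c + r * b) - (c + r' * b)" by (simp add: algebra_simps)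
    then show ?thesis using that False by simp
  qed
  then show ?thesis by (auto simp: card_le_Suc0_iff_eq)
qed

lemma card_quadratic_le_2:
  assumes char: "(1::'a::{field,finite}) + 1 = 0" and "a \<noteq> 0 \<or> b \<noteq> 0 \<or> c \<noteq> 0"
  shows "card {s::'a. c + s * b + s\<^sup>2 * a = 0} \<le> 2"
  using card_quadratic_roots[OF char, of a b c] assms(2) by (cases "a = 0"; cases "b = 0") auto

lemma det3_tangent:
  assumes "det3 p y z \<noteq> 0" "cr n p \<noteq> 0"
  shows "det3 n z p \<noteq> 0 \<or> det3 n y p \<noteq> 0"
proof (rule ccontr)
  assume *: "\<not> (det3 n z p \<noteq> 0 \<or> det3 n y p \<noteq> 0)"
  have "det3 p y z *s n = det3 n y z *s p + det3 p n z *s y + det3 p y n *s z" by (rule cramer3)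
  moreover have "det3 p n z = 0" "det3 p y n = 0"
    using * by (simp_all add: det3_eq algebra_simps)
  ultimately have "det3 p y z *s n = det3 n y z *s p" by simp
  then have "cr (det3 p y z *s n) p = 0" by simp
  moreover have "cr (det3 p y z *s n) p = det3 p y z *s cr n p" by (simp add: vec3_eq_iff algebra_simps)
  ultimately have "det3 p y z *s cr n p = 0" by simp
  then show False using assms by simp
qed

text \<open>The determinant vanishes only for the line joining \<open>p\<close> to the
  nucleus.\<close>

lemma conic_tangents_le_1:
  fixes C :: "'a::{field,finite} poly3"
  assumes "det3 p y z \<noteq> 0" "cr (nuc C) p \<noteq> 0"
  shows "card {r. det3 (nuc C) (y + r *s z) p = 0} \<le> 1"
proof -
  have "det3 (nuc C) (y + r *s z) p = det3 (nuc C) y p + r * det3 (nuc C) z p" for r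
    by (simp add: det3_eq algebra_simps)
  then show ?thesis using card_linear_le_1[of "det3 (nuc C) z p" "det3 (nuc C) y p"] det3_tangent[OF assms] by simp
qed

lemma card_irreducible_conic_le:
  fixes C :: "'a::{field,finite} poly3"
  assumes char: "(1::'a) + 1 = 0" and q: "CARD('a) > 2"
    and C: "C \<in> forms 2" "irreducible C"
  shows "card (curve_points C) \<le> CARD('a) + 1"
proof (cases "card (curve_points C) \<ge> 2")
  case True
  then show ?thesis using card_conic[OF char C(1) irreducible_conic_nuc[OF char q C]] by simp
next
  case False
  then show ?thesis by simp
qed

lemma stepanov_curve:
  fixes F :: "'a::{field,finite} poly3"
  assumes char: "(1::'a) + 1 = 0" and q: "CARD('a) = 32 * q'" "64 \<le> q'"
    and F: "F \<in> forms d" "irreducible F"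
  shows "3 \<le> d \<Longrightarrow> d \<le> 5 \<Longrightarrow> card (curve_points F) \<le> 45 * q' + 63"
    "3 \<le> d \<Longrightarrow> d \<le> 7 \<Longrightarrow> card (curve_points F) \<le> 63 * q' + 63"
proof -
  obtain V where V: "proj_distinct V" "card V = card (curve_points F)" "\<And>v. v \<in> V \<Longrightarrow> pt v \<in> curve_points F"
    using ex_representatives[OF curve_points_subset] by blast
  have "\<And>v. v \<in> V \<Longrightarrow> eval3 F v = 0" using V(3) pt_in_curve_points[OF F(1)] by blast
  from stepanov_bounds[OF char q F V(1) this]
  show "3 \<le> d \<Longrightarrow> d \<le> 5 \<Longrightarrow> card (curve_points F) \<le> 45 * q' + 63"
    "3 \<le> d \<Longrightarrow> d \<le> 7 \<Longrightarrow> card (curve_points F) \<le> 63 * q' + 63"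
    unfolding V(2) by blast+
qed

lemma dot3_commute: "dot3 a b = dot3 b a"
  by (simp add: dot3_def mult.commute)

lemma arc_points_on_line:
  fixes K :: "('a::{field,finite} ^ 3) set set"
  assumes K: "maximal_arc4 K" and w: "w \<noteq> 0"
  shows "card {P \<in> K. \<forall>v\<in>P. dot3 w v = 0} \<le> 4"
proof -
  obtain p u where pu: "cr p u \<noteq> 0" "dot3 w p = 0" "dot3 w u = 0" by (rule ex_plane_basis)
  obtain c where c: "det3 p u c \<noteq> 0" using ex_third[OF pu(1)] .
  have "{P \<in> K. \<forall>v\<in>P. dot3 w v = 0} \<subseteq> {P \<in> K. P \<subseteq> vec.span {p, u}}"
  proof safe
    fix P v assume P: "\<forall>v\<in>P. dot3 w v = 0" "v \<in> P"
    obtain a b e where v: "v = a *s p + b *s u + e *s c" using basis3_expand[OF c] by blast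
    have lin: "dot3 w (a *s p + b *s u + e *s c) = a * dot3 w p + b * dot3 w u + e * dot3 w c" for a b e
      by (simp add: dot3_def algebra_simps)
    have "dot3 w c \<noteq> 0"
    proof
      assume wc: "dot3 w c = 0"
      have "dot3 w x = 0" for x using basis3_expand[OF c, of x] lin pu wc by (metis add_0 mult_zero_right)
      moreover obtain x where "dot3 x w = 1" using ex_linf_nonzero[OF w] .
      ultimately show False by (simp add: dot3_commute[of x])
    qed
    moreover have "dot3 w v = 0" using P by blast
    ultimately have "e = 0" using lin[of a b e] v pu by simp
    then show "v \<in> vec.span {p, u}" unfolding span2 using v by auto
  qed
  then have "card {P \<in> K. \<forall>v\<in>P. dot3 w v = 0} \<le> card {P \<in> K. P \<subseteq> vec.span {p, u}}"
    by (intro card_mono) auto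
  moreover have "card {P \<in> K. P \<subseteq> vec.span {p, u}} \<le> 4"
  proof -
    have "card {P \<in> K. P \<subseteq> vec.span {p, u}} = 0 \<or> card {P \<in> K. P \<subseteq> vec.span {p, u}} = 4"
      using K span2_in_pg_lines[OF pu(1)] unfolding maximal_arc4_def by blast
    then show ?thesis by linarith
  qed
  ultimately show ?thesis by simp
qed

section \<open>Two conics and a cubic do not cover a maximal arc\<close>

lemma lookup_pd:
  "lookup (pd i F) m = of_nat (lookup m i + 1) * lookup F (m + single i 1)"
proof -
  let ?m = "m + single i 1"
  have "lookup (pd i F) m = (\<Sum>m'\<in>keys F.
     if m' = ?m then of_nat (lookup ?m i) * lookup F ?m else 0)"
    unfolding pd_def lookup_sum
  proof (intro sum.cong refl)
    fix m'
    show "lookup (single (m' - single i 1)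
        (of_nat (lookup m' i) * lookup F m')) m =
      (if m' = ?m then of_nat (lookup ?m i) * lookup F ?m else 0)"
    proof (cases "m' = ?m")
      case True
      then show ?thesis by (simp only: add_diff_cancel_right' lookup_single_eq if_True simp_thms)
    next
      case False
      have "lookup m' i = 0 \<or> m' - single i 1 \<noteq> m"
      proof (rule ccontr)
        assume *: "\<not> ?thesis"
        have "m' = ?m"
        proof (rule poly_mapping_eqI)
          fix k
          have "lookup (m' - single i 1) k = lookup m k" using * by simp
          then show "lookup m' k = lookup ?m k"
            unfolding lookup_minus_single lookup_add using * by (cases "i = k") (auto simp: lookup_single)
        qed
        with False show False by simp
      qed
      then show ?thesis using False by (auto simp: lookup_single when_def)
    qed
  qed
  also have "\<dots> = of_nat (lookup ?m i) * lookup F ?m"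
    by (auto simp: in_keys_iff)
  also have "lookup ?m i = lookup m i + 1"
    by (simp add: lookup_add)
  finally show ?thesis .
qed

lemma cf_pd:
  "cf (pd 1 F) a b c = of_nat (a + 1) * cf F (a + 1) b c"
  "cf (pd 2 F) a b c = of_nat (b + 1) * cf F a (b + 1) c"
  "cf (pd 3 F) a b c = of_nat (c + 1) * cf F a b (c + 1)"
proof -
  let ?m = "single 1 a + single 2 b + single (3::3) c"
  have m: "?m + single 1 1 = single 1 (a + 1) + single 2 b + single 3 c"
    "?m + single 2 1 = single 1 a + single 2 (b + 1) + single 3 c"
    "?m + single 3 1 = single 1 a + single 2 b + single 3 (c + 1)"
    by (simp_all only: single_add add_ac)
  have l: "lookup ?m 1 = a" "lookup ?m 2 = b" "lookup ?m 3 = c"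
    by (simp_all add: lookup_add lookup_single)
  show "cf (pd 1 F) a b c = of_nat (a + 1) * cf F (a + 1) b c"
    "cf (pd 2 F) a b c = of_nat (b + 1) * cf F a (b + 1) c"
    "cf (pd 3 F) a b c = of_nat (c + 1) * cf F a b (c + 1)"
    unfolding cf_def lookup_pd m l by (rule refl)+
qed

lemma ev_forms_3:
  assumes "F \<in> forms 3" "ring_hom_fun h"
  shows "ev h v F = h (cf F 3 0 0) * v 1 ^ 3 + h (cf F 0 3 0) * v 2 ^ 3 + h (cf F 0 0 3) * v 3 ^ 3 +
    h (cf F 2 1 0) * (v 1 ^ 2 * v 2) + h (cf F 2 0 1) * (v 1 ^ 2 * v 3) + h (cf F 1 2 0) * (v 1 * v 2 ^ 2) +
    h (cf F 1 1 1) * (v 1 * v 2 * v 3) + h (cf F 1 0 2) * (v 1 * v 3 ^ 2) +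
    h (cf F 0 2 1) * (v 2 ^ 2 * v 3) + h (cf F 0 1 2) * (v 2 * v 3 ^ 2)"
  unfolding ev_forms_expand[OF assms]
  by (simp add: atMost_3 atMost_2 atMost_1[unfolded One_nat_def] add_ac)

definition grad :: "'a::field poly3 \<Rightarrow> 'a ^ 3 \<Rightarrow> 'a ^ 3" where
  "grad F v = (\<chi> i. eval3 (pd i F) v)"

text \<open>For \<open>p\<close> on the cubic and in characteristic 2, the second identity says that
  the derivative in direction \<open>p\<close> is constant along lines through
  \<open>p\<close>.\<close>

lemma cubic_polar:
  assumes E: "E \<in> forms 3"
  shows "eval3 E (u + s *s p) = eval3 E u + s * dot3 p (grad E u) + s\<^sup>2 * dot3 u (grad E p) + s ^ 3 * eval3 E p"
    "dot3 p (grad E (u + s *s p)) = dot3 p (grad E u) + 2 * s * dot3 u (grad E p) + 3 * s\<^sup>2 * eval3 E p"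
proof -
  have pd: "pd i E \<in> forms 2" for i using pd_forms[OF E, of i] by simp
  have g: "grad E v $ i = eval3 (pd i E) v" for v i by (simp add: grad_def)
  note e = eval3_conv_ev ev_forms_2[OF pd ring_hom_fun_id] ev_forms_3[OF E ring_hom_fun_id] cf_pd
  have nums: "(0::nat) + 1 = 1" "(1::nat) + 1 = 2" "(2::nat) + 1 = 3" by simp_all
  show "eval3 E (u + s *s p) = eval3 E u + s * dot3 p (grad E u) + s\<^sup>2 * dot3 u (grad E p) + s ^ 3 * eval3 E p"
    unfolding dot3_def g e nums by (simp add: power2_eq_square power3_eq_cube algebra_simps)
  show "dot3 p (grad E (u + s *s p)) = dot3 p (grad E u) + 2 * s * dot3 u (grad E p) + 3 * s\<^sup>2 * eval3 E p"
    unfolding dot3_def g e nums by (simp add: power2_eq_square power3_eq_cube algebra_simps)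
qed

lemma even_card_conic_line:
  fixes C :: "'a::{field,finite} poly3"
  assumes "(1::'a) + 1 = 0" "C \<in> forms 2" "det3 (nuc C) u p \<noteq> 0" "eval3 C p \<noteq> 0"
  shows "card {s. eval3 C (u + s *s p) = 0} \<in> {0, 2}"
  using card_conic_line(1)[OF assms] by simp

lemma card_Un3: "card (A \<union> B \<union> C) \<le> card A + card B + card C"
  using card_Un_le[of "A \<union> B" C] card_Un_le[of A B] by linarith

lemma card_Un5: "card (A \<union> B \<union> C \<union> D \<union> E) \<le> card A + card B + card C + card D + card E"
  using card_Un_le[of "A \<union> B \<union> C \<union> D" E] card_Un_le[of "A \<union> B \<union> C" D] card_Un3[of A B C] by linarith

text \<open>On a general line through a general point of the arc on the cubic each of the three curves
  has an even number of further points, whereas the arc has three.\<close>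

lemma no_two_conics_and_cubic:
  fixes K :: "('a::{field,finite} ^ 3) set set"
  assumes char: "(1::'a) + 1 = 0" and q: "CARD('a) = 32 * q'" "64 \<le> q'"
    and K: "maximal_arc4 K"
    and C: "C1 \<in> forms 2" "irreducible C1" "C2 \<in> forms 2" "irreducible C2"
    and E: "E \<in> forms 3" "irreducible E"
    and cover: "K \<subseteq> curve_points C1 \<union> curve_points C2 \<union> curve_points E"
  shows False
proof -
  have two: "(2::'a) = 0" using char by simp
  have q2: "CARD('a) > 2" using q by simp
  have cK: "card K = 96 * q' + 4" using K q by (simp add: maximal_arc4_def)
  have Kp: "K \<subseteq> pg_points" using K by (simp add: maximal_arc4_def)
  have c1: "card (curve_points C1) \<le> 32 * q' + 1" and c2: "card (curve_points C2) \<le> 32 * q' + 1"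
    using card_irreducible_conic_le[OF char q2 C(1,2)] card_irreducible_conic_le[OF char q2 C(3,4)] q by simp_all
  have c3: "card (curve_points E) \<le> 45 * q' + 63" using stepanov_curve(1)[OF char q E] by simp
  have ex: "card (exceptional K (curve_points C1) (curve_points C2) (curve_points E)) \<le> 13 * q' + 61"
  proof -
    have "K \<subseteq> curve_points C1 \<union> curve_points C2 \<union> curve_points E \<union> {}" using cover by simp
    from card_exceptional[OF this] show ?thesis using c1 c2 c3 cK by simp
  qed

  \<comment> \<open>The singular rational points. More than 3 * 2 of them would include a smooth one
    by \<open>ex_smooth_point\<close>.\<close>
  define Sing where "Sing = {P \<in> curve_points E. \<forall>v\<in>P. \<forall>i. eval3 (pd i E) v = 0}"
  have sing: "card Sing \<le> 6"
  proof (rule ccontr)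
    assume *: "\<not> card Sing \<le> 6"
    have "Sing \<subseteq> pg_points" using curve_points_subset by (auto simp: Sing_def)
    then obtain V where V: "proj_distinct V" "card V = card Sing" "\<And>v. v \<in> V \<Longrightarrow> pt v \<in> Sing"
      by (rule ex_representatives) blast
    have V0: "eval3 E v = 0" if "v \<in> V" for v using V(3)[OF that] pt_in_curve_points[OF E(1)] by (auto simp: Sing_def)
    have "card V > 3 * (3 - 1)" using * V(2) by simp
    then obtain v i where "v \<in> V" "eval3 (pd i E) v \<noteq> 0" using ex_smooth_point[OF char E V(1) V0] by blast
    then show False using V(3)[of v] mem_pt[of v] unfolding Sing_def by blast
  qed
  have c3': "card (curve_points E) > 6"
  proof -
    have "card K \<le> card (curve_points C1 \<union> curve_points C2 \<union> curve_points E)" using cover by (intro card_mono) auto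
    also have "\<dots> \<le> card (curve_points C1) + card (curve_points C2) + card (curve_points E)"
      by (rule card_Un3)
    finally show ?thesis using cK c1 c2 q(2) by linarith
  qed
  have "\<not> curve_points E \<subseteq> Sing"
  proof
    assume "curve_points E \<subseteq> Sing"
    then have "card (curve_points E) \<le> card Sing" by (intro card_mono) auto
    then show False using sing c3' by simp
  qed
  then obtain u0 i0 where u0: "eval3 (pd i0 E) u0 \<noteq> 0" by (auto simp: Sing_def)
  \<comment> \<open>If \<open>p\<close> satisfies \<open>dot3 p w = 0\<close>, its polar conic
    passes through \<open>u0\<close>. Avoiding these at most four points of the arc ensures that the
    polar conic of \<open>p\<close> is not the zero form.\<close>
  define w where "w = grad E u0"
  have w: "w \<noteq> 0" using u0 by (auto simp: w_def grad_def vec_eq_iff)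
  define Str where "Str = {P \<in> K. \<forall>v\<in>P. dot3 w v = 0}"
  have str: "card Str \<le> 4" unfolding Str_def by (rule arc_points_on_line[OF K w])

  \<comment> \<open>The sets to be avoided have at most 64 q' + 14 points in all, fewer than the
    arc.\<close>
  have "\<not> K \<subseteq> curve_points C1 \<union> curve_points C2 \<union> Sing \<union> Str \<union> {pt (nuc C1), pt (nuc C2)}"
  proof
    assume "K \<subseteq> curve_points C1 \<union> curve_points C2 \<union> Sing \<union> Str \<union> {pt (nuc C1), pt (nuc C2)}"
    then have "card K \<le> card (curve_points C1 \<union> curve_points C2 \<union> Sing \<union> Str \<union> {pt (nuc C1), pt (nuc C2)})"
      by (intro card_mono) auto
    also have "\<dots> \<le> card (curve_points C1) + card (curve_points C2) + card Sing + card Str + card {pt (nuc C1), pt (nuc C2)}"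
      by (rule card_Un5)
    also have "card {pt (nuc C1), pt (nuc C2)} \<le> 2" by (simp add: card_insert_if)
    finally show False using cK c1 c2 sing str q(2) by linarith
  qed
  then obtain P where P: "P \<in> K" "P \<notin> curve_points C1" "P \<notin> curve_points C2" "P \<notin> Sing" "P \<notin> Str"
    "P \<noteq> pt (nuc C1)" "P \<noteq> pt (nuc C2)" by auto
  then have "P \<in> curve_points E" using cover by auto
  then obtain p where p: "p \<noteq> 0" "P = pt p" "eval3 E p = 0" by (rule curve_pointsE)
  have pC: "eval3 C1 p \<noteq> 0" "eval3 C2 p \<noteq> 0"
    using P(2,3) p pt_in_curve_points[OF C(1)] pt_in_curve_points[OF C(3)] by auto
  have scale: "eval3 (pd i E) (c *s p) = c\<^sup>2 * eval3 (pd i E) p" for i c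
    using eval3_scale[of "pd i E" 2] pd_forms[OF E(1), of i] by simp
  have "\<exists>i. eval3 (pd i E) p \<noteq> 0"
    using P(4) \<open>P \<in> curve_points E\<close> scale by (auto simp: Sing_def p(2) pt_eq)
  then have gp: "grad E p \<noteq> 0" by (auto simp: grad_def vec_eq_iff)
  have wp: "dot3 p w \<noteq> 0"
  proof
    assume "dot3 p w = 0"
    moreover have "dot3 w (c *s p) = c * dot3 p w" for c by (simp add: dot3_def algebra_simps)
    ultimately have "dot3 w (c *s p) = 0" for c by simp
    then show False using P(1,5) by (auto simp: Str_def p(2) pt_eq)
  qed
  have nuc: "eval3 C (nuc C) \<noteq> 0" if "C \<in> forms 2" "irreducible C" "card (curve_points C) \<ge> 2" for C :: "'a poly3"
    using irreducible_conic_nuc[OF char q2 that] .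
  have Np: "cr (nuc C) p \<noteq> 0" if "P \<noteq> pt (nuc C)" "nuc C \<noteq> 0" for C
    using that p pt_eqI[of "nuc C" p] by auto
  have "card K \<le> card (curve_points C1) + card (curve_points C2) + card (curve_points E)"
    using card_Un3 card_mono[OF finite cover] le_trans by blast
  then have "card (curve_points C1) \<ge> 2" "card (curve_points C2) \<ge> 2" using cK c1 c2 c3 q(2) by linarith+
  from nuc[OF C(1,2) this(1)] nuc[OF C(3,4) this(2)] have "nuc C1 \<noteq> 0" "nuc C2 \<noteq> 0"
    using eval3_scale[OF C(1), of 0 0] eval3_scale[OF C(3), of 0 0] by auto
  then have N: "cr (nuc C1) p \<noteq> 0" "cr (nuc C2) p \<noteq> 0" using Np P by auto

  obtain y where y: "cr p y \<noteq> 0" using ex_second[OF p(1)] .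
  obtain z where d: "det3 p y z \<noteq> 0" using ex_third[OF y] .
  let ?u = "\<lambda>r. y + r *s z"
  \<comment> \<open>The lines to be avoided: those with exceptional points, those through a nucleus,
    and those on which the coefficient of \<open>s^2\<close> or of \<open>s\<close> in the equation
    of the cubic vanishes. On other lines, since \<open>p\<close> lies on the cubic, the equation is
    quadratic with two nonzero coefficients and has 0 or 2 roots.\<close>
  let ?B0 = "{r. \<exists>s. pt (?u r + s *s p) \<in> exceptional K (curve_points C1) (curve_points C2) (curve_points E)}"
  let ?B1 = "{r. det3 (nuc C1) (?u r) p = 0}"
  let ?B2 = "{r. det3 (nuc C2) (?u r) p = 0}"
  let ?B3 = "{r. dot3 (?u r) (grad E p) = 0}"
  let ?B4 = "{r. dot3 p (grad E (?u r)) = 0}"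
  have euler: "dot3 p (grad E p) = 0"
    using eval3_euler[OF E(1), of p] p(3) by (simp add: dot3_def grad_def)
  have X3: "card ?B3 \<le> 1"
  proof -
    have lin: "dot3 (a *s p + b *s y + c *s z) (grad E p) = b * dot3 y (grad E p) + c * dot3 z (grad E p)" for a b c
    proof -
      have "dot3 (a *s p + b *s y + c *s z) (grad E p) = a * dot3 p (grad E p) + b * dot3 y (grad E p) + c * dot3 z (grad E p)"
        by (simp add: dot3_def algebra_simps)
      then show ?thesis using euler by simp
    qed
    have "dot3 z (grad E p) \<noteq> 0 \<or> dot3 y (grad E p) \<noteq> 0"
    proof (rule ccontr)
      assume *: "\<not> ?thesis"
      obtain x where x: "dot3 x (grad E p) = 1" using ex_linf_nonzero[OF gp] .
      obtain a b c where "x = a *s p + b *s y + c *s z" using basis3_expand[OF d] .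
      then show False using lin[of a b c] x * by simp
    qed
    moreover have "dot3 (?u r) (grad E p) = dot3 y (grad E p) + r * dot3 z (grad E p)" for r
      by (simp add: dot3_def algebra_simps)
    ultimately show ?thesis using card_linear_le_1 by simp
  qed
  have X4: "card ?B4 \<le> 2"
  proof -
    define G where "G = const3 (p $ 1) * pd 1 E + const3 (p $ 2) * pd 2 E + const3 (p $ 3) * pd 3 E"
    have pd2: "pd i E \<in> forms 2" for i using pd_forms[OF E(1), of i] by simp
    have cpd: "const3 (p $ i) * pd i E \<in> forms 2" for i using forms_mult[OF const3_forms pd2, of "p $ i" i] by (simp only: add_0_left)
    have G: "G \<in> forms 2" unfolding G_def by (intro forms_add cpd)
    have eG: "eval3 G v = dot3 p (grad E v)" for v by (simp add: G_def eval3_add eval3_mult dot3_def grad_def)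
    \<comment> \<open>By this invariance the values of the polar conic are determined on the span of
      \<open>y\<close> and \<open>z\<close>. It cannot vanish identically there, because it does not
      vanish at \<open>u0\<close>.\<close>
    have Gp: "eval3 G (v + s *s p) = eval3 G v" for v s
      unfolding eG cubic_polar(2)[OF E(1)] using two p(3) by simp
    have "eval3 G z \<noteq> 0 \<or> det3 (nuc G) y z \<noteq> 0 \<or> eval3 G y \<noteq> 0"
    proof (rule ccontr)
      assume *: "\<not> ?thesis"
      obtain a b c where abc: "u0 = a *s p + b *s y + c *s z" using basis3_expand[OF d] .
      have "u0 = (b *s y + c *s z) + a *s p" unfolding abc by (simp add: algebra_simps)
      then have "eval3 G u0 = eval3 G (b *s y + c *s z)" by (simp only: Gp)
      also have "\<dots> = b\<^sup>2 * eval3 G y + c * det3 (nuc G) (b *s y) z + c\<^sup>2 * eval3 G z"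
        unfolding eval3_conic_polar[OF char G] eval3_scale[OF G] ..
      also have "det3 (nuc G) (b *s y) z = b * det3 (nuc G) y z" by (simp add: det3_eq algebra_simps)
      finally show False using * wp unfolding eG w_def by simp
    qed
    then have "card {r. eval3 G y + r * det3 (nuc G) y z + r\<^sup>2 * eval3 G z = 0} \<le> 2"
      by (intro card_quadratic_le_2[OF char]) auto
    then show ?thesis unfolding eG[symmetric] eval3_conic_polar[OF char G] .
  qed
  have "?B0 \<union> ?B1 \<union> ?B2 \<union> ?B3 \<union> ?B4 \<noteq> UNIV"
  proof
    assume "?B0 \<union> ?B1 \<union> ?B2 \<union> ?B3 \<union> ?B4 = UNIV"
    then have "CARD('a) \<le> card ?B0 + card ?B1 + card ?B2 + card ?B3 + card ?B4"
      using card_Un5[of ?B0 ?B1 ?B2 ?B3 ?B4] by simp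
    moreover have "card ?B0 \<le> 13 * q' + 61" using card_bad_lines[OF d] ex le_trans by blast
    moreover have "card ?B1 \<le> 1" by (rule conic_tangents_le_1[OF d N(1)])
    moreover have "card ?B2 \<le> 1" by (rule conic_tangents_le_1[OF d N(2)])
    ultimately show False using X3 X4 q by linarith
  qed
  then obtain r where r: "r \<notin> ?B0" "r \<notin> ?B1" "r \<notin> ?B2" "r \<notin> ?B3" "r \<notin> ?B4" by blast
  have e1: "card {s. eval3 C1 (?u r + s *s p) = 0} \<in> {0, 2}"
    using r(2) pC by (intro even_card_conic_line[OF char C(1)]) auto
  have e2: "card {s. eval3 C2 (?u r + s *s p) = 0} \<in> {0, 2}"
    using r(3) pC by (intro even_card_conic_line[OF char C(3)]) auto
  have e3: "card {s. eval3 E (?u r + s *s p) = 0} \<in> {0, 2}"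
    using r(4,5) card_quadratic_roots(1)[OF char] by (simp add: cubic_polar(1)[OF E(1)] p(3))
  have "of_bool (pt p \<in> K) + (card {s. eval3 C1 (?u r + s *s p) = 0} + card {s. eval3 C2 (?u r + s *s p) = 0}
     + card {s. eval3 E (?u r + s *s p) = 0}) \<in> {0, 4}"
    using r(1) by (intro pencil_count[OF K d C(1) C(3) E(1)]) simp
  then show False using e1 e2 e3 P(1) p(2) by auto
qed

section \<open>Three conics covering all but a few points of a maximal arc\<close>

text \<open>\<open>M\<close> is meant to be the set of points of the arc on the remaining linear component.\<close>

locale three_conics =
  fixes K :: "('a::{field,finite} ^ 3) set set" and C1 C2 C3 :: "'a poly3" and M :: "('a ^ 3) set set" and q' :: nat
  assumes char: "(1::'a) + 1 = 0" and q: "CARD('a) = 32 * q'" "64 \<le> q'"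
    and K: "maximal_arc4 K"
    and C1: "C1 \<in> forms 2" "irreducible C1"
    and C2: "C2 \<in> forms 2" "irreducible C2"
    and C3: "C3 \<in> forms 2" "irreducible C3"
    and cover: "K \<subseteq> curve_points C1 \<union> curve_points C2 \<union> curve_points C3 \<union> M"
    and M: "M \<subseteq> K" "card M \<le> 4"
begin

lemma card_K: "card K = 96 * q' + 4"
  using K q by (simp add: maximal_arc4_def)

lemma q_gt_2: "CARD('a) > 2"
  using q by simp

lemma conic_upper:
  "card (curve_points C1) \<le> 32 * q' + 1" "card (curve_points C2) \<le> 32 * q' + 1" "card (curve_points C3) \<le> 32 * q' + 1"
  using card_irreducible_conic_le[OF char q_gt_2 C1] card_irreducible_conic_le[OF char q_gt_2 C2]
    card_irreducible_conic_le[OF char q_gt_2 C3] q by simp_all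

lemma conic_lower:
  "card (curve_points C1) \<ge> 2" "card (curve_points C2) \<ge> 2" "card (curve_points C3) \<ge> 2"
proof -
  have "card K \<le> card (curve_points C1 \<union> curve_points C2 \<union> curve_points C3 \<union> M)"
    by (intro card_mono cover) simp
  also have "\<dots> \<le> card (curve_points C1 \<union> curve_points C2 \<union> curve_points C3) + card M" by (rule card_Un_le)
  finally have "96 * q' + 4 \<le> card (curve_points C1) + card (curve_points C2) + card (curve_points C3) + 4"
    using card_Un3[of "curve_points C1" "curve_points C2" "curve_points C3"] M(2) card_K by linarith
  then show "card (curve_points C1) \<ge> 2" "card (curve_points C2) \<ge> 2" "card (curve_points C3) \<ge> 2"
    using conic_upper q(2) by linarith+
qed

lemma nuc_off:
  "eval3 C1 (nuc C1) \<noteq> 0" "eval3 C2 (nuc C2) \<noteq> 0" "eval3 C3 (nuc C3) \<noteq> 0"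
  using irreducible_conic_nuc[OF char q_gt_2] C1 C2 C3 conic_lower by blast+

lemma conic_card:
  "card (curve_points C1) = 32 * q' + 1" "card (curve_points C2) = 32 * q' + 1" "card (curve_points C3) = 32 * q' + 1"
  using card_conic[OF char C1(1) nuc_off(1)] card_conic[OF char C2(1) nuc_off(2)] card_conic[OF char C3(1) nuc_off(3)] q
  by simp_all

lemma nuc_nz: "nuc C1 \<noteq> 0" "nuc C2 \<noteq> 0" "nuc C3 \<noteq> 0"
  using nuc_off eval3_scale[OF C1(1), of 0 0] eval3_scale[OF C2(1), of 0 0] eval3_scale[OF C3(1), of 0 0] by auto

text \<open>The bound is 3 (32 q' + 1) + 2 * 4 - (96 q' + 4) = 7.\<close>

lemma card_ex: "card (exceptional K (curve_points C1) (curve_points C2) (curve_points C3)) \<le> 7"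
  using card_exceptional[OF cover M(1)] M(2) conic_card card_K by simp

text \<open>The Artin-Schreier invariant of the quadratic polynomial that \<open>C\<close> induces
  on the line through \<open>p\<close> and \<open>u\<close>.\<close>

definition quot :: "'a poly3 \<Rightarrow> 'a ^ 3 \<Rightarrow> 'a ^ 3 \<Rightarrow> 'a" where
  "quot C p u = eval3 C p * eval3 C u / (det3 (nuc C) u p)\<^sup>2"

text \<open>At most 7 lines contain exceptional points and at most 3 pass through a nucleus. On any
  other line each conic has 0 or 2 points, and together with the vertex this must make 0 or 4. So
  the vertex is not on the arc, and an even number of the three quotients lies in \<open>AS\<close>;
  as the index is 2, their sum does not.\<close>

lemma pencil:
  assumes d: "det3 p y z \<noteq> 0"
    and Cp: "eval3 C1 p \<noteq> 0" "eval3 C2 p \<noteq> 0" "eval3 C3 p \<noteq> 0"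
    and N: "cr (nuc C1) p \<noteq> 0" "cr (nuc C2) p \<noteq> 0" "cr (nuc C3) p \<noteq> 0"
  shows "card {r. quot C1 p (y + r *s z) + quot C2 p (y + r *s z) + quot C3 p (y + r *s z) \<in> AS} \<le> 10" "pt p \<notin> K"
proof -
  let ?u = "\<lambda>r. y + r *s z"
  let ?B0 = "{r. \<exists>s. pt (?u r + s *s p) \<in> exceptional K (curve_points C1) (curve_points C2) (curve_points C3)}"
  let ?B1 = "{r. det3 (nuc C1) (?u r) p = 0}"
  let ?B2 = "{r. det3 (nuc C2) (?u r) p = 0}"
  let ?B3 = "{r. det3 (nuc C3) (?u r) p = 0}"
  have B0: "card ?B0 \<le> 7" using card_bad_lines[OF d] card_ex le_trans by blast
  have B: "card (?B0 \<union> ?B1 \<union> ?B2 \<union> ?B3) \<le> 10"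
    using card_Un_le[of "?B0 \<union> ?B1 \<union> ?B2" ?B3] card_Un3[of ?B0 ?B1 ?B2] B0
      conic_tangents_le_1[OF d N(1)] conic_tangents_le_1[OF d N(2)] conic_tangents_le_1[OF d N(3)] by linarith
  have good: "pt p \<notin> K \<and> quot C1 p (?u r) + quot C2 p (?u r) + quot C3 p (?u r) \<notin> AS"
    if r: "r \<notin> ?B0 \<union> ?B1 \<union> ?B2 \<union> ?B3" for r
  proof -
    have r0: "r \<notin> ?B0" and r1: "det3 (nuc C1) (?u r) p \<noteq> 0" and r2: "det3 (nuc C2) (?u r) p \<noteq> 0"
      and r3: "det3 (nuc C3) (?u r) p \<noteq> 0" using r by blast+
    have "of_bool (pt p \<in> K) + (card {s. eval3 C1 (?u r + s *s p) = 0} + card {s. eval3 C2 (?u r + s *s p) = 0}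
       + card {s. eval3 C3 (?u r + s *s p) = 0}) \<in> {0, 4}"
      using r0 by (intro pencil_count[OF K d C1(1) C2(1) C3(1)]) simp
    moreover have "card {s. eval3 C1 (?u r + s *s p) = 0} = (if quot C1 p (?u r) \<in> AS then 2 else 0)"
      "card {s. eval3 C2 (?u r + s *s p) = 0} = (if quot C2 p (?u r) \<in> AS then 2 else 0)"
      "card {s. eval3 C3 (?u r + s *s p) = 0} = (if quot C3 p (?u r) \<in> AS then 2 else 0)"
      unfolding quot_def
      using card_conic_line(1)[OF char C1(1) r1 Cp(1)] card_conic_line(1)[OF char C2(1) r2 Cp(2)]
        card_conic_line(1)[OF char C3(1) r3 Cp(3)] by simp_all
    ultimately show ?thesis by (auto simp: AS_add_iff[OF char] of_bool_def split: if_splits)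
  qed
  then have "{r. quot C1 p (?u r) + quot C2 p (?u r) + quot C3 p (?u r) \<in> AS} \<subseteq> ?B0 \<union> ?B1 \<union> ?B2 \<union> ?B3" by blast
  then have "card {r. quot C1 p (?u r) + quot C2 p (?u r) + quot C3 p (?u r) \<in> AS} \<le> card (?B0 \<union> ?B1 \<union> ?B2 \<union> ?B3)"
    by (intro card_mono) simp_all
  then show "card {r. quot C1 p (?u r) + quot C2 p (?u r) + quot C3 p (?u r) \<in> AS} \<le> 10" using B by linarith
  have "?B0 \<union> ?B1 \<union> ?B2 \<union> ?B3 \<noteq> UNIV"
  proof
    assume "?B0 \<union> ?B1 \<union> ?B2 \<union> ?B3 = UNIV"
    then have "CARD('a) \<le> 10" using B by simp
    then show False using q by simp
  qed
  then obtain r where "r \<notin> ?B0 \<union> ?B1 \<union> ?B2 \<union> ?B3" by blast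
  then show "pt p \<notin> K" using good by blast
qed

end

text \<open>Modulo \<open>AS\<close> the square term may be replaced by its root, so the expression
  becomes linear in \<open>r\<close>. With nonzero slope it would lie in \<open>AS\<close> for half
  of all \<open>r\<close>; the slope is zero exactly if \<open>D\<close> is the square of
  \<open>B\<close>.\<close>

lemma AS_quadratic:
  assumes char: "(1::'a::{field,finite}) + 1 = 0" and q: "CARD('a) > 20"
    and card: "card {r::'a. A + r * B + r\<^sup>2 * D \<in> AS} \<le> 10"
  shows "D = B\<^sup>2"
proof -
  obtain e where e: "e\<^sup>2 = D" by (rule char2_sqrt[OF char])
  have iff: "A + r * B + r\<^sup>2 * D \<in> AS \<longleftrightarrow> A + r * (B + e) \<in> AS" for r
  proof -
    have "A + r * B + r\<^sup>2 * D = (r * e)\<^sup>2 + (A + r * B)" by (simp add: power_mult_distrib e)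
    moreover have "A + r * (B + e) = r * e + (A + r * B)" by (simp add: algebra_simps)
    ultimately show ?thesis by (simp only: AS_square_iff[OF char])
  qed
  have "B + e = 0"
  proof (rule ccontr)
    assume nz: "B + e \<noteq> 0"
    have "AS \<subseteq> (\<lambda>r. A + r * (B + e)) ` {r. A + r * (B + e) \<in> AS}"
    proof
      fix t :: 'a assume t: "t \<in> AS"
      define r where "r = (t - A) / (B + e)"
      have r: "t = A + r * (B + e)" using nz by (simp add: r_def)
      with t have "r \<in> {r. A + r * (B + e) \<in> AS}" by simp
      with r show "t \<in> (\<lambda>r. A + r * (B + e)) ` {r. A + r * (B + e) \<in> AS}" by (rule image_eqI)
    qed
    then have "card (AS :: 'a set) \<le> card ((\<lambda>r. A + r * (B + e)) ` {r. A + r * (B + e) \<in> AS})" by (intro card_mono) auto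
    also have "\<dots> \<le> card {r. A + r * (B + e) \<in> AS}" by (rule card_image_le) simp
    also have "\<dots> \<le> 10" using card unfolding iff .
    finally show False using card_AS[OF char] q by simp
  qed
  then have "B = e" using char2_uminus[OF char, of e] by (simp only: eq_neg_iff_add_eq_0[symmetric])
  then show ?thesis using e by simp
qed

text \<open>If \<open>k / r + d r\<close> were constant modulo the additive subgroup \<open>AS\<close>, adding the values at \<open>s\<close>,
  \<open>s v\<close> and \<open>s (v + 1)\<close> would remove the linear part and make a multiple of \<open>1 / s\<close> constant.\<close>

lemma AS_pole:
  assumes char: "(1::'a::{field,finite}) + 1 = 0" and q: "CARD('a) > 100" and \<kappa>: "\<kappa> \<noteq> 0"
    and card: "card {r::'a. r \<noteq> 0 \<and> \<kappa> / r\<^sup>2 + A + r * B + r\<^sup>2 * D \<in> AS} \<le> 10"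
  shows False
proof -
  obtain e where e: "e\<^sup>2 = D" by (rule char2_sqrt[OF char])
  obtain k where k: "k\<^sup>2 = \<kappa>" by (rule char2_sqrt[OF char])
  have knz: "k \<noteq> 0" using k \<kappa> by auto
  define \<delta> where "\<delta> = B + e"
  have two: "(2::'a) = 0" using char by simp
  \<comment> \<open>Both square terms are replaced by their roots, and the double pole becomes a
    simple one.\<close>
  have iff: "\<kappa> / r\<^sup>2 + A + r * B + r\<^sup>2 * D \<in> AS \<longleftrightarrow> A + k / r + \<delta> * r \<in> AS" for r
  proof -
    have "\<kappa> / r\<^sup>2 + A + r * B + r\<^sup>2 * D = (r * e)\<^sup>2 + ((k / r)\<^sup>2 + (A + r * B))" by (simp add: power_mult_distrib power_divide e k)
    moreover have "r * e + ((k / r)\<^sup>2 + (A + r * B)) = (k / r)\<^sup>2 + (r * e + (A + r * B))" by (simp only: add_ac)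
    moreover have "A + k / r + \<delta> * r = k / r + (r * e + (A + r * B))" by (simp add: \<delta>_def algebra_simps)
    ultimately show ?thesis by (simp only: AS_square_iff[OF char])
  qed
  define Bad where "Bad = insert 0 {r. r \<noteq> 0 \<and> A + k / r + \<delta> * r \<in> AS}"
  have Bad: "card Bad \<le> 11"
    using card card_insert_le_m1[of 11 "{r. r \<noteq> 0 \<and> A + k / r + \<delta> * r \<in> AS}" 0] unfolding iff Bad_def by simp
  have good: "r \<noteq> 0" "A + k / r + \<delta> * r \<notin> AS" if "r \<notin> Bad" for r using that by (auto simp: Bad_def)
  \<comment> \<open>Besides 0 and 1, the roots of \<open>1 + v + v^2\<close> are avoided, since they
    would make the coefficient of \<open>1 / s\<close> vanish.\<close>
  have "{v::'a. 0 + v * 1 + v\<^sup>2 * 1 = 0} \<union> {v. 1 + v * 1 + v\<^sup>2 * 1 = 0} \<noteq> UNIV"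
  proof
    assume *: "{v::'a. 0 + v * 1 + v\<^sup>2 * 1 = 0} \<union> {v. 1 + v * 1 + v\<^sup>2 * 1 = 0} = UNIV"
    have "card ({v::'a. 0 + v * 1 + v\<^sup>2 * 1 = 0} \<union> {v. 1 + v * 1 + v\<^sup>2 * 1 = 0}) \<le>
      card {v::'a. 0 + v * 1 + v\<^sup>2 * 1 = 0} + card {v::'a. 1 + v * 1 + v\<^sup>2 * 1 = 0}" by (rule card_Un_le)
    also have "\<dots> \<le> 2 + 2" by (intro add_mono card_quadratic_le_2[OF char]) auto
    finally show False unfolding * using q by simp
  qed
  then obtain v :: 'a where v: "v + v\<^sup>2 \<noteq> 0" "1 + v + v\<^sup>2 \<noteq> 0" by auto
  have v0: "v \<noteq> 0" "v + 1 \<noteq> 0"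
  proof -
    have "v + v\<^sup>2 = v * (v + 1)" by (simp add: power2_eq_square algebra_simps)
    then show "v \<noteq> 0" "v + 1 \<noteq> 0" using v(1) by auto
  qed
  define w where "w = k * ((1 + v + v\<^sup>2) / (v + v\<^sup>2))"
  have w: "w \<noteq> 0" using knz v by (simp add: w_def)
  define S where "S = UNIV - (Bad \<union> (\<lambda>s. s / v) ` Bad \<union> (\<lambda>s. s / (v + 1)) ` Bad)"
  have S: "A + w / s \<notin> AS" "s \<noteq> 0" if s: "s \<in> S" for s
  proof -
    have "s \<notin> Bad" using s by (simp add: S_def)
    moreover have "s * v \<notin> Bad"
    proof
      assume "s * v \<in> Bad"
      then have "s * v / v \<in> (\<lambda>s. s / v) ` Bad" by (rule imageI)
      then show False using s v0 by (simp add: S_def)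
    qed
    moreover have "s * (v + 1) \<notin> Bad"
    proof
      assume "s * (v + 1) \<in> Bad"
      then have "s * (v + 1) / (v + 1) \<in> (\<lambda>s. s / (v + 1)) ` Bad" by (rule imageI)
      then show False using s v0 by (simp add: S_def)
    qed
    ultimately have *: "s \<noteq> 0" "A + k / s + \<delta> * s \<notin> AS" "A + k / (s * v) + \<delta> * (s * v) \<notin> AS"
      "A + k / (s * (v + 1)) + \<delta> * (s * (v + 1)) \<notin> AS" using good by blast+
    \<comment> \<open>The arguments \<open>s\<close>, \<open>s * v\<close> and
      \<open>s * (v + 1)\<close> add up to 0, which removes the linear part, whereas
      \<open>A\<close> occurs three times and survives. A sum of three elements outside
      \<open>AS\<close> is again outside \<open>AS\<close>.\<close>
    have "A + k / s + \<delta> * s + (A + k / (s * v) + \<delta> * (s * v)) + (A + k / (s * (v + 1)) + \<delta> * (s * (v + 1)))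
       = A + k / s * (1 + 1 / v + 1 / (v + 1)) + 2 * (A + \<delta> * s + \<delta> * s * v)"
      using v0 \<open>s \<noteq> 0\<close> by (simp add: algebra_simps)
    also have "\<dots> = A + k / s * (1 + 1 / v + 1 / (v + 1))" using two by simp
    also have "1 + 1 / v + 1 / (v + 1) = (1 + v + v\<^sup>2 + 2 * v) / (v + v\<^sup>2)"
    proof -
      have "v + v\<^sup>2 = v * (v + 1)" by (simp add: power2_eq_square algebra_simps)
      then show ?thesis using v0 by (simp add: power2_eq_square field_simps)
    qed
    also have "\<dots> = (1 + v + v\<^sup>2) / (v + v\<^sup>2)" using two by simp
    finally have eq: "A + k / s + \<delta> * s + (A + k / (s * v) + \<delta> * (s * v)) + (A + k / (s * (v + 1)) + \<delta> * (s * (v + 1)))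
      = A + w / s" by (simp add: w_def)
    show "A + w / s \<notin> AS" unfolding eq[symmetric] using *(2-4) AS_add_iff[OF char] by blast
    show "s \<noteq> 0" by fact
  qed
  \<comment> \<open>An injection of \<open>S\<close> into the complement of \<open>AS\<close> is
    impossible: \<open>S\<close> omits at most 33 elements, the complement of \<open>AS\<close>
    omits half of the field.\<close>
  have inj: "inj_on (\<lambda>s. A + w / s) S" using S(2) w by (intro inj_onI) (simp add: field_simps)
  have "card S \<le> card (- (AS :: 'a set))"
    by (rule card_inj_on_le[OF inj]) (use S(1) in auto)
  moreover have "card (- (AS :: 'a set)) = CARD('a) - card (AS :: 'a set)" by (simp add: Compl_eq_Diff_UNIV card_Diff_subset)
  moreover have "card S \<ge> CARD('a) - 33"
  proof -
    have "card (Bad \<union> (\<lambda>s. s / v) ` Bad \<union> (\<lambda>s. s / (v + 1)) ` Bad) \<le> card Bad + card ((\<lambda>s. s / v) ` Bad) + card ((\<lambda>s. s / (v + 1)) ` Bad)"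
      by (rule card_Un3)
    also have "\<dots> \<le> 11 + 11 + 11"
      using Bad card_image_le[of Bad "\<lambda>s. s / v"] card_image_le[of Bad "\<lambda>s. s / (v + 1)"] by (intro add_mono) auto
    finally show ?thesis unfolding S_def by (simp add: card_Diff_subset)
  qed
  ultimately show False using card_AS[OF char] q by linarith
qed

lemma det3_eq_dot_cr: "det3 n u p = - dot3 u (cr n p)"
  by (simp add: det3_eq dot3_def algebra_simps)

lemma det3_add_scale:
  "det3 n (u + r *s w) p = det3 n u p + r * det3 n w p"
  "det3 n u (p + x *s w) = det3 n u p + x * det3 n u w"
  by (simp_all add: det3_eq algebra_simps)

section \<open>The position of the three nuclei\<close>

context three_conics
begin

text \<open>The vertex \<open>p\<close> is put on the line joining the second and third nuclei. That
  line is not among those with parameter \<open>r\<close>, so the second and third quotients are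
  polynomials in \<open>r\<close>, while the first has a double pole at \<open>r = 0\<close>, the
  line through the first nucleus. \<open>AS_pole\<close> excludes this.\<close>

lemma nuclei_noncollinear:
  assumes det: "det3 (nuc C1) (nuc C2) (nuc C3) \<noteq> 0"
  shows False
proof -
  let ?N1 = "nuc C1" and ?N2 = "nuc C2" and ?N3 = "nuc C3"
  have perm: "det3 ?N2 ?N1 ?N3 \<noteq> 0" "det3 ?N3 ?N1 ?N2 \<noteq> 0" "det3 ?N1 ?N3 ?N2 \<noteq> 0"
    using det by (simp_all add: det3_eq algebra_simps)
  let ?p = "\<lambda>x. ?N2 + x *s ?N3"
  have "\<exists>x. x \<noteq> 0 \<and> eval3 C1 (?p x) \<noteq> 0 \<and> eval3 C2 (?p x) \<noteq> 0 \<and> eval3 C3 (?p x) \<noteq> 0"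
  proof (rule ccontr)
    assume "\<not> ?thesis"
    then have "UNIV \<subseteq> {0} \<union> {x. eval3 C1 (?p x) = 0} \<union> {x. eval3 C2 (?p x) = 0} \<union> {x. eval3 C3 (?p x) = 0}" by blast
    then have "CARD('a) \<le> card ({0} \<union> {x. eval3 C1 (?p x) = 0} \<union> {x. eval3 C2 (?p x) = 0} \<union> {x. eval3 C3 (?p x) = 0})"
      by (intro card_mono) auto
    also have "\<dots> \<le> card ({0} \<union> {x. eval3 C1 (?p x) = 0} \<union> {x. eval3 C2 (?p x) = 0}) + card {x. eval3 C3 (?p x) = 0}"
      by (rule card_Un_le)
    also have "\<dots> \<le> (card {0::'a} + card {x. eval3 C1 (?p x) = 0} + card {x. eval3 C2 (?p x) = 0}) + card {x. eval3 C3 (?p x) = 0}"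
      by (intro add_mono card_Un3 order_refl)
    also have "\<dots> \<le> (1 + 2 + 2) + 2"
      unfolding eval3_conic_polar[OF char C1(1)] eval3_conic_polar[OF char C2(1)] eval3_conic_polar[OF char C3(1)]
      using det nuc_off by (intro add_mono card_quadratic_le_2[OF char]) auto
    finally show False using q by simp
  qed
  then obtain x where x: "x \<noteq> 0" "eval3 C1 (?p x) \<noteq> 0" "eval3 C2 (?p x) \<noteq> 0" "eval3 C3 (?p x) \<noteq> 0" by blast
  define p where "p = ?p x"
  have d: "det3 p ?N1 ?N3 \<noteq> 0" using perm(1) by (simp add: p_def det3_eq algebra_simps)
  have d1: "det3 ?N1 (?N1 + r *s ?N3) p = r * det3 ?N1 ?N3 ?N2" for r
    by (simp add: p_def det3_add_scale)
  have d2: "det3 ?N2 (?N1 + r *s ?N3) p = x * det3 ?N2 ?N1 ?N3" for r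
    by (simp add: p_def det3_add_scale)
  have d3: "det3 ?N3 (?N1 + r *s ?N3) p = det3 ?N3 ?N1 ?N2" for r
    by (simp add: p_def det3_add_scale)
  have N: "cr ?N1 p \<noteq> 0" "cr ?N2 p \<noteq> 0" "cr ?N3 p \<noteq> 0"
    using d1[of 1] d2[of 1] d3[of 1] perm x(1) unfolding det3_eq_dot_cr by auto
  define \<kappa> where "\<kappa> = eval3 C1 p * eval3 C1 ?N1 / (det3 ?N1 ?N3 ?N2)\<^sup>2"
  have \<kappa>: "\<kappa> \<noteq> 0" using x(2) nuc_off(1) perm(3) by (simp add: \<kappa>_def p_def)
  define e1 e2 e3 where "e1 = eval3 C1 p / (det3 ?N1 ?N3 ?N2)\<^sup>2" "e2 = eval3 C2 p / (x * det3 ?N2 ?N1 ?N3)\<^sup>2"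
    "e3 = eval3 C3 p / (det3 ?N3 ?N1 ?N2)\<^sup>2"
  define A B D where "A = e1 * eval3 C1 ?N3 + e2 * eval3 C2 ?N1 + e3 * eval3 C3 ?N1"
    "B = e2 * det3 ?N2 ?N1 ?N3" "D = e2 * eval3 C2 ?N3 + e3 * eval3 C3 ?N3"
  have G: "quot C1 p (?N1 + r *s ?N3) + quot C2 p (?N1 + r *s ?N3) + quot C3 p (?N1 + r *s ?N3) = \<kappa> / r\<^sup>2 + A + r * B + r\<^sup>2 * D"
    if r: "r \<noteq> 0" for r
  proof -
    have "quot C1 p (?N1 + r *s ?N3) = \<kappa> / r\<^sup>2 + e1 * eval3 C1 ?N3"
      unfolding quot_def d1 eval3_conic_polar[OF char C1(1)] \<kappa>_def e1_e2_e3_def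
      using r perm(3) by (simp add: field_simps)
    moreover have "quot C2 p (?N1 + r *s ?N3) = e2 * eval3 C2 ?N1 + r * (e2 * det3 ?N2 ?N1 ?N3) + r\<^sup>2 * (e2 * eval3 C2 ?N3)"
      unfolding quot_def d2 eval3_conic_polar[OF char C2(1)] e1_e2_e3_def by (simp add: field_simps add_divide_distrib)
    moreover have "quot C3 p (?N1 + r *s ?N3) = e3 * eval3 C3 ?N1 + r\<^sup>2 * (e3 * eval3 C3 ?N3)"
      unfolding quot_def d3 eval3_conic_polar[OF char C3(1)] e1_e2_e3_def by (simp add: field_simps add_divide_distrib)
    ultimately show ?thesis unfolding A_B_D_def by (simp add: algebra_simps)
  qed
  have "card {r. r \<noteq> 0 \<and> \<kappa> / r\<^sup>2 + A + r * B + r\<^sup>2 * D \<in> AS} \<le>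
    card {r. quot C1 p (?N1 + r *s ?N3) + quot C2 p (?N1 + r *s ?N3) + quot C3 p (?N1 + r *s ?N3) \<in> AS}"
    using G by (intro card_mono) auto
  also have "\<dots> \<le> 10" using x(2-4) N by (intro pencil(1)[OF d]) (simp_all add: p_def)
  finally show False using AS_pole[OF char _ \<kappa>] q by simp
qed

text \<open>For a vertex on the common line all three denominators are free of \<open>r\<close>, and
  \<open>AS_quadratic\<close> yields \<open>D = B^2\<close>. As the vertex \<open>N1 + x N2\<close>
  moves, this becomes a polynomial equation in \<open>x\<close> valid for almost all
  \<open>x\<close>. It fails at \<open>x = 0\<close>, where the vertex tends to the first nucleus
  and the pole of its term in \<open>D\<close> has nothing to cancel with.\<close>

lemma nuclei_collinear:
  assumes det: "det3 (nuc C1) (nuc C2) (nuc C3) = 0" and ne: "cr (nuc C1) (nuc C2) \<noteq> 0" "cr (nuc C1) (nuc C3) \<noteq> 0"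
  shows False
proof -
  let ?N1 = "nuc C1" and ?N2 = "nuc C2" and ?N3 = "nuc C3"
  have det': "det3 ?N3 ?N1 ?N2 = 0" using det by (simp add: det3_eq algebra_simps)
  obtain u where u: "det3 ?N1 ?N2 u \<noteq> 0" using ex_third[OF ne(1)] .
  obtain a b c where abc: "?N3 = a *s ?N1 + b *s ?N2 + c *s u" using basis3_expand[OF u] .
  have "det3 ?N1 ?N2 ?N3 = c * det3 ?N1 ?N2 u" unfolding abc by (simp add: det3_eq algebra_simps)
  then have "c = 0" using det u by simp
  then have N3: "?N3 = a *s ?N1 + b *s ?N2" using abc by simp
  have "cr ?N1 ?N3 = b *s cr ?N1 ?N2" unfolding N3 by (simp add: vec3_eq_iff algebra_simps)
  then have b: "b \<noteq> 0" using ne(2) by auto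
  \<comment> \<open>For the vertex with parameter \<open>x\<close> the determinants in the
    denominators of the three quotients are \<open>x * k\<close>, \<open>b2\<close> and
    \<open>b3 + x * e3\<close>.\<close>
  define k b2 b3 e3 where "k = det3 ?N1 u ?N2" "b2 = det3 ?N2 u ?N1" "b3 = det3 ?N3 u ?N1" "e3 = det3 ?N3 u ?N2"
  note defs = this
  have k: "k \<noteq> 0" and b2: "b2 \<noteq> 0" using u by (simp_all add: defs det3_eq algebra_simps)
  have "b3 = b * b2" unfolding defs by (subst N3) (simp add: det3_eq algebra_simps)
  then have b3: "b3 \<noteq> 0" using b b2 by simp
  let ?p = "\<lambda>x. ?N1 + x *s ?N2"
  have d: "det3 (?p x) u ?N1 = x * b2" for x unfolding defs by (simp add: det3_eq algebra_simps)
  have d1: "det3 ?N1 (u + r *s ?N1) (?p x) = x * k" for r x unfolding defs det3_add_scale by simp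
  have d2: "det3 ?N2 (u + r *s ?N1) (?p x) = b2" for r x unfolding defs det3_add_scale by simp
  have d3: "det3 ?N3 (u + r *s ?N1) (?p x) = b3 + x * e3" for r x unfolding defs det3_add_scale by (simp add: det')
  have c: "eval3 C1 (?p x) = eval3 C1 ?N1 + x\<^sup>2 * eval3 C1 ?N2" "eval3 C2 (?p x) = eval3 C2 ?N1 + x\<^sup>2 * eval3 C2 ?N2"
    "eval3 C3 (?p x) = eval3 C3 ?N1 + x\<^sup>2 * eval3 C3 ?N2" for x
    unfolding eval3_conic_polar[OF char C1(1)] eval3_conic_polar[OF char C2(1)] eval3_conic_polar[OF char C3(1)]
    by (simp_all add: det')
  \<comment> \<open>The third conic does not contain the common line, because its own nucleus lies
    on that line but not on the conic. Hence it excludes at most two values of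
    \<open>x\<close>.\<close>
  have c3: "eval3 C3 ?N1 \<noteq> 0 \<or> eval3 C3 ?N2 \<noteq> 0"
  proof (rule ccontr)
    assume *: "\<not> ?thesis"
    have "det3 ?N3 (a *s ?N1) ?N2 = a * det3 ?N3 ?N1 ?N2" by (simp add: det3_eq algebra_simps)
    then have "eval3 C3 (a *s ?N1 + b *s ?N2) = 0"
      unfolding eval3_conic_polar[OF char C3(1)] eval3_scale[OF C3(1)] using * det' by simp
    then show False using nuc_off(3) N3 by simp
  qed
  \<comment> \<open>This is \<open>D = B^2\<close> multiplied by the square of
    \<open>x * k * b2 * (b3 + x * e3)^2\<close>, which clears all denominators.\<close>
  have key: "eval3 C1 (?p x) * eval3 C1 ?N1 * b2\<^sup>2 * (b3 + x * e3) ^ 4 + x\<^sup>2 * k\<^sup>2 *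
      (eval3 C2 (?p x) * eval3 C2 ?N1 * (b3 + x * e3) ^ 4 + eval3 C3 (?p x) * eval3 C3 ?N1 * b2\<^sup>2 * (b3 + x * e3)\<^sup>2
       - (eval3 C2 (?p x) * (b3 + x * e3)\<^sup>2 + eval3 C3 (?p x) * b3 * b2)\<^sup>2) = 0"
    if x: "x \<noteq> 0" "b3 + x * e3 \<noteq> 0" "eval3 C1 (?p x) \<noteq> 0" "eval3 C2 (?p x) \<noteq> 0" "eval3 C3 (?p x) \<noteq> 0" for x
  proof -
    define p where "p = ?p x"
    define \<beta> where "\<beta> = b3 + x * e3"
    have \<beta>: "\<beta> \<noteq> 0" using x(2) by (simp add: \<beta>_def)
    have dp: "det3 p u ?N1 \<noteq> 0" using d[of x] x(1) b2 by (simp add: p_def)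
    have N: "cr ?N1 p \<noteq> 0" "cr ?N2 p \<noteq> 0" "cr ?N3 p \<noteq> 0"
      using d1[of 0 x] d2[of 0 x] d3[of 0 x] x k b2 unfolding det3_eq_dot_cr p_def by auto
    define A B D where "A = eval3 C1 p * eval3 C1 u / (x * k)\<^sup>2 + eval3 C2 p * eval3 C2 u / b2\<^sup>2 + eval3 C3 p * eval3 C3 u / \<beta>\<^sup>2"
      "B = eval3 C2 p * b2 / b2\<^sup>2 + eval3 C3 p * b3 / \<beta>\<^sup>2"
      "D = eval3 C1 p * eval3 C1 ?N1 / (x * k)\<^sup>2 + eval3 C2 p * eval3 C2 ?N1 / b2\<^sup>2 + eval3 C3 p * eval3 C3 ?N1 / \<beta>\<^sup>2"
    have G: "quot C1 p (u + r *s ?N1) + quot C2 p (u + r *s ?N1) + quot C3 p (u + r *s ?N1) = A + r * B + r\<^sup>2 * D" for r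
    proof -
      have "quot C1 p (u + r *s ?N1) = eval3 C1 p * (eval3 C1 u + r\<^sup>2 * eval3 C1 ?N1) / (x * k)\<^sup>2"
        unfolding quot_def p_def d1 by (subst (2) eval3_conic_polar[OF char C1(1)]) simp
      moreover have "quot C2 p (u + r *s ?N1) = eval3 C2 p * (eval3 C2 u + r * b2 + r\<^sup>2 * eval3 C2 ?N1) / b2\<^sup>2"
        unfolding quot_def p_def d2 by (subst (2) eval3_conic_polar[OF char C2(1)]) (simp add: defs)
      moreover have "quot C3 p (u + r *s ?N1) = eval3 C3 p * (eval3 C3 u + r * b3 + r\<^sup>2 * eval3 C3 ?N1) / \<beta>\<^sup>2"
        unfolding quot_def p_def d3 \<beta>_def by (subst (2) eval3_conic_polar[OF char C3(1)]) (simp add: defs)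
      ultimately show ?thesis unfolding A_B_D_def by (simp add: add_divide_distrib distrib_left distrib_right mult_ac add_ac)
    qed
    have "card {r. A + r * B + r\<^sup>2 * D \<in> AS} \<le> 10"
      using pencil(1)[OF dp _ _ _ N] x(3-5) unfolding G by (simp add: p_def)
    then have "D = B\<^sup>2" using q by (intro AS_quadratic[OF char]) simp_all
    then have "x\<^sup>2 * k\<^sup>2 * b2\<^sup>2 * \<beta> ^ 4 * D = x\<^sup>2 * k\<^sup>2 * b2\<^sup>2 * \<beta> ^ 4 * B\<^sup>2" by simp
    moreover have "x\<^sup>2 * k\<^sup>2 * b2\<^sup>2 * \<beta> ^ 4 * D = eval3 C1 p * eval3 C1 ?N1 * b2\<^sup>2 * \<beta> ^ 4 + x\<^sup>2 * k\<^sup>2 *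
      (eval3 C2 p * eval3 C2 ?N1 * \<beta> ^ 4 + eval3 C3 p * eval3 C3 ?N1 * b2\<^sup>2 * \<beta>\<^sup>2)"
      unfolding A_B_D_def using x(1) k b2 \<beta> by (simp add: field_simps power2_eq_square power4_eq_xxxx)
    moreover have "x\<^sup>2 * k\<^sup>2 * b2\<^sup>2 * \<beta> ^ 4 * B\<^sup>2 = x\<^sup>2 * k\<^sup>2 * (eval3 C2 p * \<beta>\<^sup>2 + eval3 C3 p * b3 * b2)\<^sup>2"
    proof -
      have "b2 * \<beta>\<^sup>2 * B = eval3 C2 p * \<beta>\<^sup>2 + eval3 C3 p * b3 * b2"
        unfolding A_B_D_def using b2 \<beta> by (simp add: field_simps power2_eq_square)
      moreover have "x\<^sup>2 * k\<^sup>2 * b2\<^sup>2 * \<beta> ^ 4 * B\<^sup>2 = x\<^sup>2 * k\<^sup>2 * (b2 * \<beta>\<^sup>2 * B)\<^sup>2"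
        by (simp add: power_mult_distrib mult_ac flip: power_mult)
      ultimately show ?thesis by simp
    qed
    ultimately have "eval3 C1 p * eval3 C1 ?N1 * b2\<^sup>2 * \<beta> ^ 4 + x\<^sup>2 * k\<^sup>2 *
      (eval3 C2 p * eval3 C2 ?N1 * \<beta> ^ 4 + eval3 C3 p * eval3 C3 ?N1 * b2\<^sup>2 * \<beta>\<^sup>2)
      = x\<^sup>2 * k\<^sup>2 * (eval3 C2 p * \<beta>\<^sup>2 + eval3 C3 p * b3 * b2)\<^sup>2" by (simp only:)
    then show ?thesis
      unfolding p_def[symmetric] \<beta>_def[symmetric] by (simp only: right_diff_distrib add_diff_eq diff_self)
  qed
  define P where "P C = [:eval3 C ?N1, 0, eval3 C ?N2:]" for C
  define Bt where "Bt = [:b3, e3:]"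
  define \<Phi> where "\<Phi> = [:eval3 C1 ?N1 * b2\<^sup>2:] * (P C1 * Bt ^ 4) + [:0, 0, k\<^sup>2:] *
    ([:eval3 C2 ?N1:] * (P C2 * Bt ^ 4) + [:eval3 C3 ?N1 * b2\<^sup>2:] * (P C3 * Bt\<^sup>2) -
      (P C2 * Bt\<^sup>2 + [:b3 * b2:] * P C3)\<^sup>2)"
  have poly_\<Phi>: "poly \<Phi> x = eval3 C1 (?p x) * eval3 C1 ?N1 * b2\<^sup>2 * (b3 + x * e3) ^ 4 + x\<^sup>2 * k\<^sup>2 *
      (eval3 C2 (?p x) * eval3 C2 ?N1 * (b3 + x * e3) ^ 4 + eval3 C3 (?p x) * eval3 C3 ?N1 * b2\<^sup>2 * (b3 + x * e3)\<^sup>2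
       - (eval3 C2 (?p x) * (b3 + x * e3)\<^sup>2 + eval3 C3 (?p x) * b3 * b2)\<^sup>2)" for x
  proof -
    have PC: "poly (P C1) x = eval3 C1 (?p x)" "poly (P C2) x = eval3 C2 (?p x)" "poly (P C3) x = eval3 C3 (?p x)"
      unfolding c P_def by (simp_all add: power2_eq_square algebra_simps)
    have "poly [:0, 0, k\<^sup>2:] x = x\<^sup>2 * k\<^sup>2" by (simp add: power2_eq_square algebra_simps)
    moreover have "poly Bt x = b3 + x * e3" by (simp add: Bt_def)
    ultimately show ?thesis
      unfolding \<Phi>_def poly_add poly_mult poly_diff poly_power PC by (simp add: mult_ac power2_eq_square)
  qed
  \<comment> \<open>All summands except that of the first conic carry the factor \<open>x^2\<close>.
    The remaining value is nonzero because the first conic misses its nucleus and the second and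
    third nuclei differ from the first.\<close>
  have "poly \<Phi> 0 = (eval3 C1 ?N1)\<^sup>2 * b2\<^sup>2 * b3 ^ 4" unfolding poly_\<Phi> by (simp add: power2_eq_square)
  then have \<Phi>: "\<Phi> \<noteq> 0" using nuc_off(1) b2 b3 by auto
  have deg: "degree \<Phi> \<le> 10"
  proof -
    have dm: "degree (f * g) \<le> m + n" if "degree f \<le> m" "degree g \<le> n" for f g :: "'a poly" and m n
      using degree_mult_le[of f g] that by linarith
    have dP: "degree (P C) \<le> 2" for C by (simp add: P_def)
    have "degree Bt \<le> 1" by (simp add: Bt_def)
    then have dB: "degree (Bt ^ n) \<le> n" for n
      using degree_power_le[of Bt n] mult_le_mono1[of "degree Bt" 1 n] by linarith
    have dc: "degree [:t :: 'a:] \<le> 0" for t by simp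
    have f1: "degree ([:eval3 C1 ?N1 * b2\<^sup>2:] * (P C1 * Bt ^ 4)) \<le> 0 + (2 + 4)" by (intro dm dc dP dB)
    have f2: "degree ([:eval3 C2 ?N1:] * (P C2 * Bt ^ 4)) \<le> 0 + (2 + 4)" by (intro dm dc dP dB)
    have f3: "degree ([:eval3 C3 ?N1 * b2\<^sup>2:] * (P C3 * Bt\<^sup>2)) \<le> 0 + (2 + 2)" by (intro dm dc dP dB)
    have f4: "degree (P C2 * Bt\<^sup>2) \<le> 2 + 2" by (intro dm dP dB)
    have f5: "degree ([:b3 * b2:] * P C3) \<le> 0 + 2" by (intro dm dc dP)
    have f6: "degree (P C2 * Bt\<^sup>2 + [:b3 * b2:] * P C3) \<le> 4" using f4 f5 by (intro degree_add_le) simp_all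
    have f7: "degree ((P C2 * Bt\<^sup>2 + [:b3 * b2:] * P C3)\<^sup>2) \<le> 4 + 4"
      unfolding power2_eq_square[of "P C2 * Bt\<^sup>2 + [:b3 * b2:] * P C3"] by (intro dm f6)
    have f8: "degree ([:eval3 C2 ?N1:] * (P C2 * Bt ^ 4) + [:eval3 C3 ?N1 * b2\<^sup>2:] * (P C3 * Bt\<^sup>2) -
      (P C2 * Bt\<^sup>2 + [:b3 * b2:] * P C3)\<^sup>2) \<le> 8"
      using f2 f3 f7 by (intro degree_diff_le degree_add_le) simp_all
    have f9: "degree [:0, 0, k\<^sup>2:] \<le> 2" by simp
    have "degree ([:0, 0, k\<^sup>2:] * ([:eval3 C2 ?N1:] * (P C2 * Bt ^ 4) + [:eval3 C3 ?N1 * b2\<^sup>2:] * (P C3 * Bt\<^sup>2) -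
      (P C2 * Bt\<^sup>2 + [:b3 * b2:] * P C3)\<^sup>2)) \<le> 2 + 8" by (intro dm f8 f9)
    then show ?thesis unfolding \<Phi>_def using f1 by (intro degree_add_le) simp_all
  qed
  let ?Z1 = "{x. eval3 C1 (?p x) = 0}" and ?Z2 = "{x. eval3 C2 (?p x) = 0}" and ?Z3 = "{x. eval3 C3 (?p x) = 0}"
  have "UNIV \<subseteq> {x. poly \<Phi> x = 0} \<union> ({0} \<union> {x. b3 + x * e3 = 0} \<union> ?Z1 \<union> ?Z2 \<union> ?Z3)"
    using key unfolding poly_\<Phi> by blast
  then have "CARD('a) \<le> card ({x. poly \<Phi> x = 0} \<union> ({0} \<union> {x. b3 + x * e3 = 0} \<union> ?Z1 \<union> ?Z2 \<union> ?Z3))"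
    by (intro card_mono) auto
  also have "\<dots> \<le> card {x. poly \<Phi> x = 0} + card ({0} \<union> {x. b3 + x * e3 = 0} \<union> ?Z1 \<union> ?Z2 \<union> ?Z3)" by (rule card_Un_le)
  also have "\<dots> \<le> 10 + (card {0::'a} + card {x. b3 + x * e3 = 0} + card ?Z1 + card ?Z2 + card ?Z3)"
    using card_poly_roots_bound[OF \<Phi>] deg by (intro add_mono card_Un5) simp_all
  also have "\<dots> \<le> 10 + (1 + 1 + 2 + 2 + 2)"
    unfolding eval3_conic_polar[OF char C1(1)] eval3_conic_polar[OF char C2(1)] eval3_conic_polar[OF char C3(1)]
    using b3 nuc_off c3 by (intro add_mono order_refl card_linear_le_1 card_quadratic_le_2[OF char]) auto
  finally show False using q by simp
qed

lemma nucleus_not_isolated: "cr (nuc C1) (nuc C2) = 0 \<or> cr (nuc C1) (nuc C3) = 0"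
  using nuclei_collinear nuclei_noncollinear by blast

text \<open>By \<open>pencil\<close> a point of the arc on none of the conics can only be the common
  nucleus. The conics together have at most 96 q' + 3 points, one fewer than the arc. So the nucleus
  belongs to the arc, hence to \<open>M\<close>, and the bound is attained, which forces the conics
  to be disjoint.\<close>

lemma common_nucleus_conclusion:
  assumes eq: "pt (nuc C2) = pt (nuc C1)" "pt (nuc C3) = pt (nuc C1)"
  shows "pt (nuc C1) \<in> M" "curve_points C1 \<inter> curve_points C2 = {}" "curve_points C1 \<inter> curve_points C3 = {}"
    "curve_points C2 \<inter> curve_points C3 = {}"
proof -
  let ?A = "curve_points C1" and ?B = "curve_points C2" and ?D = "curve_points C3"
  have sub: "K - (?A \<union> ?B \<union> ?D) \<subseteq> {pt (nuc C1)}"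
  proof (rule ccontr)
    assume "\<not> ?thesis"
    then obtain P where P: "P \<in> K" "P \<notin> ?A" "P \<notin> ?B" "P \<notin> ?D" "P \<noteq> pt (nuc C1)" by blast
    have "P \<in> pg_points" using P(1) K by (auto simp: maximal_arc4_def)
    then obtain p where p: "p \<noteq> 0" "P = pt p" by (rule pg_pointsE)
    have Cp: "eval3 C1 p \<noteq> 0" "eval3 C2 p \<noteq> 0" "eval3 C3 p \<noteq> 0"
      using P(2-4) p pt_in_curve_points[OF C1(1)] pt_in_curve_points[OF C2(1)] pt_in_curve_points[OF C3(1)] by auto
    have N: "cr (nuc C1) p \<noteq> 0" "cr (nuc C2) p \<noteq> 0" "cr (nuc C3) p \<noteq> 0"
      using pt_eqI[OF _ _ p(1)] nuc_nz eq P(5) p(2) by metis+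
    obtain y where y: "cr p y \<noteq> 0" using ex_second[OF p(1)] .
    obtain z where d: "det3 p y z \<noteq> 0" using ex_third[OF y] .
    show False using pencil(2)[OF d Cp N] P(1) p(2) by simp
  qed
  have le: "card (?A \<union> ?B \<union> ?D) \<le> 96 * q' + 3" using card_Un3[of ?A ?B ?D] conic_card by simp
  have "card K \<le> card ((?A \<union> ?B \<union> ?D) \<union> (K - (?A \<union> ?B \<union> ?D)))" by (intro card_mono) auto
  also have "\<dots> \<le> card (?A \<union> ?B \<union> ?D) + card (K - (?A \<union> ?B \<union> ?D))" by (rule card_Un_le)
  finally have 1: "96 * q' + 4 \<le> card (?A \<union> ?B \<union> ?D) + card (K - (?A \<union> ?B \<union> ?D))" using card_K by simp
  then have "K - (?A \<union> ?B \<union> ?D) \<noteq> {}" using le by (intro notI) simp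
  then have "K - (?A \<union> ?B \<union> ?D) = {pt (nuc C1)}" using sub by blast
  then show "pt (nuc C1) \<in> M" using cover by blast
  have "card (K - (?A \<union> ?B \<union> ?D)) \<le> card {pt (nuc C1)}" using sub by (intro card_mono) auto
  then have ge: "96 * q' + 3 \<le> card (?A \<union> ?B \<union> ?D)" using 1 by simp
  have i1: "card ?A + card ?B = card (?A \<union> ?B) + card (?A \<inter> ?B)" by (rule card_Un_Int) simp_all
  have i2: "card (?A \<union> ?B) + card ?D = card (?A \<union> ?B \<union> ?D) + card ((?A \<union> ?B) \<inter> ?D)" by (rule card_Un_Int) simp_all
  have "card (?A \<inter> ?B) = 0" "card ((?A \<union> ?B) \<inter> ?D) = 0" using i1 i2 ge conic_card by linarith+
  then have "?A \<inter> ?B = {}" "(?A \<union> ?B) \<inter> ?D = {}" by (simp_all only: card_0_eq finite)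
  then show "?A \<inter> ?B = {}" "?A \<inter> ?D = {}" "?B \<inter> ?D = {}" by blast+
qed

end

lemma three_conics_permute:
  assumes "three_conics K C1 C2 C3 M q'"
  shows "three_conics K C2 C1 C3 M q'" "three_conics K C3 C1 C2 M q'"
  using assms unfolding three_conics_def by (simp_all add: Un_ac)

text \<open>By symmetry each of the three nuclei coincides with another one, and then all three
  coincide.\<close>

theorem three_conics_common_nucleus:
  assumes t: "three_conics K C1 C2 C3 M q'"
  shows "pt (nuc C2) = pt (nuc C1)" "pt (nuc C3) = pt (nuc C1)"
proof -
  note nz = three_conics.nuc_nz[OF t]
  have iff: "cr (nuc C1) (nuc C2) = 0 \<longleftrightarrow> pt (nuc C1) = pt (nuc C2)" "cr (nuc C1) (nuc C3) = 0 \<longleftrightarrow> pt (nuc C1) = pt (nuc C3)"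
    "cr (nuc C2) (nuc C1) = 0 \<longleftrightarrow> pt (nuc C2) = pt (nuc C1)" "cr (nuc C2) (nuc C3) = 0 \<longleftrightarrow> pt (nuc C2) = pt (nuc C3)"
    "cr (nuc C3) (nuc C1) = 0 \<longleftrightarrow> pt (nuc C3) = pt (nuc C1)" "cr (nuc C3) (nuc C2) = 0 \<longleftrightarrow> pt (nuc C3) = pt (nuc C2)"
    using pt_eq_iff nz by metis+
  have "pt (nuc C1) = pt (nuc C2) \<or> pt (nuc C1) = pt (nuc C3)"
    "pt (nuc C2) = pt (nuc C1) \<or> pt (nuc C2) = pt (nuc C3)"
    "pt (nuc C3) = pt (nuc C1) \<or> pt (nuc C3) = pt (nuc C2)"
    using three_conics.nucleus_not_isolated[OF t] three_conics.nucleus_not_isolated[OF three_conics_permute(1)[OF t]]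
      three_conics.nucleus_not_isolated[OF three_conics_permute(2)[OF t]] unfolding iff by blast+
  then show "pt (nuc C2) = pt (nuc C1)" "pt (nuc C3) = pt (nuc C1)" by auto
qed

section \<open>Components of a curve of degree 7\<close>

lemma arc_points_on_linear_component:
  fixes K :: "('a::{field,finite} ^ 3) set set"
  assumes K: "maximal_arc4 K" and L: "L \<in> forms 1" "L \<noteq> 0"
  shows "card (K \<inter> curve_points L) \<le> 4"
proof -
  define w :: "'a ^ 3" where "w = vector [cf L 1 0 0, cf L 0 1 0, cf L 0 0 1]"
  have eL: "eval3 L v = dot3 w v" for v
    unfolding eval3_conv_ev ev_forms_1[OF L(1) ring_hom_fun_id] by (simp add: w_def dot3_def)
  have "w \<noteq> 0"
  proof
    assume "w = 0"
    then have z: "cf L 1 0 0 = 0" "cf L 0 1 0 = 0" "cf L 0 0 1 = 0" by (simp_all add: w_def vec3_eq_iff)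
    have "lookup L m = 0" for m
    proof (cases "mdeg m = 1")
      case True
      let ?a = "lookup m 1" and ?b = "lookup m 2" and ?c = "lookup m 3"
      have "m = single 1 ?a + single 2 ?b + single 3 ?c"
        by (rule poly_mapping_3_eqI) (simp_all add: lookup_add lookup_single)
      then have m: "lookup L m = cf L ?a ?b ?c" by (simp add: cf_def)
      have "?a + ?b + ?c = 1" using True by (simp add: mdeg_3)
      then consider "?a = 1 \<and> ?b = 0 \<and> ?c = 0" | "?a = 0 \<and> ?b = 1 \<and> ?c = 0" | "?a = 0 \<and> ?b = 0 \<and> ?c = 1" by linarith
      then show ?thesis using z m by cases simp_all
    next
      case False
      then show ?thesis using L(1) by (auto simp: forms_def in_keys_iff)
    qed
    then have "L = 0" by (intro poly_mapping_eqI) simp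
    then show False using L(2) by simp
  qed
  moreover have "K \<inter> curve_points L \<subseteq> {P \<in> K. \<forall>v\<in>P. dot3 w v = 0}"
    by (auto simp: curve_points_def eL)
  then have "card (K \<inter> curve_points L) \<le> card {P \<in> K. \<forall>v\<in>P. dot3 w v = 0}" by (intro card_mono) auto
  ultimately show ?thesis using arc_points_on_line[OF K, of w] by linarith
qed

lemma eval3_prod_list_eq_0: "eval3 (prod_list Gs) v = 0 \<Longrightarrow> \<exists>G\<in>set Gs. eval3 G v = 0"
  by (induction Gs) (auto simp: eval3_1 eval3_mult)

lemma prod_list_filter:
  "prod_list (map f (filter P xs)) * prod_list (map f (filter (\<lambda>x. \<not> P x) xs)) = (prod_list (map f xs) :: 'b::comm_monoid_mult)"
  by (induction xs) (auto simp: mult_ac)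

lemma sum_list_filter:
  "sum_list (map f (filter P xs)) + sum_list (map f (filter (\<lambda>x. \<not> P x) xs)) = (sum_list (map f xs) :: nat)"
  by (induction xs) auto

lemma card_UN_list_le:
  assumes "\<And>x. x \<in> set xs \<Longrightarrow> card (A x) \<le> k"
  shows "card (\<Union>x\<in>set xs. A x) \<le> k * length xs"
  using assms
proof (induction xs)
  case (Cons x xs)
  have "card (\<Union>x\<in>set (x # xs). A x) \<le> card (A x) + card (\<Union>x\<in>set xs. A x)" by (simp add: card_Un_le)
  then show ?case using Cons.IH Cons.prems[of x] Cons.prems by fastforce
qed simp

text \<open>Entries of size at least 2 with sum at most 7 number at most three; if there are two,
  neither exceeds 7 - 2.\<close>

lemma components_cases:
  assumes "sum_list (map snd xs) \<le> (7::nat)" "\<And>x. x \<in> set xs \<Longrightarrow> 2 \<le> snd x"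
  obtains "length xs \<le> 1" | a b where "xs = [a, b]" "snd a \<le> 5" "snd b \<le> 5" | a b c where "xs = [a, b, c]"
proof -
  have "length xs * 2 \<le> sum_list (map snd xs)"
    using assms(2) by (induction xs) fastforce+
  then have "length xs \<le> 3" using assms(1) by linarith
  then consider "length xs \<le> 1" | "length xs = 2" | "length xs = 3" by linarith
  then show thesis
  proof cases
    case 2
    then obtain a b where "xs = [a, b]" by (auto simp: numeral_2_eq_2 length_Suc_conv)
    moreover from this have "snd a \<le> 5" "snd b \<le> 5" using assms(1) assms(2)[of a] assms(2)[of b] by simp_all
    ultimately show thesis by (rule that(2))
  next
    case 3
    then obtain a b c where "xs = [a, b, c]" by (auto simp: numeral_3_eq_3 length_Suc_conv)
    then show thesis using that(3) by blast
  qed (rule that(1))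
qed

theorem theorem5p1:
  fixes K :: "('a::{field,finite} ^ 3) set set"
    and \<Gamma> :: "'a poly3"
  assumes "CARD('a) > 6 ^ 4"
    and "maximal_arc4 K"
    and "plane_curve 7 \<Gamma>"
    and "K \<subseteq> curve_points \<Gamma>"
  shows "\<exists>C1 C2 C3 L N.
           \<Gamma> = C1 * C2 * C3 * L \<and>
           nondegenerate_conic C1 \<and> nondegenerate_conic C2 \<and> nondegenerate_conic C3 \<and>
           curve_points C1 \<inter> curve_points C2 = {} \<and>
           curve_points C1 \<inter> curve_points C3 = {} \<and>
           curve_points C2 \<inter> curve_points C3 = {} \<and>
           is_nucleus C1 N \<and> is_nucleus C2 N \<and> is_nucleus C3 N \<and>
           plane_curve 1 L \<and> N \<in> curve_points L"
proof -
  note K = assms(2)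
  have \<Gamma>: "\<Gamma> \<in> forms 7" "\<Gamma> \<noteq> 0" using assms(3) by (simp_all add: plane_curve_iff)
  have "4 dvd CARD('a)" using K assms(1) by (intro maximal_arc4_even) simp_all
  then have "even CARD('a)" by (rule dvd_trans[rotated]) simp
  then have char: "(1::'a) + 1 = 0" by (rule even_card_imp_char2)
  obtain q' where q: "CARD('a) = 32 * q'" "64 \<le> q'" using char2_card_32[OF char assms(1)] .
  have q2: "CARD('a) > 2" using q by simp
  have cK: "card K = 96 * q' + 4" using K q by (simp add: maximal_arc4_def)
  obtain Fs where Fs: "\<Gamma> = prod_list (map fst Fs)" "sum_list (map snd Fs) = 7"
    "\<forall>(G, k)\<in>set Fs. G \<in> forms k \<and> irreducible G"
    using forms_irreducible_factorization[OF \<Gamma>] by auto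
  define lin where "lin = filter (\<lambda>x. snd x = 1) Fs"
  define non where "non = filter (\<lambda>x. snd x \<noteq> 1) Fs"
  have prod: "\<Gamma> = prod_list (map fst lin) * prod_list (map fst non)"
    unfolding lin_def non_def prod_list_filter Fs(1) ..
  have sum: "sum_list (map snd lin) + sum_list (map snd non) = 7"
    unfolding lin_def non_def sum_list_filter Fs(2) ..
  have fs: "fst x \<in> forms (snd x)" "irreducible (fst x)" if "x \<in> set Fs" for x
    using Fs(3) that by (auto simp: case_prod_beta)
  have non: "fst x \<in> forms (snd x)" "irreducible (fst x)" "2 \<le> snd x" if "x \<in> set non" for x
    using fs[of x] irreducible_degree_pos[OF fs[of x]] that by (auto simp: non_def)
  have lin: "fst x \<in> forms 1" "fst x \<noteq> 0" if "x \<in> set lin" for x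
    using fs[of x] that by (auto simp: lin_def)
  have slin: "sum_list (map snd lin) = length lin"
  proof -
    have "map snd lin = map (\<lambda>_. 1) lin" by (rule map_cong) (auto simp: lin_def)
    then show ?thesis by (simp add: map_replicate_const sum_list_replicate)
  qed
  define M where "M = (\<Union>x\<in>set lin. K \<inter> curve_points (fst x))"
  have M: "M \<subseteq> K" by (auto simp: M_def)
  have cM: "card M \<le> 4 * length lin"
    unfolding M_def using arc_points_on_linear_component[OF K] lin by (intro card_UN_list_le) blast
  have cover: "K \<subseteq> (\<Union>x\<in>set non. curve_points (fst x)) \<union> M"
  proof
    fix P assume P: "P \<in> K"
    then obtain v where v: "v \<noteq> 0" "P = pt v" "eval3 \<Gamma> v = 0" using assms(4) curve_pointsE by blast
    then obtain x where x: "x \<in> set Fs" "eval3 (fst x) v = 0" using eval3_prod_list_eq_0[of "map fst Fs" v] Fs(1) by auto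
    then have "P \<in> curve_points (fst x)" using v pt_in_curve_points[OF fs(1)] by blast
    moreover have "x \<in> set lin \<or> x \<in> set non" using x(1) by (auto simp: lin_def non_def)
    ultimately show "P \<in> (\<Union>x\<in>set non. curve_points (fst x)) \<union> M" using P by (auto simp: M_def)
  qed
  \<comment> \<open>There are at most 7 linear factors with at most 4 points of the arc on each,
    hence 28.\<close>
  have cK_le: "96 * q' + 4 \<le> card (\<Union>x\<in>set non. curve_points (fst x)) + 28"
  proof -
    have "card K \<le> card ((\<Union>x\<in>set non. curve_points (fst x)) \<union> M)" by (intro card_mono cover) simp
    also have "\<dots> \<le> card (\<Union>x\<in>set non. curve_points (fst x)) + card M" by (rule card_Un_le)
    finally show ?thesis using cK cM slin sum by linarith
  qed
  have bound7: "card (curve_points (fst x)) \<le> 63 * q' + 63" if x: "x \<in> set non" "snd x \<le> 7" for x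
  proof (cases "snd x = 2")
    case True
    then show ?thesis using card_irreducible_conic_le[OF char q2, of "fst x"] non[OF x(1)] q by simp
  next
    case False
    then show ?thesis using stepanov_curve(2)[OF char q non(1,2)[OF x(1)]] non(3)[OF x(1)] x(2) by simp
  qed
  have bound5: "card (curve_points (fst x)) \<le> 45 * q' + 63" if x: "x \<in> set non" "snd x \<le> 5" for x
  proof (cases "snd x = 2")
    case True
    then show ?thesis using card_irreducible_conic_le[OF char q2, of "fst x"] non[OF x(1)] q by simp
  next
    case False
    then show ?thesis using stepanov_curve(1)[OF char q non(1,2)[OF x(1)]] non(3)[OF x(1)] x(2) by simp
  qed
  have "sum_list (map snd non) \<le> 7" using sum by linarith
  then consider "length non \<le> 1" | a b where "non = [a, b]" "snd a \<le> 5" "snd b \<le> 5" | a b c where "non = [a, b, c]"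
    using components_cases[of non] non(3) by blast
  then show ?thesis
  proof cases
    \<comment> \<open>A single nonlinear component leaves 96 q' + 4 <= 63 q' + 63 + 28, impossible
      for q' >= 64. For two components the corresponding bound is 2 (45 q' + 63) + 28.\<close>
    case 1
    have "card (\<Union>x\<in>set non. curve_points (fst x)) \<le> (63 * q' + 63) * length non"
    proof (rule card_UN_list_le)
      fix x assume x: "x \<in> set non"
      then have "snd x \<le> sum_list (map snd non)" by (intro member_le_sum_list) auto
      then show "card (curve_points (fst x)) \<le> 63 * q' + 63" using bound7[OF x] sum by linarith
    qed
    also have "\<dots> \<le> (63 * q' + 63) * 1" using 1 by (rule mult_le_mono2)
    finally have "96 * q' + 4 \<le> 63 * q' + 63 + 28" using cK_le by simp
    then show ?thesis using q(2) by simp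
  next
    case (2 a b)
    have "card (\<Union>x\<in>set non. curve_points (fst x)) \<le> card (curve_points (fst a)) + card (curve_points (fst b))"
      unfolding 2(1) by (simp add: card_Un_le)
    then show ?thesis using cK_le bound5[of a] bound5[of b] 2 q(2) by simp
  next
    case (3 a b c)
    have f: "fst a \<in> forms (snd a)" "irreducible (fst a)" "2 \<le> snd a"
      "fst b \<in> forms (snd b)" "irreducible (fst b)" "2 \<le> snd b"
      "fst c \<in> forms (snd c)" "irreducible (fst c)" "2 \<le> snd c"
      using non[of a] non[of b] non[of c] 3 by simp_all
    have s: "length lin + (snd a + snd b + snd c) = 7" using sum slin 3 by simp
    have cover3: "K \<subseteq> curve_points (fst a) \<union> curve_points (fst b) \<union> curve_points (fst c) \<union> M"
      using cover 3 by auto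
    \<comment> \<open>Three degrees that are at least 2 and add up to 7 are 2, 2, 3 in some order.
      With a linear factor present they must all be 2, and there is just one line.\<close>
    show ?thesis
    proof (cases "length lin = 0")
      case True
      then have "M = {}" by (simp add: M_def)
      with cover3 have cover: "K \<subseteq> curve_points (fst a) \<union> curve_points (fst b) \<union> curve_points (fst c)"
        "K \<subseteq> curve_points (fst a) \<union> curve_points (fst c) \<union> curve_points (fst b)"
        "K \<subseteq> curve_points (fst b) \<union> curve_points (fst c) \<union> curve_points (fst a)" by auto
      consider "snd a = 2 \<and> snd b = 2 \<and> snd c = 3" | "snd a = 2 \<and> snd b = 3 \<and> snd c = 2"
        | "snd a = 3 \<and> snd b = 2 \<and> snd c = 2" using s True f(3,6,9) by linarith
      then have False
      proof cases
        case 1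
        then show False using no_two_conics_and_cubic[OF char q K _ _ _ _ _ _ cover(1)] f by simp
      next
        case 2
        then show False using no_two_conics_and_cubic[OF char q K _ _ _ _ _ _ cover(2)] f by simp
      next
        case 3
        then show False using no_two_conics_and_cubic[OF char q K _ _ _ _ _ _ cover(3)] f by simp
      qed
      then show ?thesis ..
    next
      case False
      then have sn: "snd a = 2" "snd b = 2" "snd c = 2" "length lin = 1" using s f(3,6,9) by linarith+
      then obtain x where x: "lin = [x]" by (auto simp: length_Suc_conv)
      have C: "fst a \<in> forms 2" "fst b \<in> forms 2" "fst c \<in> forms 2" using f sn by simp_all
      have t: "three_conics K (fst a) (fst b) (fst c) M q'"
        using char q K C f cover3 M cM sn(4) by unfold_locales simp_all
      interpret t: three_conics K "fst a" "fst b" "fst c" M q' by (rule t)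
      note eq = three_conics_common_nucleus[OF t]
      have "M \<subseteq> curve_points (fst x)" by (auto simp: M_def x)
      then have N: "pt (nuc (fst a)) \<in> curve_points (fst x)" using t.common_nucleus_conclusion(1)[OF eq] by blast
      have "\<Gamma> = fst a * fst b * fst c * fst x" unfolding prod 3 x by (simp add: mult_ac)
      moreover have "plane_curve 1 (fst x)" using lin[of x] x by (simp add: plane_curve_iff)
      moreover have "is_nucleus (fst a) (pt (nuc (fst a)))" "is_nucleus (fst b) (pt (nuc (fst a)))"
        "is_nucleus (fst c) (pt (nuc (fst a)))"
        using conic_nucleus[OF char C(1) t.nuc_off(1)] conic_nucleus[OF char C(2) t.nuc_off(2)]
          conic_nucleus[OF char C(3) t.nuc_off(3)] eq by simp_all
      moreover have "nondegenerate_conic (fst a)" "nondegenerate_conic (fst b)" "nondegenerate_conic (fst c)"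
        using conic_nondegenerate[OF char C(1) t.nuc_off(1)] conic_nondegenerate[OF char C(2) t.nuc_off(2)]
          conic_nondegenerate[OF char C(3) t.nuc_off(3)] by simp_all
      ultimately show ?thesis
        using N t.common_nucleus_conclusion(2-4)[OF eq] by blast
    qed
  qed
qed

end
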